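(* Let $a\in(0,1)\cup(1,\infty)$, $b\in\mathbb{C}_+$, and $\psi(w)=aw+b$ for $w\in\mathbb{C}_+$. (1) If $a>1$, then $C_\psi-\lambda I$ is universal on $H^2(\mathbb{C}_+)$ for every $\lambda\in\mathbb{C}$ with $0<|\lambda|<a^{-1/2}$, and $\{\lambda\in\mathbb{C}:0<|\lambda|<a^{-1/2}\}\subset\sigma_p(C_\psi)$. (2) If $a<1$, then $C_\psi-\lambda I$ is not universal on $H^2(\mathbb{C}_+)$ for any $\lambda\in\mathbb{C}$, and $\sigma_p(C_\psi)=\emptyset$. (3) In both cases $\sigma(C_\psi)=\{\lambda\in\mathbb{C}:|\lambda|\le a^{-1/2}\}$.
   Context: $\mathbb{C}_+=\{w\in\mathbb{C}:\mathrm{Re}(w)>0\}$. $H^2(\mathbb{C}_+)$ is the Hilbert space of analytic functions $f$ on $\mathbb{C}_+$ with $\|f\|^2=\sup_{0<x<\infty}\int_{-\infty}^\infty|f(x+iy)|^2\,dy<\infty$. $C_\psi f=f\circ\psi$ is the (bounded) composition operator. $\sigma$ and $\sigma_p$ denote the spectrum and the point spectrum. A bounded linear operator $U$ on a Hilbert space $\mathcal{H}$ is universal on $\mathcal{H}$ if for every bounded linear operator $T$ on $\mathcal{H}$ there exist $\alpha\neq 0$ and a closed subspace $\mathcal{M}\subset\mathcal{H}$ with $U\mathcal{M}\subset\mathcal{M}$ such that $U|_{\mathcal{M}}$ is similar to $\alpha T$. *)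

theory Defs
  imports "HOL-Complex_Analysis.Complex_Analysis"
begin

section \<open>Complex normed spaces and bounded operators\<close>

class complex_normed_vector = real_normed_vector +
  fixes scaleC :: "complex \<Rightarrow> 'a \<Rightarrow> 'a"  (infixr \<open>*\<^sub>C\<close> 75)
  assumes scaleC_add_right: "c *\<^sub>C (x + y) = c *\<^sub>C x + c *\<^sub>C y"
    and scaleC_add_left: "(c + d) *\<^sub>C x = c *\<^sub>C x + d *\<^sub>C x"
    and scaleC_scaleC: "c *\<^sub>C d *\<^sub>C x = (c * d) *\<^sub>C x"
    and scaleC_of_real: "complex_of_real r *\<^sub>C x = r *\<^sub>R x"
    and norm_scaleC: "norm (c *\<^sub>C x) = cmod c * norm x"

definition bounded_clinear :: "('a::complex_normed_vector \<Rightarrow> 'b::complex_normed_vector) \<Rightarrow> bool" where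
  "bounded_clinear T \<longleftrightarrow> bounded_linear T \<and> (\<forall>c x. T (c *\<^sub>C x) = c *\<^sub>C T x)"

definition csubspace :: "'a::complex_normed_vector set \<Rightarrow> bool" where
  "csubspace M \<longleftrightarrow> subspace M \<and> (\<forall>c. \<forall>x\<in>M. c *\<^sub>C x \<in> M)"

definition spectrum :: "('a::complex_normed_vector \<Rightarrow> 'a) \<Rightarrow> complex set" where
  "spectrum T = {l. \<not> (\<exists>S. bounded_clinear S \<and>
      (\<forall>x. S (T x - l *\<^sub>C x) = x) \<and> (\<forall>x. T (S x) - l *\<^sub>C S x = x))}"

definition point_spectrum :: "('a::complex_normed_vector \<Rightarrow> 'a) \<Rightarrow> complex set" where
  "point_spectrum T = {l. \<exists>x. x \<noteq> 0 \<and> T x = l *\<^sub>C x}"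

text \<open>The restriction of \<open>U\<close> to the invariant subspace \<open>M\<close> is similar to the operator \<open>T\<close> of the
  whole space: \<open>X\<close> is an isomorphism onto \<open>M\<close> with bounded inverse \<open>Y\<close>, and \<open>U X = X T\<close>.
  Linearity of \<open>Y\<close> on \<open>M\<close> is automatic.\<close>

definition restriction_similar ::
  "('a::complex_normed_vector \<Rightarrow> 'a) \<Rightarrow> 'a set \<Rightarrow> ('b::complex_normed_vector \<Rightarrow> 'b) \<Rightarrow> bool" where
  "restriction_similar U M T \<longleftrightarrow>
    (\<exists>X Y. bounded_clinear X \<and> (\<forall>x. X x \<in> M) \<and>
      (\<forall>x. Y (X x) = x) \<and> (\<forall>y\<in>M. X (Y y) = y) \<and> (\<exists>K. \<forall>y\<in>M. norm (Y y) \<le> K * norm y) \<and>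
      (\<forall>x. U (X x) = X (T x)))"

text \<open>The notion is intended for Hilbert spaces, but it involves only the norm.\<close>

definition universal :: "('a::complex_normed_vector \<Rightarrow> 'a) \<Rightarrow> bool" where
  "universal U \<longleftrightarrow> bounded_clinear U \<and>
    (\<forall>T :: 'a \<Rightarrow> 'a. bounded_clinear T \<longrightarrow>
      (\<exists>\<alpha> M. \<alpha> \<noteq> 0 \<and> csubspace M \<and> closed M \<and> U ` M \<subseteq> M \<and>
        restriction_similar U M (\<lambda>x. \<alpha> *\<^sub>C T x)))"


section \<open>The Hardy space of the right half-plane\<close>

definition right_half_plane :: "complex set" where
  "right_half_plane = {w. Re w > 0}"

definition line_integral :: "(complex \<Rightarrow> complex) \<Rightarrow> real \<Rightarrow> ennreal" where
  "line_integral f x = (\<integral>\<^sup>+y. ennreal ((cmod (f (Complex x y)))\<^sup>2) \<partial>lborel)"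

definition h2_normsq :: "(complex \<Rightarrow> complex) \<Rightarrow> ennreal" where
  "h2_normsq f = (SUP x\<in>{0<..}. line_integral f x)"

text \<open>Functions on the half-plane are represented by their extensions by zero, so that equality of
  functions on the half-plane is equality of the representatives.\<close>

definition h2_functions :: "(complex \<Rightarrow> complex) set" where
  "h2_functions = {f. f holomorphic_on right_half_plane \<and>
     (\<forall>w. w \<notin> right_half_plane \<longrightarrow> f w = 0) \<and> h2_normsq f < \<infinity>}"

lemma Complex_in_rhp [simp]: "Complex x y \<in> right_half_plane \<longleftrightarrow> x > 0"
  by (simp add: right_half_plane_def)

lemma open_rhp: "open right_half_plane"
  unfolding right_half_plane_def by (rule open_halfspace_Re_gt)

lemma line_continuous:
  assumes "f holomorphic_on right_half_plane" "x > 0"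
  shows "continuous_on UNIV (\<lambda>y. f (Complex x y))"
proof (rule continuous_on_compose2[where f = "Complex x"])
  show "continuous_on right_half_plane f"
    using assms holomorphic_on_imp_continuous_on by blast
  show "continuous_on UNIV (Complex x)"
    unfolding complex_eq by (intro continuous_intros)
  show "range (Complex x) \<subseteq> right_half_plane"
    using assms by auto
qed

lemma line_measurable:
  assumes "f holomorphic_on right_half_plane" "x > 0"
  shows "(\<lambda>y. f (Complex x y)) \<in> borel_measurable borel"
  using line_continuous[OF assms] by (rule borel_measurable_continuous_onI)

lemma line_integral_le: "x > 0 \<Longrightarrow> line_integral f x \<le> h2_normsq f"
  unfolding h2_normsq_def by (rule SUP_upper) auto

lemma h2_functions_line_finite:
  assumes "f \<in> h2_functions" "x > 0" shows "line_integral f x < \<infinity>"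
  using assms line_integral_le[of x f] unfolding h2_functions_def by auto

lemma ennreal_le_if_power2_le:
  assumes "t\<^sup>2 \<le> (ennreal c)\<^sup>2" "c \<ge> 0"
  shows "t \<le> ennreal c"
proof (cases t)
  case (real r)
  with assms have "ennreal (r\<^sup>2) \<le> ennreal (c\<^sup>2)" by (simp add: ennreal_power)
  then have "r\<^sup>2 \<le> c\<^sup>2" by simp
  then have "r \<le> c" using assms(2) by (rule power2_le_imp_le)
  then show ?thesis using real by (simp add: ennreal_leI)
next
  case top
  with assms show ?thesis by (simp add: ennreal_power top_unique)
qed

lemma line_integral_add:
  assumes "f holomorphic_on right_half_plane" "g holomorphic_on right_half_plane" "x > 0"
    and "line_integral f x \<le> ennreal (A\<^sup>2)" "line_integral g x \<le> ennreal (B\<^sup>2)" "A \<ge> 0" "B \<ge> 0"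
  shows "line_integral (\<lambda>w. f w + g w) x \<le> ennreal ((A + B)\<^sup>2)"
proof -
  define F where "F y = cmod (f (Complex x y))" for y
  define G where "G y = cmod (g (Complex x y))" for y
  have [measurable]: "(\<lambda>y. f (Complex x y)) \<in> borel_measurable borel"
      "(\<lambda>y. g (Complex x y)) \<in> borel_measurable borel"
    using assms line_measurable by blast+
  have [measurable]: "F \<in> borel_measurable borel" "G \<in> borel_measurable borel"
    unfolding F_def G_def by measurable
  have nn: "F y \<ge> 0" "G y \<ge> 0" for y by (auto simp: F_def G_def)
  have FF: "(\<integral>\<^sup>+y. (ennreal (F y))\<^sup>2 \<partial>lborel) \<le> ennreal (A\<^sup>2)"
    using assms(4) by (simp only: line_integral_def F_def ennreal_power norm_ge_zero)
  have GG: "(\<integral>\<^sup>+y. (ennreal (G y))\<^sup>2 \<partial>lborel) \<le> ennreal (B\<^sup>2)"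
    using assms(5) by (simp only: line_integral_def G_def ennreal_power norm_ge_zero)
  have "(\<integral>\<^sup>+y. ennreal (F y) * ennreal (G y) \<partial>lborel)\<^sup>2
      \<le> (\<integral>\<^sup>+y. (ennreal (F y))\<^sup>2 \<partial>lborel) * (\<integral>\<^sup>+y. (ennreal (G y))\<^sup>2 \<partial>lborel)"
    by (rule Cauchy_Schwarz_nn_integral) auto
  also have "\<dots> \<le> ennreal (A\<^sup>2) * ennreal (B\<^sup>2)"
    by (rule mult_mono[OF FF GG]) auto
  also have "\<dots> = (ennreal (A * B))\<^sup>2"
    using assms(6,7) by (simp add: ennreal_mult power_mult_distrib flip: ennreal_power)
  finally have FG: "(\<integral>\<^sup>+y. ennreal (F y) * ennreal (G y) \<partial>lborel) \<le> ennreal (A * B)"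
    using assms(6,7) by (intro ennreal_le_if_power2_le) auto
  have "line_integral (\<lambda>w. f w + g w) x
      \<le> (\<integral>\<^sup>+y. (ennreal (F y))\<^sup>2 + (ennreal (G y))\<^sup>2 + 2 * (ennreal (F y) * ennreal (G y)) \<partial>lborel)"
    unfolding line_integral_def
  proof (rule nn_integral_mono)
    fix y
    have "(cmod (f (Complex x y) + g (Complex x y)))\<^sup>2 \<le> (F y + G y)\<^sup>2"
      by (simp add: F_def G_def norm_triangle_ineq power_mono)
    also have "\<dots> = (F y)\<^sup>2 + (G y)\<^sup>2 + 2 * (F y * G y)"
      by (simp add: power2_sum)
    finally have "ennreal ((cmod (f (Complex x y) + g (Complex x y)))\<^sup>2)
        \<le> ennreal ((F y)\<^sup>2 + (G y)\<^sup>2 + 2 * (F y * G y))"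
      by (rule ennreal_leI)
    also have "\<dots> = (ennreal (F y))\<^sup>2 + (ennreal (G y))\<^sup>2 + 2 * (ennreal (F y) * ennreal (G y))"
      using nn by (simp add: ennreal_mult ennreal_power ennreal_plus)
    finally show "ennreal ((cmod (f (Complex x y) + g (Complex x y)))\<^sup>2)
        \<le> (ennreal (F y))\<^sup>2 + (ennreal (G y))\<^sup>2 + 2 * (ennreal (F y) * ennreal (G y))" .
  qed
  also have "\<dots> = (\<integral>\<^sup>+y. (ennreal (F y))\<^sup>2 \<partial>lborel) + (\<integral>\<^sup>+y. (ennreal (G y))\<^sup>2 \<partial>lborel)
      + 2 * (\<integral>\<^sup>+y. ennreal (F y) * ennreal (G y) \<partial>lborel)"
    by (simp add: nn_integral_add nn_integral_cmult)
  also have "\<dots> \<le> ennreal (A\<^sup>2) + ennreal (B\<^sup>2) + 2 * ennreal (A * B)"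
    by (intro add_mono mult_mono FF GG FG) auto
  also have "\<dots> = ennreal ((A + B)\<^sup>2)"
  proof -
    have "ennreal ((A + B)\<^sup>2) = ennreal (A\<^sup>2 + B\<^sup>2 + 2 * (A * B))"
      by (simp add: power2_sum mult.assoc)
    also have "\<dots> = ennreal (A\<^sup>2) + ennreal (B\<^sup>2) + ennreal (2 * (A * B))"
      using assms(6,7) by (simp add: ennreal_plus)
    also have "ennreal (2 * (A * B)) = 2 * ennreal (A * B)"
      using assms(6,7) by (simp only: ennreal_mult' ennreal_numeral zero_le_numeral)
    finally show ?thesis by simp
  qed
  finally show ?thesis .
qed

lemma h2_normsq_root:
  assumes "f \<in> h2_functions"
  shows "ennreal ((sqrt (enn2real (h2_normsq f)))\<^sup>2) = h2_normsq f"
  using assms by (simp add: h2_functions_def less_top)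

lemma h2_normsq_add:
  assumes "f \<in> h2_functions" "g \<in> h2_functions"
  shows "h2_normsq (\<lambda>w. f w + g w)
    \<le> ennreal ((sqrt (enn2real (h2_normsq f)) + sqrt (enn2real (h2_normsq g)))\<^sup>2)"
  unfolding h2_normsq_def[of "\<lambda>w. f w + g w"]
proof (rule SUP_least)
  fix x :: real assume "x \<in> {0<..}"
  then have "x > 0" by simp
  then show "line_integral (\<lambda>w. f w + g w) x
      \<le> ennreal ((sqrt (enn2real (h2_normsq f)) + sqrt (enn2real (h2_normsq g)))\<^sup>2)"
    using assms line_integral_le h2_normsq_root[OF assms(1)] h2_normsq_root[OF assms(2)]
    by (intro line_integral_add) (auto simp: h2_functions_def)
qed

lemma h2_add_closed:
  assumes "f \<in> h2_functions" "g \<in> h2_functions"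
  shows "(\<lambda>w. f w + g w) \<in> h2_functions"
proof -
  have "h2_normsq (\<lambda>w. f w + g w) < \<infinity>"
    using h2_normsq_add[OF assms] by (metis ennreal_less_top infinity_ennreal_def le_less_trans)
  then show ?thesis
    using assms by (auto simp: h2_functions_def intro!: holomorphic_intros)
qed

lemma h2_normsq_scale:
  assumes "f \<in> h2_functions"
  shows "h2_normsq (\<lambda>w. c * f w) = ennreal ((cmod c)\<^sup>2) * h2_normsq f"
proof -
  have "line_integral (\<lambda>w. c * f w) x = ennreal ((cmod c)\<^sup>2) * line_integral f x" if "x > 0" for x
  proof -
    have [measurable]: "(\<lambda>y. f (Complex x y)) \<in> borel_measurable borel"
      using assms that line_measurable by (auto simp: h2_functions_def)
    show ?thesis
      by (simp add: line_integral_def norm_mult power_mult_distrib ennreal_mult nn_integral_cmult)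
  qed
  then have "h2_normsq (\<lambda>w. c * f w) = (SUP x\<in>{0<..}. ennreal ((cmod c)\<^sup>2) * line_integral f x)"
    unfolding h2_normsq_def by (intro SUP_cong) auto
  then show ?thesis
    unfolding h2_normsq_def by (simp add: SUP_mult_left_ennreal)
qed

lemma h2_scale_closed:
  assumes "f \<in> h2_functions"
  shows "(\<lambda>w. c * f w) \<in> h2_functions"
  using assms h2_normsq_scale[OF assms, of c]
  by (auto simp: h2_functions_def ennreal_mult_less_top intro!: holomorphic_intros)

lemma h2_zero_closed: "(\<lambda>w. 0) \<in> h2_functions"
  by (simp add: h2_functions_def h2_normsq_def line_integral_def)

lemma h2_normsq_eq_0:
  assumes "f \<in> h2_functions" "h2_normsq f = 0"
  shows "f = (\<lambda>w. 0)"
proof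
  fix w
  show "f w = 0"
  proof (cases "w \<in> right_half_plane")
    case False
    then show ?thesis using assms by (simp add: h2_functions_def)
  next
    case True
    define x where "x = Re w"
    have x: "x > 0" using True by (simp add: right_half_plane_def x_def)
    have hol: "f holomorphic_on right_half_plane" using assms by (simp add: h2_functions_def)
    have cont: "continuous_on UNIV (\<lambda>y. f (Complex x y))"
      using line_continuous[OF hol x] .
    have [measurable]: "(\<lambda>y. f (Complex x y)) \<in> borel_measurable borel"
      using line_measurable[OF hol x] .
    have "line_integral f x = 0"
      using line_integral_le[OF x, of f] assms by simp
    then have "AE y in lborel. ennreal ((cmod (f (Complex x y)))\<^sup>2) = 0"
      unfolding line_integral_def by (subst (asm) nn_integral_0_iff_AE) auto
    then have ae: "AE y in lborel. f (Complex x y) = 0" by simp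
    have "closed {y. f (Complex x y) = 0}"
      using continuous_closed_preimage_constant[OF cont, of 0] by simp
    moreover have "AE y in lebesgue. y \<in> {y. f (Complex x y) = 0}"
      using ae by (auto intro: AE_completion)
    ultimately have "Im w \<in> {y. f (Complex x y) = 0}"
      by (rule mem_closed_if_AE_lebesgue)
    then show ?thesis by (simp add: x_def)
  qed
qed

typedef h2 = h2_functions
  using h2_zero_closed by blast

setup_lifting type_definition_h2

instantiation h2 :: complex_normed_vector
begin

lift_definition zero_h2 :: h2 is "\<lambda>w. 0" by (rule h2_zero_closed)

lift_definition plus_h2 :: "h2 \<Rightarrow> h2 \<Rightarrow> h2" is "\<lambda>f g w. f w + g w" by (rule h2_add_closed)

lift_definition scaleC_h2 :: "complex \<Rightarrow> h2 \<Rightarrow> h2" is "\<lambda>c f w. c * f w" by (rule h2_scale_closed)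

lift_definition norm_h2 :: "h2 \<Rightarrow> real" is "\<lambda>f. sqrt (enn2real (h2_normsq f))" .

definition uminus_h2 :: "h2 \<Rightarrow> h2" where "uminus_h2 f = (-1) *\<^sub>C f"
definition minus_h2 :: "h2 \<Rightarrow> h2 \<Rightarrow> h2" where "minus_h2 f g = f + - g"
definition scaleR_h2 :: "real \<Rightarrow> h2 \<Rightarrow> h2" where "scaleR_h2 r f = complex_of_real r *\<^sub>C f"
definition sgn_h2 :: "h2 \<Rightarrow> h2" where "sgn_h2 f = inverse (norm f) *\<^sub>R f"
definition dist_h2 :: "h2 \<Rightarrow> h2 \<Rightarrow> real" where "dist_h2 f g = norm (f - g)"
definition uniformity_h2 :: "(h2 \<times> h2) filter" where
  "uniformity_h2 = (INF e\<in>{0<..}. principal {(f, g). dist f g < e})"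
definition open_h2 :: "h2 set \<Rightarrow> bool" where
  "open_h2 U \<longleftrightarrow> (\<forall>f\<in>U. eventually (\<lambda>(f', g). f' = f \<longrightarrow> g \<in> U) uniformity)"

instance
proof
  fix f g h :: h2 and c d :: complex and r s :: real and U :: "h2 set"
  have nsc: "norm (c *\<^sub>C f) = cmod c * norm f" for c and f :: h2
    by transfer (simp add: h2_normsq_scale enn2real_mult real_sqrt_mult)
  show "f + g + h = f + (g + h)" by transfer (simp add: add.assoc)
  show "f + g = g + f" by transfer (simp add: add.commute)
  show "0 + f = f" by transfer simp
  show "- f + f = 0" unfolding uminus_h2_def by transfer simp
  show "f - g = f + - g" by (rule minus_h2_def)
  show "r *\<^sub>R (f + g) = r *\<^sub>R f + r *\<^sub>R g"
    unfolding scaleR_h2_def by transfer (simp add: distrib_left)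
  show "(r + s) *\<^sub>R f = r *\<^sub>R f + s *\<^sub>R f"
    unfolding scaleR_h2_def by transfer (simp add: distrib_right)
  show "r *\<^sub>R s *\<^sub>R f = (r * s) *\<^sub>R f"
    unfolding scaleR_h2_def by transfer (simp add: mult.assoc)
  show "1 *\<^sub>R f = f" unfolding scaleR_h2_def by transfer simp
  show "sgn f = inverse (norm f) *\<^sub>R f" by (rule sgn_h2_def)
  show "dist f g = norm (f - g)" by (rule dist_h2_def)
  show "(uniformity :: (h2 \<times> h2) filter) = (INF e\<in>{0<..}. principal {(f, g). dist f g < e})"
    by (rule uniformity_h2_def)
  show "open U \<longleftrightarrow> (\<forall>f\<in>U. eventually (\<lambda>(f', g). f' = f \<longrightarrow> g \<in> U) uniformity)"
    by (rule open_h2_def)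
  show "norm f = 0 \<longleftrightarrow> f = 0"
  proof
    show "norm f = 0 \<Longrightarrow> f = 0"
    proof transfer
      fix f assume f: "f \<in> h2_functions" and "sqrt (enn2real (h2_normsq f)) = 0"
      then have "h2_normsq f = 0"
        using h2_normsq_root[OF f] by simp
      with f show "f = (\<lambda>w. 0)" by (rule h2_normsq_eq_0)
    qed
    show "f = 0 \<Longrightarrow> norm f = 0"
      by transfer (simp add: h2_normsq_def line_integral_def)
  qed
  show "norm (f + g) \<le> norm f + norm g"
  proof transfer
    fix f g assume fg: "f \<in> h2_functions" "g \<in> h2_functions"
    let ?A = "sqrt (enn2real (h2_normsq f)) + sqrt (enn2real (h2_normsq g))"
    have "enn2real (h2_normsq (\<lambda>w. f w + g w)) \<le> ?A\<^sup>2"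
      using h2_normsq_add[OF fg] by (intro enn2real_leI) auto
    then show "sqrt (enn2real (h2_normsq (\<lambda>w. f w + g w))) \<le> ?A"
      by (intro real_le_lsqrt) auto
  qed
  show "norm (r *\<^sub>R f) = \<bar>r\<bar> * norm f"
    unfolding scaleR_h2_def by (simp add: nsc)
  show "c *\<^sub>C (f + g) = c *\<^sub>C f + c *\<^sub>C g" by transfer (simp add: distrib_left)
  show "(c + d) *\<^sub>C f = c *\<^sub>C f + d *\<^sub>C f" by transfer (simp add: distrib_right)
  show "c *\<^sub>C d *\<^sub>C f = (c * d) *\<^sub>C f" by transfer (simp add: mult.assoc)
  show "complex_of_real r *\<^sub>C f = r *\<^sub>R f" by (simp add: scaleR_h2_def)
  show "norm (c *\<^sub>C f) = cmod c * norm f" by (rule nsc)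
qed

end

text \<open>Meaningful for self-maps of the half-plane that induce an operator on the Hardy space; the
  affine maps below are such.\<close>

definition composition_operator :: "(complex \<Rightarrow> complex) \<Rightarrow> h2 \<Rightarrow> h2" where
  "composition_operator \<psi> f = Abs_h2 (\<lambda>w. if w \<in> right_half_plane then Rep_h2 f (\<psi> w) else 0)"

context
  fixes a :: real and b :: complex and \<psi> :: "complex \<Rightarrow> complex"
  assumes a: "a > 0" and b: "b \<in> right_half_plane"
    and \<psi>: "\<And>w. w \<in> right_half_plane \<Longrightarrow> \<psi> w = complex_of_real a * w + b"
begin

lemma affine_self_map: "w \<in> right_half_plane \<Longrightarrow> \<psi> w \<in> right_half_plane"
  using a b \<psi> by (auto simp: right_half_plane_def intro: add_pos_pos)

lemma h2_normsq_affine: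
  assumes f: "f \<in> h2_functions"
  shows "h2_normsq (\<lambda>w. if w \<in> right_half_plane then f (\<psi> w) else 0) \<le> ennreal (1 / a) * h2_normsq f"
  unfolding h2_normsq_def[of "\<lambda>w. if w \<in> right_half_plane then f (\<psi> w) else 0"]
proof (rule SUP_least)
  fix x :: real assume "x \<in> {0<..}"
  then have x: "x > 0" by simp
  define x' where "x' = a * x + Re b"
  have x': "x' > 0" using a b x by (simp add: x'_def right_half_plane_def add_pos_pos)
  have [measurable]: "(\<lambda>y. f (Complex x' y)) \<in> borel_measurable borel"
    using line_measurable[OF _ x'] f by (simp add: h2_functions_def)
  have "\<psi> (Complex x y) = Complex x' (Im b + a * y)" for y
    using \<psi>[of "Complex x y"] x by (simp add: x'_def complex_eq_iff)
  then have 1: "line_integral (\<lambda>w. if w \<in> right_half_plane then f (\<psi> w) else 0) x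
      = (\<integral>\<^sup>+y. ennreal ((cmod (f (Complex x' (Im b + a * y))))\<^sup>2) \<partial>lborel)"
    using x by (simp add: line_integral_def)
  have "line_integral f x' = ennreal a * (\<integral>\<^sup>+y. ennreal ((cmod (f (Complex x' (Im b + a * y))))\<^sup>2) \<partial>lborel)"
    unfolding line_integral_def
    using a nn_integral_real_affine[of "\<lambda>y. ennreal ((cmod (f (Complex x' y)))\<^sup>2)" a "Im b"] by simp
  then have "ennreal (1 / a) * line_integral f x'
      = line_integral (\<lambda>w. if w \<in> right_half_plane then f (\<psi> w) else 0) x"
    using a by (simp add: 1 mult.assoc[symmetric] ennreal_mult[symmetric])
  then show "line_integral (\<lambda>w. if w \<in> right_half_plane then f (\<psi> w) else 0) x
      \<le> ennreal (1 / a) * h2_normsq f"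
    using mult_left_mono[OF line_integral_le[OF x', of f], of "ennreal (1 / a)"] by simp
qed

lemma h2_affine_closed:
  assumes f: "f \<in> h2_functions"
  shows "(\<lambda>w. if w \<in> right_half_plane then f (\<psi> w) else 0) \<in> h2_functions"
proof -
  have "(f \<circ> (\<lambda>w. complex_of_real a * w + b)) holomorphic_on right_half_plane"
    using f affine_self_map \<psi>
    by (intro holomorphic_on_compose_gen[where t = right_half_plane] holomorphic_intros)
      (auto simp: h2_functions_def)
  then have "(\<lambda>w. if w \<in> right_half_plane then f (\<psi> w) else 0) holomorphic_on right_half_plane"
    by (rule holomorphic_transform) (simp add: \<psi>)
  moreover have "ennreal (1 / a) * h2_normsq f < \<infinity>"
    using f by (auto simp: h2_functions_def ennreal_mult_less_top)
  ultimately show ?thesis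
    using h2_normsq_affine[OF f] by (auto simp: h2_functions_def)
qed

lemma Rep_composition_operator:
  "Rep_h2 (composition_operator \<psi> f) w = (if w \<in> right_half_plane then Rep_h2 f (\<psi> w) else 0)"
  unfolding composition_operator_def
  by (subst Abs_h2_inverse) (auto intro: h2_affine_closed Rep_h2)

lemma norm_composition_operator: "norm (composition_operator \<psi> f) \<le> sqrt (1 / a) * norm f"
proof -
  have "Rep_h2 (composition_operator \<psi> f) = (\<lambda>w. if w \<in> right_half_plane then Rep_h2 f (\<psi> w) else 0)"
    by (auto simp: Rep_composition_operator)
  then have "h2_normsq (Rep_h2 (composition_operator \<psi> f)) \<le> ennreal (1 / a) * h2_normsq (Rep_h2 f)"
    using h2_normsq_affine[OF Rep_h2[of f]] by simp
  moreover have "ennreal (1 / a) * h2_normsq (Rep_h2 f) < \<infinity>"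
    using Rep_h2[of f] by (auto simp: h2_functions_def ennreal_mult_less_top)
  ultimately have "enn2real (h2_normsq (Rep_h2 (composition_operator \<psi> f)))
      \<le> enn2real (ennreal (1 / a) * h2_normsq (Rep_h2 f))"
    by (intro enn2real_mono) auto
  also have "\<dots> = 1 / a * enn2real (h2_normsq (Rep_h2 f))"
    using a by (simp add: enn2real_mult)
  finally show ?thesis
    unfolding norm_h2.rep_eq by (metis real_sqrt_le_mono real_sqrt_mult)
qed

lemma bounded_clinear_composition_operator: "bounded_clinear (composition_operator \<psi>)"
proof -
  have add: "composition_operator \<psi> (f + g) = composition_operator \<psi> f + composition_operator \<psi> g" for f g
    by (auto simp: Rep_h2_inject[symmetric] Rep_composition_operator plus_h2.rep_eq)
  have sc: "composition_operator \<psi> (c *\<^sub>C f) = c *\<^sub>C composition_operator \<psi> f" for c f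
    by (auto simp: Rep_h2_inject[symmetric] Rep_composition_operator scaleC_h2.rep_eq)
  have "bounded_linear (composition_operator \<psi>)"
  proof (rule bounded_linear_intro[where K = "sqrt (1 / a)"])
    show "composition_operator \<psi> (r *\<^sub>R f) = r *\<^sub>R composition_operator \<psi> f" for r f
      using sc[of "complex_of_real r" f] by (simp add: scaleC_of_real)
    show "norm (composition_operator \<psi> f) \<le> norm f * sqrt (1 / a)" for f
      using norm_composition_operator[of f] by (simp add: mult.commute)
  qed (rule add)
  then show ?thesis using sc by (simp add: bounded_clinear_def)
qed

end

end

theory Submission
  imports Defs
begin

text \<open>
  Centred at the fixed point \<open>w0\<close> of \<open>\<psi>\<close>, the operator \<open>C\<close> becomes a dilation \<open>f(v) \<mapsto> f(a v)\<close>.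

  For \<open>a > 1\<close> the point \<open>w0\<close> lies to the left of the half-plane. The functions \<open>v^s p(q(v))\<close> with
  \<open>a^s = l\<close>, \<open>q(v) = v^(2 \<pi> i / log a)\<close> and \<open>p\<close> a polynomial are eigenfunctions. To solve
  \<open>C f - l f = g\<close>, split \<open>g = (I - T)^N g + (g - (I - T)^N g)\<close>, where \<open>T\<close> is the translation by
  \<open>- w0\<close>: the first summand is \<open>O(v^(-N))\<close> in mean square on vertical lines and is handled by a
  Neumann series in \<open>C\<close>; the second extends to the half-plane \<open>Re v > 0\<close> and is handled by a
  Neumann series in the inverse dilation. Hence \<open>C - l\<close> has a bounded right inverse and an
  infinite-dimensional kernel, so it is universal by Caradus' criterion.

  For \<open>a < 1\<close> the point \<open>w0\<close> lies inside the half-plane and a Taylor expansion at \<open>w0\<close> excludes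
  eigenfunctions; since a universal operator restricts to a copy of the zero operator, it has a kernel, so
  \<open>C - l\<close> is not universal. For \<open>0 < |l| < a^(-1/2)\<close> the functional
  \<open>f \<mapsto> \<integral> f(w) (w0 - w)^s dw\<close>, taken over a vertical line to the left of \<open>w0\<close>, annihilates the
  range of \<open>C - l\<close> for a suitable \<open>s\<close>, so \<open>l\<close> is in the spectrum.
\<close>

text \<open>The radius \<open>a powr (-1/2)\<close> enters in three ways. It bounds the norm of
  \<open>C\<close>, since stretching vertical lines by \<open>a\<close> divides squared integrals by
  \<open>a\<close>. It is the condition \<open>Re s < -1/2\<close> under which the powers used here,
  as eigenfunctions or as kernel of the functional, are square integrable on vertical lines. And for
  \<open>a > 1\<close> it makes \<open>l\<close> times the inverse dilation a contraction. For
  \<open>a > 1\<close> neither Neumann series alone solves \<open>C f - l f = g\<close>: the norm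
  bound of \<open>C\<close> exceeds \<open>cmod l\<close>, and the inverse dilation evaluates
  \<open>g\<close> to the left of its domain. Differences help because each gains a factor of order
  \<open>1 / x\<close> on the line at \<open>x\<close>, while \<open>C ^^ n\<close> evaluates its
  argument on lines at distance of order \<open>a ^ n\<close>. The norm is a supremum over lines, so
  the inner product that Caradus' criterion uses has to be constructed. The squared norm on a line
  is a bounded log-convex function of the abscissa, hence decreasing; the supremum is therefore a
  limit at the boundary, and polarization carries the inner products on lines over to that
  limit.\<close>

section \<open>Bounded operators on complex Banach spaces\<close>

lemma bounded_clinearD:
  assumes "bounded_clinear T"
  shows "bounded_linear T" "T (c *\<^sub>C x) = c *\<^sub>C T x"
  using assms by (auto simp: bounded_clinear_def)

lemma bounded_linear_scaleC: "bounded_linear ((*\<^sub>C) c :: 'a::complex_normed_vector \<Rightarrow> 'a)"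
proof (rule bounded_linear_intro[where K = "cmod c"])
  show "c *\<^sub>C (r *\<^sub>R x) = r *\<^sub>R (c *\<^sub>C x)" for r and x :: 'a
    by (metis scaleC_of_real scaleC_scaleC mult.commute)
qed (auto simp: scaleC_add_right norm_scaleC mult.commute)

lemma scaleC_zero_right [simp]: "c *\<^sub>C (0::'a::complex_normed_vector) = 0"
  by (rule linear_0[OF bounded_linear.linear[OF bounded_linear_scaleC]])

lemma scaleC_diff_right: "c *\<^sub>C (x - y :: 'a::complex_normed_vector) = c *\<^sub>C x - c *\<^sub>C y"
  by (rule linear_diff[OF bounded_linear.linear[OF bounded_linear_scaleC]])

lemma scaleC_minus_right: "c *\<^sub>C (- x :: 'a::complex_normed_vector) = - (c *\<^sub>C x)"
  by (rule linear_neg[OF bounded_linear.linear[OF bounded_linear_scaleC]])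

lemma scaleC_zero_left [simp]: "0 *\<^sub>C (x::'a::complex_normed_vector) = 0"
  using scaleC_of_real[of 0 x] by simp

lemma scaleC_one [simp]: "1 *\<^sub>C (x::'a::complex_normed_vector) = x"
  using scaleC_of_real[of 1 x] by simp

lemma scaleC_minus_left: "(- c) *\<^sub>C (x::'a::complex_normed_vector) = - (c *\<^sub>C x)"
  using scaleC_add_left[of c "- c" x] by (simp add: eq_neg_iff_add_eq_0 add.commute)

lemma scaleC_diff_left: "(c - d) *\<^sub>C (x::'a::complex_normed_vector) = c *\<^sub>C x - d *\<^sub>C x"
  using scaleC_add_left[of c "- d" x] by (simp add: scaleC_minus_left)

lemma bounded_clinear_scaleC: "bounded_clinear ((*\<^sub>C) c)"
  using bounded_linear_scaleC by (auto simp: bounded_clinear_def scaleC_scaleC mult.commute)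

lemma bounded_clinear_ident: "bounded_clinear (\<lambda>x. x)"
  by (auto simp: bounded_clinear_def)

lemma bounded_clinear_compose:
  assumes "bounded_clinear S" "bounded_clinear T" shows "bounded_clinear (\<lambda>x. S (T x))"
  using assms by (auto simp: bounded_clinear_def bounded_linear_compose)

lemma bounded_clinear_add:
  assumes "bounded_clinear S" "bounded_clinear T" shows "bounded_clinear (\<lambda>x. S x + T x)"
  using assms by (auto simp: bounded_clinear_def scaleC_add_right intro!: bounded_linear_add)

lemma bounded_clinear_diff:
  assumes "bounded_clinear S" "bounded_clinear T" shows "bounded_clinear (\<lambda>x. S x - T x)"
  using assms by (auto simp: bounded_clinear_def scaleC_diff_right intro!: bounded_linear_sub)

text \<open>\<open>R x\<close> is the fixed point of the contraction
  \<open>\<lambda>y. x + S y\<close>; its uniqueness yields both linearity and the left inverse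
  property.\<close>

lemma neumann_inverse:
  fixes S :: "'a::{complex_normed_vector,banach} \<Rightarrow> 'a"
  assumes S: "bounded_clinear S" and q: "\<And>x. norm (S x) \<le> q * norm x" "0 \<le> q" "q < 1"
  obtains R where "bounded_clinear R" "\<And>x. R (x - S x) = x" "\<And>x. R x - S (R x) = x"
proof -
  note lin = bounded_linear.linear[OF bounded_clinearD(1)[OF S]]
  have ex: "\<exists>!y. x + S y = y" for x
  proof (rule banach_fix_type[OF q(2,3)], intro allI)
    fix y z
    show "dist (x + S y) (x + S z) \<le> q * dist y z"
      using q(1)[of "y - z"] by (simp add: dist_norm linear_diff[OF lin])
  qed
  define R where "R x = (THE y. x + S y = y)" for x
  have R: "x + S (R x) = R x" for x
    unfolding R_def using theI'[OF ex[of x]] .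
  have uniq: "R x = y" if "x + S y = y" for x y
    using ex[of x] R[of x] that by blast
  have bd: "norm (R x) \<le> norm x * (1 / (1 - q))" for x
  proof -
    have "norm (R x) \<le> norm x + norm (S (R x))"
      by (metis R norm_triangle_ineq)
    also have "\<dots> \<le> norm x + q * norm (R x)" using q(1) by simp
    finally have "norm (R x) * (1 - q) \<le> norm x" by (simp add: algebra_simps)
    then show ?thesis using q(3) by (simp add: pos_le_divide_eq)
  qed
  have sc: "R (c *\<^sub>C x) = c *\<^sub>C R x" for c x
    by (rule uniq) (metis R bounded_clinearD(2)[OF S] scaleC_add_right)
  have "bounded_linear R"
  proof (rule bounded_linear_intro[OF _ _ bd])
    show "R (x + y) = R x + R y" for x y
    proof (rule uniq)
      have "x + y + S (R x + R y) = (x + S (R x)) + (y + S (R y))"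
        by (simp add: linear_add[OF lin])
      then show "x + y + S (R x + R y) = R x + R y" by (simp add: R)
    qed
    show "R (r *\<^sub>R x) = r *\<^sub>R R x" for r x
      using sc[of "complex_of_real r" x] by (simp add: scaleC_of_real)
  qed
  then have "bounded_clinear R" using sc by (simp add: bounded_clinear_def)
  moreover have "R (x - S x) = x" for x by (rule uniq) simp
  moreover have "R x - S (R x) = x" for x using R[of x] by (simp add: diff_eq_eq)
  ultimately show ?thesis using that by blast
qed

text \<open>\<open>T - l\<close> is \<open>- l\<close> times \<open>I - T / l\<close>, and
  \<open>T / l\<close> is a contraction once \<open>cmod l\<close> exceeds \<open>q\<close>.\<close>

lemma spectrum_norm_le:
  fixes T :: "'a::{complex_normed_vector,banach} \<Rightarrow> 'a"
  assumes T: "bounded_clinear T" and q: "\<And>x. norm (T x) \<le> q * norm x" "0 \<le> q"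
    and l: "l \<in> spectrum T"
  shows "cmod l \<le> q"
proof (rule ccontr)
  assume "\<not> cmod l \<le> q"
  then have lq: "q < cmod l" by simp
  then have l0: "l \<noteq> 0" using q(2) by auto
  obtain R where R: "bounded_clinear R" "\<And>x. R (x - inverse l *\<^sub>C T x) = x"
    "\<And>x. R x - inverse l *\<^sub>C T (R x) = x"
  proof (rule neumann_inverse[of "\<lambda>x. inverse l *\<^sub>C T x" "q / cmod l"])
    show "bounded_clinear (\<lambda>x. inverse l *\<^sub>C T x)"
      by (rule bounded_clinear_compose[OF bounded_clinear_scaleC T])
    show "norm (inverse l *\<^sub>C T x) \<le> q / cmod l * norm x" for x
      using divide_right_mono[OF q(1)[of x], of "cmod l"]
      by (simp add: norm_scaleC norm_inverse divide_inverse mult_ac)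
    show "q / cmod l < 1" using lq l0 by (simp add: pos_divide_less_eq)
  qed (use q(2) in auto)
  have eq: "T x - l *\<^sub>C x = (- l) *\<^sub>C (x - inverse l *\<^sub>C T x)" for x
    using l0 by (simp add: scaleC_diff_right scaleC_minus_left scaleC_scaleC)
  have "bounded_clinear (\<lambda>x. (- inverse l) *\<^sub>C R x)"
    by (rule bounded_clinear_compose[OF bounded_clinear_scaleC R(1)])
  moreover have "(- inverse l) *\<^sub>C R (T x - l *\<^sub>C x) = x" for x
    unfolding eq bounded_clinearD(2)[OF R(1)] using l0 by (simp add: scaleC_scaleC R(2))
  moreover have "T ((- inverse l) *\<^sub>C R x) - l *\<^sub>C ((- inverse l) *\<^sub>C R x) = x" for x
    unfolding eq bounded_clinearD(2)[OF T]
    using l0 R(3)[of x] by (simp add: scaleC_scaleC scaleC_diff_right scaleC_minus_left scaleC_minus_right)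
  ultimately have "l \<notin> spectrum T" unfolding spectrum_def by blast
  with l show False by contradiction
qed

text \<open>With \<open>S\<close> the inverse of \<open>T - l\<close>, both products of
  \<open>T - m\<close> and \<open>S\<close> equal \<open>I - (m - l) S\<close>, which is invertible
  while \<open>cmod (m - l)\<close> is below the reciprocal of a norm bound of
  \<open>S\<close>.\<close>

lemma closed_spectrum:
  fixes T :: "'a::{complex_normed_vector,banach} \<Rightarrow> 'a"
  assumes T: "bounded_clinear T"
  shows "closed (spectrum T)"
  unfolding closed_def open_contains_ball
proof (intro ballI)
  fix l assume "l \<in> - spectrum T"
  then obtain S where S: "bounded_clinear S"
    "\<And>x. S (T x - l *\<^sub>C x) = x" "\<And>x. T (S x) - l *\<^sub>C S x = x"
    unfolding spectrum_def by blast
  obtain K where K: "K > 0" "\<And>x. norm (S x) \<le> norm x * K"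
    using bounded_linear.pos_bounded[OF bounded_clinearD(1)[OF S(1)]] by blast
  have "ball l (1 / K) \<subseteq> - spectrum T"
  proof
    fix m assume "m \<in> ball l (1 / K)"
    then have m: "cmod (m - l) * K < 1"
      using K(1) by (simp add: dist_norm norm_minus_commute pos_less_divide_eq)
    define S' where "S' x = (m - l) *\<^sub>C S x" for x
    have S': "bounded_clinear S'"
      unfolding S'_def by (rule bounded_clinear_compose[OF bounded_clinear_scaleC S(1)])
    obtain R where R: "bounded_clinear R" "\<And>x. R (x - S' x) = x" "\<And>x. R x - S' (R x) = x"
    proof (rule neumann_inverse[OF S', of "cmod (m - l) * K"])
      show "norm (S' x) \<le> cmod (m - l) * K * norm x" for x
        using mult_left_mono[OF K(2)[of x], of "cmod (m - l)"] by (simp add: S'_def norm_scaleC mult_ac)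
    qed (use m K(1) in auto)
    have 1: "T (S x) - m *\<^sub>C S x = x - S' x" for x
      using S(3)[of x] by (simp add: S'_def scaleC_diff_left algebra_simps)
    have Slin: "S (x - y) = S x - S y" for x y
      by (rule linear_diff[OF bounded_linear.linear[OF bounded_clinearD(1)[OF S(1)]]])
    have 2: "S (T x - m *\<^sub>C x) = x - S' x" for x
    proof -
      have "S (T x - m *\<^sub>C x) = S ((T x - l *\<^sub>C x) - (m - l) *\<^sub>C x)"
        by (simp add: scaleC_diff_left)
      also have "\<dots> = S (T x - l *\<^sub>C x) - S ((m - l) *\<^sub>C x)" by (rule Slin)
      finally show ?thesis by (simp only: S(2) S'_def bounded_clinearD(2)[OF S(1)])
    qed
    \<comment> \<open>The two products give \<open>S R\<close> as a right and \<open>R S\<close> as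
      a left inverse of \<open>T - m\<close>; commutation makes them one operator.\<close>
    have 3: "R (S x) = S (R x)" for x
    proof -
      have "S x = S (T (S (R x)) - m *\<^sub>C S (R x))" by (simp add: 1 R(3))
      also have "\<dots> = S (R x) - S' (S (R x))" by (rule 2)
      finally show ?thesis by (simp add: R(2))
    qed
    have "bounded_clinear (\<lambda>x. S (R x))" by (rule bounded_clinear_compose[OF S(1) R(1)])
    moreover have "S (R (T x - m *\<^sub>C x)) = x" for x by (simp add: 3[symmetric] 2 R(2))
    moreover have "T (S (R x)) - m *\<^sub>C S (R x) = x" for x by (simp add: 1 R(3))
    ultimately have "m \<notin> spectrum T" unfolding spectrum_def by blast
    then show "m \<in> - spectrum T" by simp
  qed
  then show "\<exists>e>0. ball l e \<subseteq> - spectrum T"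
    using K(1) by (intro exI[of _ "1 / K"]) auto
qed

lemma point_spectrum_subset_spectrum: "point_spectrum T \<subseteq> spectrum T"
proof
  fix l assume "l \<in> point_spectrum T"
  then obtain x where x: "x \<noteq> 0" "T x = l *\<^sub>C x" by (auto simp: point_spectrum_def)
  show "l \<in> spectrum T"
    unfolding spectrum_def
  proof (clarify)
    fix S assume S: "bounded_clinear S" "\<forall>x. S (T x - l *\<^sub>C x) = x"
    have "x = S 0" using S(2) x(2) by (metis diff_self)
    also have "\<dots> = 0" by (rule linear_0[OF bounded_linear.linear[OF bounded_clinearD(1)[OF S(1)]]])
    finally show False using x(1) by simp
  qed
qed

text \<open>\<open>V\<close> embeds the space into the kernel of \<open>U\<close> and
  \<open>L\<close> undoes \<open>V\<close>. A solution of \<open>X = V + \<alpha> W' X T\<close>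
  satisfies \<open>U X = \<alpha> X T\<close>, so \<open>U\<close> acts on the range of
  \<open>X\<close> like \<open>\<alpha> T\<close>; for small \<open>\<alpha>\<close> it exists by
  contraction, and \<open>L\<close> inverts it.\<close>

lemma universal_if_right_inverse:
  fixes U W V L :: "'a::{complex_normed_vector,banach} \<Rightarrow> 'a"
  assumes U: "bounded_clinear U" and W: "bounded_clinear W" and V: "bounded_clinear V"
    and L: "bounded_clinear L"
    and UW: "\<And>x. U (W x) = x" and UV: "\<And>x. U (V x) = 0" and LV: "\<And>x. L (V x) = x"
  shows "universal U"
  unfolding universal_def
proof (intro conjI allI impI)
  fix T :: "'a \<Rightarrow> 'a" assume T: "bounded_clinear T"
  note lin = bounded_linear.linear[OF bounded_clinearD(1)]
  \<comment> \<open>Subtracting a kernel vector keeps a right inverse of \<open>U\<close> and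
    arranges \<open>L W' = 0\<close>, which makes \<open>L\<close> a left inverse of
    \<open>X\<close>.\<close>
  define W' where "W' x = W x - V (L (W x))" for x
  have W': "bounded_clinear W'"
    unfolding W'_def
    by (rule bounded_clinear_diff[OF W bounded_clinear_compose[OF V bounded_clinear_compose[OF L W]]])
  have UW': "U (W' x) = x" for x by (simp add: W'_def linear_diff[OF lin[OF U]] UW UV)
  have LW': "L (W' x) = 0" for x by (simp add: W'_def linear_diff[OF lin[OF L]] LV)
  obtain Wb where Wb: "W' = blinfun_apply Wb"
    by (metis W' bounded_clinearD(1) bounded_linear_Blinfun_apply)
  obtain Vb where Vb: "V = blinfun_apply Vb"
    by (metis V bounded_clinearD(1) bounded_linear_Blinfun_apply)
  obtain Tb where Tb: "T = blinfun_apply Tb"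
    by (metis T bounded_clinearD(1) bounded_linear_Blinfun_apply)
  \<comment> \<open>Then \<open>Z \<mapsto> \<alpha> W' Z T\<close> contracts by a factor below 1;
    the summand 1 covers the case that \<open>Wb\<close> or \<open>Tb\<close> is zero.\<close>
  define \<alpha> where "\<alpha> = 1 / (norm Wb * norm Tb + 1)"
  have pos: "norm Wb * norm Tb + 1 > 0" by (simp add: add_nonneg_pos)
  have \<alpha>: "\<alpha> > 0" using pos by (simp add: \<alpha>_def)
  define q where "q = \<alpha> * (norm Wb * norm Tb)"
  have q: "0 \<le> q" "q < 1" using \<alpha> pos by (auto simp: q_def \<alpha>_def divide_simps)
  have con: "norm (\<alpha> *\<^sub>R (Wb o\<^sub>L Z o\<^sub>L Tb)) \<le> q * norm Z" for Z
  proof -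
    have "norm (Wb o\<^sub>L Z o\<^sub>L Tb) \<le> norm (Wb o\<^sub>L Z) * norm Tb" by (rule norm_blinfun_compose)
    also have "\<dots> \<le> norm Wb * norm Z * norm Tb"
      by (intro mult_right_mono norm_blinfun_compose) simp
    finally have "\<alpha> * norm (Wb o\<^sub>L Z o\<^sub>L Tb) \<le> \<alpha> * (norm Wb * norm Z * norm Tb)"
      using \<alpha> by (intro mult_left_mono) auto
    then show ?thesis using \<alpha> by (simp add: q_def mult_ac)
  qed
  have "\<exists>!X. Vb + \<alpha> *\<^sub>R (Wb o\<^sub>L X o\<^sub>L Tb) = X"
  proof (rule banach_fix_type[OF q], intro allI)
    fix X Z
    have "(Vb + \<alpha> *\<^sub>R (Wb o\<^sub>L X o\<^sub>L Tb)) - (Vb + \<alpha> *\<^sub>R (Wb o\<^sub>L Z o\<^sub>L Tb))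
        = \<alpha> *\<^sub>R (Wb o\<^sub>L (X - Z) o\<^sub>L Tb)"
      by (rule blinfun_eqI) (simp add: blinfun.bilinear_simps algebra_simps)
    then show "dist (Vb + \<alpha> *\<^sub>R (Wb o\<^sub>L X o\<^sub>L Tb)) (Vb + \<alpha> *\<^sub>R (Wb o\<^sub>L Z o\<^sub>L Tb)) \<le> q * dist X Z"
      using con[of "X - Z"] by (simp add: dist_norm)
  qed
  then obtain Xb where Xb: "Vb + \<alpha> *\<^sub>R (Wb o\<^sub>L Xb o\<^sub>L Tb) = Xb" by blast
  define X where "X = blinfun_apply Xb"
  have X: "X x = V x + \<alpha> *\<^sub>R W' (X (T x))" for x
    unfolding X_def by (subst Xb[symmetric]) (simp add: blinfun.bilinear_simps Vb Wb Tb)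
  have blX: "bounded_linear X" unfolding X_def by (rule blinfun.bounded_linear_right)
  note linX = bounded_linear.linear[OF blX]
  \<comment> \<open>The fixed point was found among real-linear operators. Its failure
    \<open>D\<close> to commute with \<open>c\<close> solves the homogeneous equation
    \<open>D = \<alpha> W' D T\<close>, so the contraction estimate forces
    \<open>D = 0\<close>.\<close>
  have Xsc: "X (c *\<^sub>C x) = c *\<^sub>C X x" for c x
  proof -
    define D where "D x = X (c *\<^sub>C x) - c *\<^sub>C X x" for x
    have "bounded_linear D"
      unfolding D_def
      by (intro bounded_linear_sub bounded_linear_compose[OF blX bounded_linear_scaleC]
          bounded_linear_compose[OF bounded_linear_scaleC blX])
    then obtain Db where Db: "D = blinfun_apply Db" by (metis bounded_linear_Blinfun_apply)
    have DT: "D x = \<alpha> *\<^sub>R W' (D (T x))" for x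
    proof -
      have "D x = \<alpha> *\<^sub>R W' (X (c *\<^sub>C T x)) - c *\<^sub>C (\<alpha> *\<^sub>R W' (X (T x)))"
        unfolding D_def X[of "c *\<^sub>C x"] X[of x]
        by (simp add: bounded_clinearD(2)[OF V] bounded_clinearD(2)[OF T] scaleC_add_right)
      also have "c *\<^sub>C (\<alpha> *\<^sub>R W' (X (T x))) = \<alpha> *\<^sub>R W' (c *\<^sub>C X (T x))"
        by (simp add: bounded_clinearD(2)[OF W'] linear_scale[OF bounded_linear.linear[OF bounded_linear_scaleC]])
      finally show ?thesis
        by (simp add: D_def linear_diff[OF lin[OF W']] scaleR_diff_right)
    qed
    have "Db = \<alpha> *\<^sub>R (Wb o\<^sub>L Db o\<^sub>L Tb)"
    proof (rule blinfun_eqI)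
      show "blinfun_apply Db x = blinfun_apply (\<alpha> *\<^sub>R (Wb o\<^sub>L Db o\<^sub>L Tb)) x" for x
        using DT[of x] by (simp add: Db Wb Tb blinfun.bilinear_simps)
    qed
    then have "norm Db = norm (\<alpha> *\<^sub>R (Wb o\<^sub>L Db o\<^sub>L Tb))" by (rule arg_cong)
    also have "\<dots> \<le> q * norm Db" by (rule con)
    finally have "norm Db \<le> q * norm Db" .
    then have "(1 - q) * norm Db \<le> 0" by (simp add: algebra_simps)
    then have "norm Db \<le> 0" using q(2) by (simp add: mult_le_0_iff)
    then have "D x = 0" by (simp add: Db)
    then show ?thesis by (simp add: D_def)
  qed
  have bX: "bounded_clinear X" using blX Xsc by (simp add: bounded_clinear_def)
  have LX: "L (X x) = x" for x
    by (subst X) (simp add: linear_add[OF lin[OF L]] linear_scale[OF lin[OF L]] LV LW')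
  have UX: "U (X x) = X (complex_of_real \<alpha> *\<^sub>C T x)" for x
  proof -
    have "U (X x) = \<alpha> *\<^sub>R X (T x)"
      by (subst X) (simp add: linear_add[OF lin[OF U]] linear_scale[OF lin[OF U]] UV UW')
    then show ?thesis by (simp add: linear_scale[OF linX] scaleC_of_real)
  qed
  have csub: "csubspace (range X)"
    unfolding csubspace_def
  proof (intro conjI allI ballI)
    show "subspace (range X)" by (rule linear_subspace_image[OF linX subspace_UNIV])
    show "c *\<^sub>C x \<in> range X" if "x \<in> range X" for c x
      using that by (auto simp: Xsc[symmetric])
  qed
  \<comment> \<open>The left inverse presents the range as the fixed points of the continuous map
    \<open>X L\<close>, so it is closed.\<close>
  have "range X = {y. X (L y) = y}"
    by (auto simp: LX) (metis rangeI)
  moreover have "closed {y. X (L y) = y}"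
    by (intro closed_Collect_eq continuous_on_id
        linear_continuous_on[OF bounded_linear_compose[OF blX bounded_clinearD(1)[OF L]]])
  ultimately have clo: "closed (range X)" by simp
  have "\<exists>K. \<forall>y\<in>range X. norm (L y) \<le> K * norm y"
    using bounded_linear.bounded[OF bounded_clinearD(1)[OF L]] by (metis mult.commute)
  then have "restriction_similar U (range X) (\<lambda>x. complex_of_real \<alpha> *\<^sub>C T x)"
    unfolding restriction_similar_def using bX LX UX
    by (intro exI[of _ X] exI[of _ L]) auto
  then show "\<exists>\<alpha> M. \<alpha> \<noteq> 0 \<and> csubspace M \<and> closed M \<and> U ` M \<subseteq> M \<and>
      restriction_similar U M (\<lambda>x. \<alpha> *\<^sub>C T x)"
    using \<alpha> csub clo UX by (intro exI[of _ "complex_of_real \<alpha>"] exI[of _ "range X"]) auto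
qed (rule U)

text \<open>\<open>z\<close> excludes the zero space, whose only operator is universal and has no
  eigenvector.\<close>

lemma universal_imp_eigenvalue:
  fixes U :: "'a::complex_normed_vector \<Rightarrow> 'a" and z :: 'a
  assumes "universal U" and z: "z \<noteq> 0"
  shows "\<exists>x. x \<noteq> 0 \<and> U x = 0"
proof -
  have "bounded_clinear (\<lambda>x. 0 :: 'a)" by (auto simp: bounded_clinear_def)
  then obtain M \<alpha> where "restriction_similar U M (\<lambda>x. \<alpha> *\<^sub>C (\<lambda>x. 0 :: 'a) x)"
    using assms(1) unfolding universal_def by blast
  then obtain X Y :: "'a \<Rightarrow> 'a" where X: "bounded_clinear X" "\<forall>x. Y (X x) = x" "\<forall>x. U (X x) = X 0"
    unfolding restriction_similar_def scaleC_zero_right by blast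
  have X0: "X 0 = 0" by (rule linear_0[OF bounded_linear.linear[OF bounded_clinearD(1)[OF X(1)]]])
  have "X z \<noteq> 0" using X(2) z X0 by metis
  then show ?thesis using X(3) X0 by auto
qed

section \<open>Complex Hilbert spaces and Caradus' criterion\<close>

text \<open>The inner product is a parameter because the norm of \<open>h2\<close> is given first
  and its inner product is recovered from it later; \<open>ip_self\<close> ties the two
  together.\<close>

locale complex_hilbert =
  fixes ip :: "'a::{complex_normed_vector,banach} \<Rightarrow> 'a \<Rightarrow> complex"
  assumes ip_add_left: "ip (x + y) z = ip x z + ip y z"
    and ip_scale_left: "ip (c *\<^sub>C x) y = c * ip x y"
    and ip_commute: "ip y x = cnj (ip x y)"
    and ip_self: "ip x x = complex_of_real ((norm x)\<^sup>2)"
begin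

lemma ip_zero_left [simp]: "ip 0 y = 0"
  using ip_scale_left[of 0 0 y] by simp

lemma ip_zero_right [simp]: "ip y 0 = 0"
  using ip_commute[of y 0] by simp

lemma ip_scale_right: "ip x (c *\<^sub>C y) = cnj c * ip x y"
  using ip_commute[of x "c *\<^sub>C y"] ip_commute[of x y] by (simp add: ip_scale_left)

lemma ip_add_right: "ip x (y + z) = ip x y + ip x z"
  using ip_commute[of x "y + z"] ip_commute[of x y] ip_commute[of x z] by (simp add: ip_add_left)

lemma norm_sq_eq_ip: "(norm x)\<^sup>2 = Re (ip x x)"
  unfolding ip_self by (rule Re_complex_of_real[symmetric])

lemma ip_diff_left: "ip (x - y) z = ip x z - ip y z"
  using ip_add_left[of "x - y" y z] by simp

lemma ip_diff_right: "ip x (y - z) = ip x y - ip x z"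
  using ip_add_right[of x "y - z" z] by simp

lemma ip_scaleR_left: "ip (r *\<^sub>R x) y = complex_of_real r * ip x y"
  using ip_scale_left[of "complex_of_real r" x y] by (simp add: scaleC_of_real)

lemma ip_sum_left: "ip (\<Sum>i\<in>A. f i) y = (\<Sum>i\<in>A. ip (f i) y)"
  by (induction A rule: infinite_finite_induct) (auto simp: ip_add_left)

lemma ip_sum_right: "ip x (\<Sum>i\<in>A. f i) = (\<Sum>i\<in>A. ip x (f i))"
  by (induction A rule: infinite_finite_induct) (auto simp: ip_add_right)

text \<open>The drop in norm on removing the component along \<open>y\<close>. Nonnegativity of the
  left side gives Cauchy-Schwarz; minimality of a shortest vector turns it into orthogonality in the
  Riesz theorem.\<close>

lemma norm_diff_project:
  assumes "y \<noteq> 0"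
  shows "(norm (x - (ip x y / complex_of_real ((norm y)\<^sup>2)) *\<^sub>C y))\<^sup>2
    = (norm x)\<^sup>2 - (cmod (ip x y))\<^sup>2 / (norm y)\<^sup>2"
proof -
  define n where "n = complex_of_real ((norm y)\<^sup>2)"
  have n: "n \<noteq> 0" "cnj n = n" "ip y y = n" using assms by (auto simp: n_def ip_self)
  define t where "t = ip x y / n"
  have yx: "ip y x = cnj (ip x y)" by (rule ip_commute)
  have "complex_of_real ((norm (x - t *\<^sub>C y))\<^sup>2) = ip (x - t *\<^sub>C y) (x - t *\<^sub>C y)"
    by (rule ip_self[symmetric])
  also have "\<dots> = ip x x - cnj t * ip x y - t * cnj (ip x y) + t * cnj t * n"
    by (simp add: ip_diff_left ip_diff_right ip_scale_left ip_scale_right n(3) yx algebra_simps)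
  also have "\<dots> = ip x x - ip x y * cnj (ip x y) / n"
    using n(1,2) by (simp add: t_def field_simps)
  also have "\<dots> = complex_of_real ((norm x)\<^sup>2 - (cmod (ip x y))\<^sup>2 / (norm y)\<^sup>2)"
    by (simp add: ip_self n_def complex_norm_square del: of_real_power)
  finally show ?thesis
    unfolding t_def n_def using of_real_eq_iff by blast
qed

lemma cauchy_schwarz: "cmod (ip x y) \<le> norm x * norm y"
proof (cases "y = 0")
  case False
  have "0 \<le> (norm x)\<^sup>2 - (cmod (ip x y))\<^sup>2 / (norm y)\<^sup>2"
    using norm_diff_project[OF False, of x] by (metis zero_le_power2)
  then have "(cmod (ip x y))\<^sup>2 \<le> (norm x * norm y)\<^sup>2"
    using False by (simp add: field_simps power_mult_distrib)
  then show ?thesis by (rule power2_le_imp_le) simp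
qed simp

lemma bounded_linear_ip_left: "bounded_linear (\<lambda>x. ip x y)"
  by (rule bounded_linear_intro[where K = "norm y"])
    (auto simp: ip_add_left ip_scaleR_left cauchy_schwarz scaleR_conv_of_real)

lemma pythagoras: "ip x y = 0 \<Longrightarrow> (norm (x + y))\<^sup>2 = (norm x)\<^sup>2 + (norm y)\<^sup>2"
  using ip_commute[of y x] by (simp add: norm_sq_eq_ip ip_add_left ip_add_right)

lemma parallelogram:
  fixes x y :: 'a
  shows "(norm (x + y))\<^sup>2 + (norm (x - y))\<^sup>2 = 2 * (norm x)\<^sup>2 + 2 * (norm y)\<^sup>2"
  by (simp add: norm_sq_eq_ip ip_add_left ip_add_right ip_diff_left ip_diff_right)

text \<open>The vector of least norm on the hyperplane \<open>\<phi> = 1\<close> is orthogonal to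
  the kernel of \<open>\<phi>\<close>; divided by its squared norm it represents
  \<open>\<phi>\<close>.\<close>

lemma riesz_representation:
  fixes \<phi> :: "'a \<Rightarrow> complex"
  assumes bl: "bounded_linear \<phi>" and sc: "\<And>c x. \<phi> (c *\<^sub>C x) = c * \<phi> x"
  obtains z where "\<And>x. \<phi> x = ip x z"
proof (cases "\<forall>x. \<phi> x = 0")
  case True
  then show ?thesis using that[of 0] by simp
next
  case False
  note lin = bounded_linear.linear[OF bl]
  then obtain u where "\<phi> u \<noteq> 0" using False by blast
  then have u1: "\<phi> (inverse (\<phi> u) *\<^sub>C u) = 1" by (simp add: sc)
  define S where "S = {x. \<phi> x = 1}"
  define d where "d = Inf (norm ` S)"
  have Sne: "norm ` S \<noteq> {}" using u1 by (auto simp: S_def)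
  have bdd: "bdd_below (norm ` S)" by (rule bdd_belowI2[of _ 0]) simp
  have d_le: "d \<le> norm x" if "\<phi> x = 1" for x
    unfolding d_def using that by (intro cInf_lower bdd) (auto simp: S_def)
  have d0: "d \<ge> 0" unfolding d_def using Sne by (intro cInf_greatest) auto
  have "\<exists>x. \<phi> x = 1 \<and> norm x < d + 1 / real (Suc n)" for n
  proof -
    have "Inf (norm ` S) < d + 1 / real (Suc n)" by (simp add: d_def)
    then show ?thesis using cInf_lessD[OF Sne] by (auto simp: S_def)
  qed
  then obtain X where X: "\<And>n. \<phi> (X n) = 1" "\<And>n. norm (X n) < d + 1 / real (Suc n)" by metis
  have sq: "(norm (X n))\<^sup>2 \<le> d\<^sup>2 + (2 * d + 1) / real (Suc n)" for n
  proof -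
    define e where "e = 1 / real (Suc n)"
    have e: "0 \<le> e" "e \<le> 1" by (auto simp: e_def)
    have "(norm (X n))\<^sup>2 \<le> (d + e)\<^sup>2"
      using X(2)[of n] by (intro power_mono) (auto simp: e_def)
    also have "\<dots> = d\<^sup>2 + 2 * d * e + e * e" by (simp add: power2_eq_square algebra_simps)
    also have "e * e \<le> 1 * e" using e by (intro mult_right_mono) auto
    finally have "(norm (X n))\<^sup>2 \<le> d\<^sup>2 + (2 * d + 1) * e" by (simp add: algebra_simps)
    then show ?thesis by (simp add: e_def)
  qed
  \<comment> \<open>The midpoint of two members stays on the hyperplane and has norm at least
    \<open>d\<close>, so the parallelogram law bounds their difference by the excesses over
    \<open>d\<^sup>2\<close>.\<close>
  have mid: "(norm (X m - X n))\<^sup>2 \<le> 2 * (2 * d + 1) / real (Suc m) + 2 * (2 * d + 1) / real (Suc n)" for m n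
  proof -
    have "\<phi> ((1/2) *\<^sub>R (X m + X n)) = 1"
      by (simp add: linear_scale[OF lin] linear_add[OF lin] X(1) scaleR_conv_of_real)
    then have "d \<le> norm ((1/2) *\<^sub>R (X m + X n))" by (rule d_le)
    then have "2 * d \<le> norm (X m + X n)" by simp
    then have "4 * d\<^sup>2 \<le> (norm (X m + X n))\<^sup>2"
      using d0 power_mono[of "2 * d" "norm (X m + X n)" 2] by (simp add: power_mult_distrib)
    moreover define a b where "a = (2 * d + 1) / real (Suc m)" and "b = (2 * d + 1) / real (Suc n)"
    ultimately have "(norm (X m - X n))\<^sup>2 \<le> 2 * a + 2 * b"
      using parallelogram[of "X m" "X n"] sq[of m] sq[of n] by linarith
    then show ?thesis by (simp only: a_def b_def times_divide_eq_right)
  qed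
  have "Cauchy X"
  proof (rule CauchyI)
    fix e :: real assume e: "e > 0"
    then obtain N where N: "4 * (2 * d + 1) / e\<^sup>2 < real N" 
      using reals_Archimedean2[of "4 * (2 * d + 1) / e\<^sup>2"] by (elim exE)
    have "norm (X m - X n) < e" if "m \<ge> N" "n \<ge> N" for m n
    proof -
      have le: "2 * (2 * d + 1) / real (Suc k) < e\<^sup>2 / 2" if "k \<ge> N" for k
      proof -
        have "4 * (2 * d + 1) / e\<^sup>2 < real (Suc k)" using N that by linarith
        then have "4 * (2 * d + 1) < real (Suc k) * e\<^sup>2"
          using e by (simp add: pos_divide_less_eq)
        then show ?thesis by (simp add: pos_divide_less_eq mult_ac)
      qed
      have "(norm (X m - X n))\<^sup>2 < e\<^sup>2"
        using mid[of m n] le[OF that(1)] le[OF that(2)] by linarith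
      then show ?thesis by (rule power2_less_imp_less) (use e in simp)
    qed
    then show "\<exists>M. \<forall>m\<ge>M. \<forall>n\<ge>M. norm (X m - X n) < e" by blast
  qed
  then obtain x0 where x0: "X \<longlonglongrightarrow> x0"
    by (auto dest!: Cauchy_convergent simp: convergent_def)
  have "(\<lambda>n. \<phi> (X n)) \<longlonglongrightarrow> \<phi> x0" using bounded_linear.tendsto[OF bl x0] .
  then have \<phi>0: "\<phi> x0 = 1" using X(1) LIMSEQ_unique by (auto simp: LIMSEQ_const_iff)
  have "norm x0 \<le> d"
  proof (rule LIMSEQ_le)
    show "(\<lambda>n. norm (X n)) \<longlonglongrightarrow> norm x0" using x0 by (rule tendsto_norm)
    have "(\<lambda>n. d + 1 / real (Suc n)) \<longlonglongrightarrow> d + 0"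
      using LIMSEQ_inverse_real_of_nat by (intro tendsto_add tendsto_const) (simp add: inverse_eq_divide)
    then show "(\<lambda>n. d + 1 / real (Suc n)) \<longlonglongrightarrow> d" by simp
    show "\<exists>N. \<forall>n\<ge>N. norm (X n) \<le> d + 1 / real (Suc n)" using X(2) less_imp_le by blast
  qed
  have x0n: "x0 \<noteq> 0" using \<phi>0 linear_0[OF lin] by auto
  \<comment> \<open>Moving \<open>x0\<close> along the kernel stays on the hyperplane, so it cannot
    shorten \<open>x0\<close>.\<close>
  have orth: "ip x0 h = 0" if h: "\<phi> h = 0" for h
  proof (cases "h = 0")
    case False
    let ?t = "ip x0 h / complex_of_real ((norm h)\<^sup>2)"
    have "\<phi> (x0 - ?t *\<^sub>C h) = 1" by (simp add: linear_diff[OF lin] sc h \<phi>0)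
    then have "norm x0 \<le> norm (x0 - ?t *\<^sub>C h)" using d_le \<open>norm x0 \<le> d\<close> by fastforce
    then have "(norm x0)\<^sup>2 \<le> (norm (x0 - ?t *\<^sub>C h))\<^sup>2" by (rule power_mono) simp
    also have "\<dots> = (norm x0)\<^sup>2 - (cmod (ip x0 h))\<^sup>2 / (norm h)\<^sup>2" by (rule norm_diff_project[OF False])
    finally have "(cmod (ip x0 h))\<^sup>2 / (norm h)\<^sup>2 \<le> 0" by simp
    then show ?thesis using False by (simp add: divide_le_0_iff)
  qed simp
  have "\<phi> x = ip x (complex_of_real (1 / (norm x0)\<^sup>2) *\<^sub>C x0)" for x
  proof -
    have "\<phi> (x - \<phi> x *\<^sub>C x0) = 0" by (simp add: linear_diff[OF lin] sc \<phi>0)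
    then have "ip x0 (x - \<phi> x *\<^sub>C x0) = 0" by (rule orth)
    then have "ip (x - \<phi> x *\<^sub>C x0) x0 = 0" using ip_commute[of "x - \<phi> x *\<^sub>C x0" x0] by simp
    then have "ip x x0 = \<phi> x * complex_of_real ((norm x0)\<^sup>2)"
      by (simp add: ip_diff_left ip_scale_left ip_self)
    then show ?thesis using x0n by (simp add: ip_scale_right)
  qed
  then show ?thesis by (rule that)
qed

text \<open>Zero vectors are admitted, so that the Gram--Schmidt procedure below can be applied to
  linearly dependent sequences.\<close>

definition orthonormal_or_zero :: "(nat \<Rightarrow> 'a) \<Rightarrow> bool" where
  "orthonormal_or_zero e \<longleftrightarrow> (\<forall>i j. ip (e i) (e j) = (if i = j \<and> e i \<noteq> 0 then 1 else 0))"

lemma ip_sum_onz: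
  assumes "orthonormal_or_zero e" "finite A"
  shows "ip (\<Sum>i\<in>A. c i *\<^sub>C e i) (e j) = (if j \<in> A \<and> e j \<noteq> 0 then c j else 0)"
proof -
  have "ip (\<Sum>i\<in>A. c i *\<^sub>C e i) (e j) = (\<Sum>i\<in>A. if i = j then (if e j \<noteq> 0 then c j else 0) else 0)"
    using assms(1) unfolding ip_sum_left ip_scale_left orthonormal_or_zero_def
    by (intro sum.cong) auto
  then show ?thesis using assms(2) by simp
qed

text \<open>Only an inequality, because some \<open>e i\<close> may be zero.\<close>

lemma norm_sum_onz_le:
  assumes "orthonormal_or_zero e" "finite A"
  shows "(norm (\<Sum>i\<in>A. c i *\<^sub>C e i))\<^sup>2 \<le> (\<Sum>i\<in>A. (cmod (c i))\<^sup>2)"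
  using assms(2)
proof (induction A rule: finite_induct)
  case (insert j A)
  have "ip (\<Sum>i\<in>A. c i *\<^sub>C e i) (c j *\<^sub>C e j) = 0"
    using insert ip_sum_onz[OF assms(1) insert(1), of c j] by (simp add: ip_scale_right)
  then have "(norm ((\<Sum>i\<in>A. c i *\<^sub>C e i) + c j *\<^sub>C e j))\<^sup>2
      = (norm (\<Sum>i\<in>A. c i *\<^sub>C e i))\<^sup>2 + (norm (c j *\<^sub>C e j))\<^sup>2"
    by (rule pythagoras)
  moreover have "(norm (c j *\<^sub>C e j))\<^sup>2 \<le> (cmod (c j))\<^sup>2"
  proof -
    have "(norm (e j))\<^sup>2 \<le> 1"
      using assms(1) by (simp add: norm_sq_eq_ip orthonormal_or_zero_def)
    then have "(cmod (c j))\<^sup>2 * (norm (e j))\<^sup>2 \<le> (cmod (c j))\<^sup>2 * 1" by (intro mult_left_mono) auto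
    then show ?thesis by (simp add: norm_scaleC power_mult_distrib)
  qed
  ultimately have "(norm ((\<Sum>i\<in>A. c i *\<^sub>C e i) + c j *\<^sub>C e j))\<^sup>2
      \<le> (\<Sum>i\<in>A. (cmod (c i))\<^sup>2) + (cmod (c j))\<^sup>2"
    using insert.IH by linarith
  then show ?case using insert.hyps by (simp add: add.commute)
qed simp

lemma bessel:
  assumes "orthonormal_or_zero e" "finite A"
  shows "(\<Sum>i\<in>A. (cmod (ip x (e i)))\<^sup>2) \<le> (norm x)\<^sup>2"
proof -
  define s where "s = (\<Sum>i\<in>A. ip x (e i) *\<^sub>C e i)"
  have sx: "ip s (e j) = ip x (e j)" if "j \<in> A" for j
    using ip_sum_onz[OF assms, of "\<lambda>i. ip x (e i)" j] that by (auto simp: s_def)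
  have "ip (x - s) s = (\<Sum>i\<in>A. cnj (ip x (e i)) * (ip x (e i) - ip s (e i)))"
    unfolding s_def[of] by (simp add: ip_sum_right ip_scale_right ip_diff_left)
  also have "\<dots> = 0" using sx by simp
  finally have "(norm (x - s + s))\<^sup>2 = (norm (x - s))\<^sup>2 + (norm s)\<^sup>2" by (rule pythagoras)
  then have "(norm s)\<^sup>2 \<le> (norm x)\<^sup>2" by simp
  moreover have "(norm s)\<^sup>2 = (\<Sum>i\<in>A. (cmod (ip x (e i)))\<^sup>2)"
  proof -
    have "complex_of_real ((norm s)\<^sup>2) = ip s s" by (rule ip_self[symmetric])
    also have "\<dots> = (\<Sum>i\<in>A. cnj (ip x (e i)) * ip s (e i))"
      by (subst (2) s_def) (simp add: ip_sum_right ip_scale_right)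
    also have "\<dots> = (\<Sum>i\<in>A. complex_of_real ((cmod (ip x (e i)))\<^sup>2))"
      using sx by (intro sum.cong) (auto simp: complex_norm_square mult.commute simp del: of_real_power)
    finally have "complex_of_real ((norm s)\<^sup>2) = complex_of_real (\<Sum>i\<in>A. (cmod (ip x (e i)))\<^sup>2)"
      by simp
    then show ?thesis using of_real_eq_iff by blast
  qed
  ultimately show ?thesis by simp
qed

text \<open>The contraction that carries each nonzero \<open>e n\<close> to \<open>k n\<close> and
  annihilates the orthogonal complement of the sequence \<open>e\<close>; exchanging
  \<open>e\<close> and \<open>k\<close> gives its adjoint.\<close>

definition basis_transfer :: "(nat \<Rightarrow> 'a) \<Rightarrow> (nat \<Rightarrow> 'a) \<Rightarrow> 'a \<Rightarrow> 'a" where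
  "basis_transfer e k x = (\<Sum>n. ip x (e n) *\<^sub>C k n)"

lemma summable_basis_transfer:
  assumes e: "orthonormal_or_zero e" and k: "orthonormal_or_zero k"
  shows "summable (\<lambda>n. ip x (e n) *\<^sub>C k n)"
proof -
  have "summable (\<lambda>n. (cmod (ip x (e n)))\<^sup>2)"
  proof (rule summableI_nonneg_bounded)
    show "(\<Sum>i<n. (cmod (ip x (e i)))\<^sup>2) \<le> (norm x)\<^sup>2" for n by (rule bessel[OF e]) simp
  qed simp
  note S = this
  show ?thesis
    unfolding summable_Cauchy
  proof (intro allI impI)
    fix r :: real assume r: "r > 0"
    then obtain N where N: "\<And>m n. m \<ge> N \<Longrightarrow> norm (\<Sum>i\<in>{m..<n}. (cmod (ip x (e i)))\<^sup>2) < r\<^sup>2"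
      using S unfolding summable_Cauchy by (metis zero_less_power)
    have "norm (\<Sum>i\<in>{m..<n}. ip x (e i) *\<^sub>C k i) < r" if "m \<ge> N" for m n
    proof -
      have "(norm (\<Sum>i\<in>{m..<n}. ip x (e i) *\<^sub>C k i))\<^sup>2 \<le> (\<Sum>i\<in>{m..<n}. (cmod (ip x (e i)))\<^sup>2)"
        by (rule norm_sum_onz_le[OF k]) simp
      also have "\<dots> < r\<^sup>2" using N[OF that, of n] by simp
      finally show ?thesis by (rule power2_less_imp_less) (use r in simp)
    qed
    then show "\<exists>N. \<forall>m\<ge>N. \<forall>n. norm (\<Sum>i\<in>{m..<n}. ip x (e i) *\<^sub>C k i) < r" by blast
  qed
qed

lemma bounded_clinear_basis_transfer:
  assumes e: "orthonormal_or_zero e" and k: "orthonormal_or_zero k"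
  shows "bounded_clinear (basis_transfer e k)"
proof -
  note S = summable_basis_transfer[OF assms]
  have add: "basis_transfer e k (x + y) = basis_transfer e k x + basis_transfer e k y" for x y
    unfolding basis_transfer_def by (simp add: suminf_add[OF S S] ip_add_left scaleC_add_left)
  have sc: "basis_transfer e k (c *\<^sub>C x) = c *\<^sub>C basis_transfer e k x" for c x
    unfolding basis_transfer_def
    by (simp add: bounded_linear.suminf[OF bounded_linear_scaleC S] ip_scale_left scaleC_scaleC)
  have "bounded_linear (basis_transfer e k)"
  proof (rule bounded_linear_intro[where K = 1])
    show "basis_transfer e k (r *\<^sub>R x) = r *\<^sub>R basis_transfer e k x" for r x
      using sc[of "complex_of_real r" x] by (simp add: scaleC_of_real)
    show "norm (basis_transfer e k x) \<le> norm x * 1" for x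
    proof (rule LIMSEQ_le_const2)
      show "(\<lambda>n. norm (\<Sum>i<n. ip x (e i) *\<^sub>C k i)) \<longlonglongrightarrow> norm (basis_transfer e k x)"
        unfolding basis_transfer_def by (intro tendsto_norm summable_LIMSEQ S)
      have "norm (\<Sum>i<n. ip x (e i) *\<^sub>C k i) \<le> norm x" for n
      proof (rule power2_le_imp_le)
        show "(norm (\<Sum>i<n. ip x (e i) *\<^sub>C k i))\<^sup>2 \<le> (norm x)\<^sup>2"
          using norm_sum_onz_le[OF k, of "{..<n}"] bessel[OF e, of "{..<n}" x]
          by (meson finite_lessThan order_trans)
      qed simp
      then show "\<exists>N. \<forall>n\<ge>N. norm (\<Sum>i<n. ip x (e i) *\<^sub>C k i) \<le> norm x * 1" by simp
    qed
  qed (rule add)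
  then show ?thesis using sc by (simp add: bounded_clinear_def)
qed

lemma ip_basis_transfer:
  assumes e: "orthonormal_or_zero e" and k: "orthonormal_or_zero k"
  shows "ip (basis_transfer e k x) (k j) = (if k j \<noteq> 0 then ip x (e j) else 0)"
proof (rule LIMSEQ_unique)
  show "(\<lambda>n. ip (\<Sum>i<n. ip x (e i) *\<^sub>C k i) (k j)) \<longlonglongrightarrow> ip (basis_transfer e k x) (k j)"
    unfolding basis_transfer_def
    by (intro bounded_linear.tendsto[OF bounded_linear_ip_left] summable_LIMSEQ summable_basis_transfer assms)
  show "(\<lambda>n. ip (\<Sum>i<n. ip x (e i) *\<^sub>C k i) (k j)) \<longlonglongrightarrow> (if k j \<noteq> 0 then ip x (e j) else 0)"
  proof (rule tendsto_eventually)
    show "\<forall>\<^sub>F n in sequentially. ip (\<Sum>i<n. ip x (e i) *\<^sub>C k i) (k j) = (if k j \<noteq> 0 then ip x (e j) else 0)"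
      using eventually_gt_at_top[of j] by eventually_elim (simp add: ip_sum_onz[OF k])
  qed
qed

text \<open>\<open>sgn\<close> normalises and sends \<open>0\<close> to \<open>0\<close>, so a
  vector that depends linearly on its predecessors contributes a zero vector.\<close>

function gram_schmidt :: "(nat \<Rightarrow> 'a) \<Rightarrow> nat \<Rightarrow> 'a" where
  "gram_schmidt x n = sgn (x n - (\<Sum>i<n. ip (x n) (gram_schmidt x i) *\<^sub>C gram_schmidt x i))"
  by auto
termination by (relation "Wellfounded.measure snd") auto

declare gram_schmidt.simps [simp del]

lemma gram_schmidt_onz: "orthonormal_or_zero (gram_schmidt x)"
proof -
  let ?g = "gram_schmidt x"
  have self: "ip (?g n) (?g n) = (if ?g n \<noteq> 0 then 1 else 0)" for n
  proof (cases "?g n = 0")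
    case False
    then have "norm (?g n) = 1" by (simp add: gram_schmidt.simps[of x n] norm_sgn sgn_zero_iff)
    then show ?thesis using False by (simp add: ip_self)
  qed simp
  have "\<forall>i<n. \<forall>j<n. i \<noteq> j \<longrightarrow> ip (?g i) (?g j) = 0" for n
  proof (induction n)
    case (Suc n)
    have 1: "ip (?g n) (?g j) = 0" if j: "j < n" for j
    proof -
      have "ip (\<Sum>i<n. ip (x n) (?g i) *\<^sub>C ?g i) (?g j) = (\<Sum>i<n. if i = j then ip (x n) (?g j) else 0)"
        unfolding ip_sum_left ip_scale_left
        using Suc j self[of j] by (intro sum.cong) auto
      also have "\<dots> = ip (x n) (?g j)" using j by simp
      finally have "ip (x n - (\<Sum>i<n. ip (x n) (?g i) *\<^sub>C ?g i)) (?g j) = 0"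
        by (simp add: ip_diff_left)
      then show ?thesis
        by (subst gram_schmidt.simps[of x n]) (simp add: sgn_div_norm ip_scaleR_left)
    qed
    then have "ip (?g j) (?g n) = 0" if "j < n" for j
      using that ip_commute[of "?g j" "?g n"] by simp
    with 1 Suc show ?case by (auto simp: less_Suc_eq)
  qed simp
  then have "ip (?g i) (?g j) = 0" if "i \<noteq> j" for i j
    using that by (meson lessI less_trans not_less_iff_gr_or_eq)
  with self show ?thesis by (simp add: orthonormal_or_zero_def)
qed

text \<open>Each \<open>x n\<close> is a combination of the first \<open>Suc n\<close> Gram-Schmidt
  vectors, also when the last of them is zero, since the residual is then zero as well.\<close>

lemma gram_schmidt_total:
  assumes "\<And>n. ip y (gram_schmidt x n) = 0"
  shows "ip y (x n) = 0"
proof -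
  define v where "v = x n - (\<Sum>i<n. ip (x n) (gram_schmidt x i) *\<^sub>C gram_schmidt x i)"
  have "v = complex_of_real (norm v) *\<^sub>C gram_schmidt x n"
    by (cases "v = 0") (simp_all add: gram_schmidt.simps[of x n] v_def[symmetric] scaleC_of_real sgn_div_norm)
  then have "ip y v = 0" using assms by (metis ip_scale_right mult_zero_right)
  then show ?thesis
    by (simp add: v_def ip_diff_right ip_sum_right ip_scale_right assms)
qed

lemma csubspace_sum_scaleC:
  assumes "csubspace M" "\<And>i. i \<in> A \<Longrightarrow> f i \<in> M"
  shows "(\<Sum>i\<in>A. c i *\<^sub>C f i) \<in> M"
  using assms unfolding csubspace_def by (intro subspace_sum) auto

lemma gram_schmidt_mem:
  assumes M: "\<And>n. csubspace (M n)" "\<And>n. M n \<subseteq> M (Suc n)" and x: "\<And>n. x n \<in> M (Suc n)"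
  shows "gram_schmidt x n \<in> M (Suc n)"
proof (induction n rule: less_induct)
  case (less n)
  have mono: "M i \<subseteq> M j" if "i \<le> j" for i j using lift_Suc_mono_le[of M, OF M(2) that] .
  have "(\<Sum>i<n. ip (x n) (gram_schmidt x i) *\<^sub>C gram_schmidt x i) \<in> M (Suc n)"
    using less mono by (intro csubspace_sum_scaleC M(1)) (meson lessThan_iff less_SucI less_or_eq_imp_le not_less_eq subsetD)
  then show ?case
    using M(1)[of "Suc n"] x[of n] unfolding csubspace_def
    by (simp add: gram_schmidt.simps[of x n] sgn_div_norm subspace_diff subspace_scale)
qed

lemma gram_schmidt_nonzero:
  assumes M: "\<And>n. csubspace (M n)" "\<And>n. M n \<subseteq> M (Suc n)" and x: "\<And>n. x n \<in> M (Suc n)" "\<And>n. x n \<notin> M n"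
  shows "gram_schmidt x n \<noteq> 0"
proof
  assume "gram_schmidt x n = 0"
  then have "x n = (\<Sum>i<n. ip (x n) (gram_schmidt x i) *\<^sub>C gram_schmidt x i)"
    by (simp add: gram_schmidt.simps[of x n] sgn_zero_iff)
  also have "\<dots> \<in> M n"
  proof (intro csubspace_sum_scaleC M(1))
    fix i assume "i \<in> {..<n}"
    then have "M (Suc i) \<subseteq> M n" using lift_Suc_mono_le[of M, OF M(2)] by simp
    then show "gram_schmidt x i \<in> M n" using gram_schmidt_mem[of M x, OF M x(1)] by blast
  qed
  finally show False using x(2) by blast
qed

text \<open>Caradus' criterion: a surjection with infinite-dimensional kernel is universal. Separability
  is expressed by a sequence of bounded functionals that separates points.\<close>

theorem universal_criterion:
  fixes \<phi> :: "nat \<Rightarrow> 'a \<Rightarrow> complex" and M :: "nat \<Rightarrow> 'a set"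
  assumes U: "bounded_clinear U" and W: "bounded_clinear W" and UW: "\<And>x. U (W x) = x"
    and \<phi>: "\<And>n. bounded_linear (\<phi> n)" "\<And>n c x. \<phi> n (c *\<^sub>C x) = c * \<phi> n x"
    and sep: "\<And>x. (\<And>n. \<phi> n x = 0) \<Longrightarrow> x = 0"
    and M: "\<And>n. csubspace (M n)" "\<And>n. M n \<subset> M (Suc n)" and ker: "\<And>n x. x \<in> M n \<Longrightarrow> U x = 0"
  shows "universal U"
proof -
  \<comment> \<open>Riesz representation turns the separating functionals into a total sequence of
    vectors. It may be linearly dependent, so \<open>e\<close> may contain zeros, whereas
    \<open>k\<close> cannot.\<close>
  have "\<exists>z. \<forall>x. \<phi> n x = ip x z" for n by (metis riesz_representation \<phi>)
  then obtain z where z: "\<And>n x. \<phi> n x = ip x (z n)" by metis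
  have "\<exists>y. y \<in> M (Suc n) \<and> y \<notin> M n" for n using M(2)[of n] by blast
  then obtain y where y: "\<And>n. y n \<in> M (Suc n)" "\<And>n. y n \<notin> M n" by metis
  define e where "e = gram_schmidt z"
  define k where "k = gram_schmidt y"
  have e: "orthonormal_or_zero e" and k: "orthonormal_or_zero k"
    unfolding e_def k_def by (rule gram_schmidt_onz)+
  have Msub: "M n \<subseteq> M (Suc n)" for n using M(2)[of n] by blast
  have k0: "k n \<noteq> 0" for n unfolding k_def by (rule gram_schmidt_nonzero[of M y, OF M(1) Msub y])
  have Uk: "U (k n) = 0" for n
    unfolding k_def using gram_schmidt_mem[of M y, OF M(1) Msub y(1)] ker by blast
  have UV: "U (basis_transfer e k x) = 0" for x
    using bounded_linear.suminf[OF bounded_clinearD(1)[OF U] summable_basis_transfer[OF e k, of x]]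
    by (simp add: basis_transfer_def bounded_clinearD(2)[OF U] Uk)
  have total: "x = 0" if "\<And>n. ip x (e n) = 0" for x
  proof (rule sep)
    show "\<phi> n x = 0" for n
      unfolding z using that unfolding e_def by (rule gram_schmidt_total)
  qed
  \<comment> \<open>No \<open>k n\<close> vanishes, so transferring back recovers every coefficient
    with respect to \<open>e\<close>, and \<open>e\<close> is total.\<close>
  have LV: "basis_transfer k e (basis_transfer e k x) = x" for x
  proof -
    have "ip (basis_transfer k e (basis_transfer e k x) - x) (e n) = 0" for n
      by (simp add: ip_diff_left ip_basis_transfer[OF k e] ip_basis_transfer[OF e k] k0)
    then have "basis_transfer k e (basis_transfer e k x) - x = 0" by (rule total)
    then show ?thesis by simp
  qed
  show ?thesis
    by (rule universal_if_right_inverse[OF U W bounded_clinear_basis_transfer[OF e k]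
          bounded_clinear_basis_transfer[OF k e] UW UV LV])
qed

end

section \<open>Point evaluations and completeness of the Hardy space\<close>

lemma nn_integral_continuous_on_Icc:
  fixes f :: "real \<Rightarrow> real"
  assumes "continuous_on {a..b} f" "\<And>t. t \<in> {a..b} \<Longrightarrow> 0 \<le> f t"
  shows "(\<integral>\<^sup>+t\<in>{a..b}. ennreal (f t) \<partial>lborel) = ennreal (integral {a..b} f)"
proof -
  have int: "set_integrable lborel {a..b} f"
    using assms(1) by (rule borel_integrable_atLeastAtMost')
  have "(\<integral>\<^sup>+t\<in>{a..b}. ennreal (f t) \<partial>lborel)
      = (\<integral>\<^sup>+t. ennreal (indicat_real {a..b} t *\<^sub>R f t) \<partial>lborel)"
    by (intro nn_integral_cong) (auto split: split_indicator)
  also have "\<dots> = ennreal (LINT t:{a..b}|lborel. f t)"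
    using int assms(2) unfolding set_integrable_def set_lebesgue_integral_def
    by (intro nn_integral_eq_integral) (auto split: split_indicator)
  finally show ?thesis
    using set_borel_integral_eq_integral(2)[OF int] by simp
qed

text \<open>The speed \<open>2 * pi * r\<close> of the parametrisation cancels \<open>2 * pi\<close>
  and leaves \<open>r * cmod (k z)\<close>. The kernel is left open to serve both point values and
  differences of \<open>f\<close>.\<close>

lemma circle_kernel_bound:
  fixes f k :: "complex \<Rightarrow> complex"
  assumes f: "continuous_on (sphere c r) f" and r: "r > 0"
    and k: "\<And>z. z \<in> sphere c r \<Longrightarrow> r * cmod (k z) \<le> B"
    and I: "((\<lambda>z. f z * k z) has_contour_integral 2 * complex_of_real pi * \<i> * I) (circlepath c r)"
  shows "ennreal ((cmod I)\<^sup>2)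
    \<le> ennreal (B\<^sup>2) * (\<integral>\<^sup>+t\<in>{0..1}. ennreal ((cmod (f (circlepath c r t)))\<^sup>2) \<partial>lborel)"
proof -
  let ?p = "circlepath c r"
  define F where "F t = cmod (f (?p t))" for t
  define m where "m = integral {0..1} F"
  have mem: "?p t \<in> sphere c r" for t
    using r by (simp add: circlepath dist_norm norm_mult)
  have "0 \<le> r * cmod (k (?p 0))" using r by simp
  also have "\<dots> \<le> B" using k mem by blast
  finally have B: "0 \<le> B" .
  have cp: "continuous_on {0..1} ?p"
    by (metis path_circlepath path_def)
  have cF: "continuous_on {0..1} F"
    unfolding F_def by (intro continuous_on_norm continuous_on_compose2[OF f cp]) (use mem in auto)
  have hi: "((\<lambda>t. f (?p t) * k (?p t) * vector_derivative ?p (at t)) has_integral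
      2 * complex_of_real pi * \<i> * I) {0..1}"
    using I unfolding has_contour_integral .
  have bd: "cmod (f (?p t) * k (?p t) * vector_derivative ?p (at t)) \<le> 2 * pi * B * F t" for t
  proof -
    have "cmod (f (?p t) * k (?p t) * vector_derivative ?p (at t)) = 2 * pi * F t * (r * cmod (k (?p t)))"
      using r by (simp add: F_def norm_mult vector_derivative_circlepath)
    also have "\<dots> \<le> 2 * pi * F t * B"
      by (intro mult_left_mono k mem) (simp add: F_def)
    finally show ?thesis by (simp add: mult_ac)
  qed
  have "cmod (integral {0..1} (\<lambda>t. f (?p t) * k (?p t) * vector_derivative ?p (at t)))
      \<le> integral {0..1} (\<lambda>t. 2 * pi * B * F t)"
  proof (rule integral_norm_bound_integral)
    show "(\<lambda>t. f (?p t) * k (?p t) * vector_derivative ?p (at t)) integrable_on {0..1}"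
      using hi by blast
    show "(\<lambda>t. 2 * pi * B * F t) integrable_on {0..1}"
      by (intro integrable_continuous_interval continuous_intros cF)
  qed (rule bd)
  then have "2 * pi * cmod I \<le> 2 * pi * (B * m)"
    using hi by (simp add: integral_unique norm_mult m_def mult_ac)
  then have "cmod I \<le> B * m" by simp
  then have 1: "(cmod I)\<^sup>2 \<le> B\<^sup>2 * m\<^sup>2"
    by (metis norm_ge_zero power_mono power_mult_distrib)
  have iF: "F integrable_on {0..1}" "(\<lambda>t. (F t)\<^sup>2) integrable_on {0..1}"
    by (auto intro!: integrable_continuous_interval continuous_intros cF)
  \<comment> \<open>The mean of \<open>(F t - m)\<^sup>2\<close> is nonnegative: Jensen's inequality
    for the square.\<close>
  have "((\<lambda>t. (F t)\<^sup>2 - 2 * m * F t + m\<^sup>2) has_integral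
      integral {0..1} (\<lambda>t. (F t)\<^sup>2) - 2 * m * m + m\<^sup>2) {0..1}"
    using iF has_integral_const_real[of "m\<^sup>2" 0 1] unfolding m_def
    by (intro has_integral_add has_integral_diff has_integral_mult_right integrable_integral) auto
  then have "0 \<le> integral {0..1} (\<lambda>t. (F t)\<^sup>2) - 2 * m * m + m\<^sup>2"
  proof (rule has_integral_nonneg)
    fix t
    have "0 \<le> (F t - m)\<^sup>2" by simp
    then show "0 \<le> (F t)\<^sup>2 - 2 * m * F t + m\<^sup>2" by (simp add: power2_diff algebra_simps)
  qed
  then have "m\<^sup>2 \<le> integral {0..1} (\<lambda>t. (F t)\<^sup>2)"
    by (simp add: power2_eq_square)
  then have "B\<^sup>2 * m\<^sup>2 \<le> B\<^sup>2 * integral {0..1} (\<lambda>t. (F t)\<^sup>2)"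
    by (intro mult_left_mono) auto
  with 1 have "ennreal ((cmod I)\<^sup>2) \<le> ennreal (B\<^sup>2 * integral {0..1} (\<lambda>t. (F t)\<^sup>2))"
    by (intro ennreal_leI) linarith
  also have "\<dots> = ennreal (B\<^sup>2) * ennreal (integral {0..1} (\<lambda>t. (F t)\<^sup>2))"
    by (simp add: ennreal_mult')
  also have "ennreal (integral {0..1} (\<lambda>t. (F t)\<^sup>2)) = (\<integral>\<^sup>+t\<in>{0..1}. ennreal ((F t)\<^sup>2) \<partial>lborel)"
    by (intro nn_integral_continuous_on_Icc[symmetric] continuous_intros cF) auto
  finally show ?thesis unfolding F_def .
qed

text \<open>For a fixed angle \<open>t\<close> the points of the moving circles run through one
  vertical line, at an abscissa within \<open>r\<close> of \<open>x\<close>. Fubini's theorem thus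
  produces an average of line integrals.\<close>

lemma circle_line_average:
  assumes f: "f holomorphic_on right_half_plane" and r: "0 < r" "r < x"
    and M: "\<And>x'. \<bar>x' - x\<bar> \<le> r \<Longrightarrow> line_integral f x' \<le> M"
  shows "(\<integral>\<^sup>+y. (\<integral>\<^sup>+t\<in>{0..1}. ennreal ((cmod (f (circlepath (Complex x y) r t)))\<^sup>2) \<partial>lborel) \<partial>lborel) \<le> M"
proof -
  define G where "G = (\<lambda>(y, t). ennreal ((cmod (f (circlepath (Complex x y) r t)))\<^sup>2))"
  have cp: "circlepath (Complex x y) r t = Complex (x + r * cos (2 * pi * t)) (r * sin (2 * pi * t) + 1 * y)" for y t
    by (simp add: circlepath complex_eq_iff exp_eq_polar Re_exp Im_exp)
  have rc: "\<bar>r * cos (2 * pi * t)\<bar> \<le> r" for t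
    using r mult_left_mono[of "\<bar>cos (2 * pi * t)\<bar>" 1 r] by (simp add: abs_mult)
  have pos: "x + r * cos (2 * pi * t) > 0" for t
    using rc[of t] r by linarith
  have "continuous_on UNIV (\<lambda>(y, t). f (circlepath (Complex x y) r t))"
    unfolding case_prod_beta
  proof (rule continuous_on_compose2[where f = "\<lambda>p. circlepath (Complex x (fst p)) r (snd p)" and t = right_half_plane])
    show "continuous_on right_half_plane f"
      using f by (rule holomorphic_on_imp_continuous_on)
    show "continuous_on UNIV (\<lambda>p. circlepath (Complex x (fst p)) r (snd p))"
      unfolding circlepath complex_eq by (intro continuous_intros)
    show "range (\<lambda>p. circlepath (Complex x (fst p)) r (snd p)) \<subseteq> right_half_plane"
      using pos by (auto simp: cp)
  qed
  then have "(\<lambda>(y, t). f (circlepath (Complex x y) r t)) \<in> borel_measurable borel"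
    by (rule borel_measurable_continuous_onI)
  then have [measurable]: "(\<lambda>(y, t). f (circlepath (Complex x y) r t)) \<in> borel_measurable (borel \<Otimes>\<^sub>M borel)"
    by (simp add: borel_prod)
  have "(\<integral>\<^sup>+y. (\<integral>\<^sup>+t\<in>{0..1}. ennreal ((cmod (f (circlepath (Complex x y) r t)))\<^sup>2) \<partial>lborel) \<partial>lborel)
      = (\<integral>\<^sup>+t. (\<integral>\<^sup>+y. ennreal ((cmod (f (circlepath (Complex x y) r t)))\<^sup>2) * indicator {0..1} t \<partial>lborel) \<partial>lborel)"
    by (rule lborel_pair.Fubini') measurable
  also have "\<dots> \<le> (\<integral>\<^sup>+t. M * indicator {0..1} t \<partial>(lborel :: real measure))"
  proof (rule nn_integral_mono)
    fix t :: real
    have [measurable]: "(\<lambda>y. f (Complex (x + r * cos (2 * pi * t)) y)) \<in> borel_measurable borel"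
      using line_measurable[OF f pos] .
    have "(\<integral>\<^sup>+y. ennreal ((cmod (f (circlepath (Complex x y) r t)))\<^sup>2) \<partial>lborel)
        = line_integral f (x + r * cos (2 * pi * t))"
      unfolding cp line_integral_def
      by (subst nn_integral_real_affine[where c = 1 and t = "r * sin (2 * pi * t)"]) auto
    also have "\<dots> \<le> M" using rc[of t] by (intro M) simp
    finally show "(\<integral>\<^sup>+y. ennreal ((cmod (f (circlepath (Complex x y) r t)))\<^sup>2) * indicator {0..1} t \<partial>lborel)
        \<le> M * indicator {0..1} t"
      by (auto split: split_indicator)
  qed
  also have "\<dots> = M" by (simp add: nn_integral_cmult_indicator)
  finally show ?thesis .
qed

lemma rhp_cball:
  assumes "r < Re c" shows "cball c r \<subseteq> right_half_plane"
proof
  fix z assume "z \<in> cball c r"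
  then have "\<bar>Re (c - z)\<bar> \<le> r" using abs_Re_le_cmod[of "c - z"] by (simp add: dist_norm)
  then show "z \<in> right_half_plane" using assms by (simp add: right_half_plane_def)
qed

lemma circle_average_measurable:
  assumes f: "f holomorphic_on right_half_plane" and r: "0 < r" "r < x"
  shows "(\<lambda>y. \<integral>\<^sup>+t\<in>{0..1}. ennreal ((cmod (f (circlepath (Complex x y) r t)))\<^sup>2) \<partial>lborel) \<in> borel_measurable borel"
proof -
  have "continuous_on UNIV (\<lambda>p. f (circlepath (Complex x (fst p)) r (snd p)))"
  proof (rule continuous_on_compose2[where f = "\<lambda>p. circlepath (Complex x (fst p)) r (snd p)" and t = right_half_plane])
    show "continuous_on right_half_plane f"
      using f by (rule holomorphic_on_imp_continuous_on)
    show "continuous_on UNIV (\<lambda>p. circlepath (Complex x (fst p)) r (snd p))"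
      unfolding circlepath complex_eq by (intro continuous_intros)
    show "range (\<lambda>p. circlepath (Complex x (fst p)) r (snd p)) \<subseteq> right_half_plane"
    proof safe
      fix y t :: real
      have "circlepath (Complex x y) r t \<in> cball (Complex x y) r"
        using r by (simp add: circlepath dist_norm norm_mult)
      then show "circlepath (Complex x (fst (y, t))) r (snd (y, t)) \<in> right_half_plane"
        using rhp_cball[of r "Complex x y"] r by auto
    qed
  qed
  then have "(\<lambda>p. f (circlepath (Complex x (fst p)) r (snd p))) \<in> borel_measurable borel"
    by (rule borel_measurable_continuous_onI)
  then have [measurable]: "(\<lambda>p. f (circlepath (Complex x (fst p)) r (snd p))) \<in> borel_measurable (borel \<Otimes>\<^sub>M borel)"
    by (simp add: borel_prod)
  show ?thesis by measurable
qed

text \<open>Cauchy's formula is averaged over circles whose centre moves vertically, which turns the circle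
  integrals into line integrals.\<close>

lemma line_pointwise_bound:
  assumes f: "f holomorphic_on right_half_plane" and w: "w \<in> right_half_plane"
    and M: "\<And>x. x > 0 \<Longrightarrow> line_integral f x \<le> M"
  shows "ennreal ((cmod (f w))\<^sup>2) * ennreal (Re w / 2) \<le> 4 * M"
proof -
  \<comment> \<open>The discs of radius \<open>r\<close> stay in the half-plane, and centres within
    \<open>r / 2\<close> of \<open>w\<close> keep \<open>r\<close> times the kernel at most 2; its
    square is the factor 4.\<close>
  define r where "r = Re w / 2"
  have r: "r > 0" "r < Re w" using w by (auto simp: r_def right_half_plane_def)
  define J where "J y = (\<integral>\<^sup>+t\<in>{0..1}. ennreal ((cmod (f (circlepath (Complex (Re w) y) r t)))\<^sup>2) \<partial>lborel)" for y
  have 1: "ennreal ((cmod (f w))\<^sup>2) \<le> 4 * J y" if y: "y \<in> {Im w - r/2..Im w + r/2}" for y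
  proof -
    let ?c = "Complex (Re w) y"
    have sub: "cball ?c r \<subseteq> right_half_plane" using r by (intro rhp_cball) simp
    have "cmod (w - ?c) = \<bar>Im w - y\<bar>" by (simp add: cmod_def)
    then have d: "cmod (w - ?c) \<le> r/2" by (rule ord_eq_le_trans) (intro abs_leI; use y in auto)
    with r have lt: "cmod (w - ?c) < r" by linarith
    have "((\<lambda>u. f u * (1 / (u - w))) has_contour_integral 2 * complex_of_real pi * \<i> * f w) (circlepath ?c r)"
      using Cauchy_integral_circlepath_simple[OF holomorphic_on_subset[OF f sub] lt]
      by (simp only: times_divide_eq_right mult_1_right)
    moreover have "r * cmod (1 / (z - w)) \<le> 2" if z: "z \<in> sphere ?c r" for z
    proof -
      have "r = cmod (z - ?c)" using z by (metis dist_commute dist_norm mem_sphere)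
      also have "\<dots> \<le> cmod (z - w) + cmod (w - ?c)"
        using norm_triangle_ineq[of "z - w" "w - ?c"] by simp
      finally have "r/2 \<le> cmod (z - w)" using d by linarith
      then show ?thesis using r by (simp add: norm_divide divide_simps)
    qed
    moreover have "continuous_on (sphere ?c r) f"
      using holomorphic_on_imp_continuous_on[OF f] sub
      by (meson continuous_on_subset dual_order.trans sphere_cball)
    ultimately show ?thesis
      using circle_kernel_bound[of ?c r f "\<lambda>u. 1 / (u - w)" 2 "f w"] r by (simp add: J_def)
  qed
  have "ennreal ((cmod (f w))\<^sup>2) * ennreal r
      = (\<integral>\<^sup>+y\<in>{Im w - r/2..Im w + r/2}. ennreal ((cmod (f w))\<^sup>2) \<partial>lborel)"
    using r by (simp add: nn_integral_cmult_indicator)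
  also have "\<dots> \<le> (\<integral>\<^sup>+y. 4 * J y \<partial>lborel)"
    using 1 by (intro nn_integral_mono) (auto split: split_indicator)
  also have "\<dots> \<le> 4 * M"
  proof -
    have "J \<in> borel_measurable borel"
      unfolding J_def by (rule circle_average_measurable[OF f r])
    then have "(\<integral>\<^sup>+y. 4 * J y \<partial>lborel) = 4 * (\<integral>\<^sup>+y. J y \<partial>lborel)"
      by (intro nn_integral_cmult) auto
    also have "\<dots> \<le> 4 * M"
      unfolding J_def using r M by (intro mult_left_mono circle_line_average f) (auto simp: abs_le_iff)
    finally show ?thesis .
  qed
  finally show ?thesis unfolding r_def .
qed

lemma h2_normsq_eq: "h2_normsq (Rep_h2 f) = ennreal ((norm f)\<^sup>2)"
  using h2_normsq_root[OF Rep_h2[of f]] by (simp add: norm_h2.rep_eq)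

lemma Rep_h2_holomorphic: "Rep_h2 f holomorphic_on right_half_plane"
  using Rep_h2[of f] by (simp add: h2_functions_def)

lemma Rep_h2_outside: "w \<notin> right_half_plane \<Longrightarrow> Rep_h2 f w = 0"
  using Rep_h2[of f] by (simp add: h2_functions_def)

lemma h2_eqI: "(\<And>w. w \<in> right_half_plane \<Longrightarrow> Rep_h2 f w = Rep_h2 g w) \<Longrightarrow> f = g"
  by (metis Rep_h2_inject Rep_h2_outside ext)

lemma line_integral_le_norm: "x > 0 \<Longrightarrow> line_integral (Rep_h2 f) x \<le> ennreal ((norm f)\<^sup>2)"
  using line_integral_le[of x "Rep_h2 f"] by (simp add: h2_normsq_eq)

lemma norm_h2_leI:
  assumes "\<And>x. x > 0 \<Longrightarrow> line_integral (Rep_h2 f) x \<le> ennreal (B\<^sup>2)" "B \<ge> 0"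
  shows "norm f \<le> B"
proof -
  have "h2_normsq (Rep_h2 f) \<le> ennreal (B\<^sup>2)"
    unfolding h2_normsq_def using assms by (intro SUP_least) auto
  then show ?thesis using assms(2) by (simp add: h2_normsq_eq)
qed

text \<open>Bounded point evaluations make Cauchy sequences converge locally uniformly and later
  supply the functionals that separate points.\<close>

lemma Rep_h2_bound:
  assumes w: "w \<in> right_half_plane"
  shows "cmod (Rep_h2 f w) \<le> sqrt (8 / Re w) * norm f"
proof -
  have Rw: "Re w > 0" using w by (simp add: right_half_plane_def)
  have "ennreal ((cmod (Rep_h2 f w))\<^sup>2 * (Re w / 2)) = ennreal ((cmod (Rep_h2 f w))\<^sup>2) * ennreal (Re w / 2)"
    using Rw by (intro ennreal_mult) auto
  also have "\<dots> \<le> 4 * ennreal ((norm f)\<^sup>2)"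
    by (rule line_pointwise_bound[OF Rep_h2_holomorphic w line_integral_le_norm])
  also have "\<dots> = ennreal (4 * (norm f)\<^sup>2)"
    by (simp add: ennreal_mult')
  finally have "(cmod (Rep_h2 f w))\<^sup>2 * (Re w / 2) \<le> 4 * (norm f)\<^sup>2" by simp
  then have "(cmod (Rep_h2 f w))\<^sup>2 \<le> (8 / Re w) * (norm f)\<^sup>2"
    using Rw by (simp add: divide_simps mult_ac)
  also have "\<dots> = (sqrt (8 / Re w) * norm f)\<^sup>2"
    using Rw by (simp add: power_mult_distrib)
  finally show ?thesis
    by (rule power2_le_imp_le) (use Rw in auto)
qed

lemma Rep_h2_minus: "Rep_h2 (f - g) w = Rep_h2 f w - Rep_h2 g w"
  by (simp add: minus_h2_def uminus_h2_def plus_h2.rep_eq scaleC_h2.rep_eq)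

text \<open>Point evaluations give a locally uniform, hence holomorphic, limit \<open>g\<close>.
  Fatou's lemma on each vertical line bounds \<open>X n - g\<close> by a constant independent of the
  line, and so bounds the supremum over lines.\<close>

instance h2 :: banach
proof
  fix X :: "nat \<Rightarrow> h2" assume X: "Cauchy X"
  define g where "g w = lim (\<lambda>n. Rep_h2 (X n) w)" for w
  have unif: "uniform_limit (cball w (Re w / 2)) (\<lambda>n. Rep_h2 (X n)) g sequentially"
    if w: "w \<in> right_half_plane" for w
  proof -
    have Rw: "Re w > 0" using w by (simp add: right_half_plane_def)
    have "uniformly_Cauchy_on (cball w (Re w / 2)) (\<lambda>n. Rep_h2 (X n))"
    proof (rule uniformly_Cauchy_onI)
      fix e :: real assume e: "e > 0"
      define K where "K = sqrt (16 / Re w)"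
      have K: "K > 0" using Rw by (simp add: K_def)
      from e K have "e / K > 0" by simp
      then obtain N where N: "\<And>m n. m \<ge> N \<Longrightarrow> n \<ge> N \<Longrightarrow> norm (X m - X n) < e / K"
        using X by (metis CauchyD)
      have "dist (Rep_h2 (X m) z) (Rep_h2 (X n) z) < e"
        if z: "z \<in> cball w (Re w / 2)" and mn: "m \<ge> N" "n \<ge> N" for z m n
      proof -
        have "\<bar>Re (w - z)\<bar> \<le> Re w / 2"
          using z abs_Re_le_cmod[of "w - z"] by (simp add: dist_norm)
        then have Rz: "Re z \<ge> Re w / 2" using abs_ge_self[of "Re (w - z)"] by simp
        with Rw have z0: "Re z > 0" by linarith
        then have z': "z \<in> right_half_plane" by (simp add: right_half_plane_def)
        have "8 / Re z \<le> 8 / (Re w / 2)"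
          using Rz Rw z0 by (intro divide_left_mono) auto
        then have "8 / Re z \<le> 16 / Re w" by simp
        then have "sqrt (8 / Re z) \<le> K" unfolding K_def by (rule real_sqrt_le_mono)
        then have "cmod (Rep_h2 (X m - X n) z) \<le> K * norm (X m - X n)"
          using Rep_h2_bound[OF z', of "X m - X n"]
          by (meson mult_right_mono norm_ge_zero order_trans)
        also have "\<dots> < K * (e / K)" using N[OF mn] K by (intro mult_strict_left_mono)
        finally show ?thesis using K by (simp add: Rep_h2_minus dist_norm)
      qed
      then show "\<exists>M. \<forall>x\<in>cball w (Re w / 2). \<forall>m\<ge>M. \<forall>n\<ge>M. dist (Rep_h2 (X m) x) (Rep_h2 (X n) x) < e"
        by blast
    qed
    then show ?thesis
      unfolding g_def by (metis Cauchy_uniformly_convergent uniformly_convergent_uniform_limit_iff)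
  qed
  have lim: "(\<lambda>n. Rep_h2 (X n) w) \<longlonglongrightarrow> g w" if "w \<in> right_half_plane" for w
  proof -
    have "w \<in> cball w (Re w / 2)" using that by (simp add: right_half_plane_def)
    then show ?thesis using tendsto_uniform_limitI[OF unif[OF that]] by blast
  qed
  have g_hol: "g holomorphic_on right_half_plane"
  proof (rule holomorphic_uniform_sequence[OF open_rhp Rep_h2_holomorphic])
    fix w assume w: "w \<in> right_half_plane"
    then show "\<exists>d>0. cball w d \<subseteq> right_half_plane \<and> uniform_limit (cball w d) (\<lambda>n. Rep_h2 (X n)) g sequentially"
      using unif[OF w] rhp_cball[of "Re w / 2" w]
      by (intro exI[of _ "Re w / 2"]) (auto simp: right_half_plane_def)
  qed
  have g_out: "g w = 0" if "w \<notin> right_half_plane" for w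
    using that by (simp add: g_def Rep_h2_outside)
  have fatou: "line_integral (\<lambda>w. Rep_h2 (X n) w - g w) x \<le> ennreal (e\<^sup>2)"
    if x: "x > 0" and e: "\<And>m. m \<ge> N \<Longrightarrow> norm (X n - X m) \<le> e" for n N e x
  proof -
    have [measurable]: "(\<lambda>y. Rep_h2 f (Complex x y)) \<in> borel_measurable borel" for f
      using line_measurable[OF Rep_h2_holomorphic x] .
    have "line_integral (\<lambda>w. Rep_h2 (X n) w - g w) x
      = (\<integral>\<^sup>+y. liminf (\<lambda>m. ennreal ((cmod (Rep_h2 (X n - X m) (Complex x y)))\<^sup>2)) \<partial>lborel)"
      unfolding line_integral_def
    proof (intro nn_integral_cong)
      fix y
      have "(\<lambda>m. ennreal ((cmod (Rep_h2 (X n - X m) (Complex x y)))\<^sup>2))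
          \<longlonglongrightarrow> ennreal ((cmod (Rep_h2 (X n) (Complex x y) - g (Complex x y)))\<^sup>2)"
        unfolding Rep_h2_minus using x by (intro tendsto_intros tendsto_ennrealI lim) auto
      then show "ennreal ((cmod (Rep_h2 (X n) (Complex x y) - g (Complex x y)))\<^sup>2)
          = liminf (\<lambda>m. ennreal ((cmod (Rep_h2 (X n - X m) (Complex x y)))\<^sup>2))"
        by (metis lim_imp_Liminf trivial_limit_sequentially)
    qed
    also have "\<dots> \<le> liminf (\<lambda>m. \<integral>\<^sup>+y. ennreal ((cmod (Rep_h2 (X n - X m) (Complex x y)))\<^sup>2) \<partial>lborel)"
      by (rule nn_integral_liminf) measurable
    also have "\<dots> = liminf (\<lambda>m. line_integral (Rep_h2 (X n - X m)) x)"
      by (simp add: line_integral_def)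
    also have "\<dots> \<le> limsup (\<lambda>m. line_integral (Rep_h2 (X n - X m)) x)"
      by (rule Liminf_le_Limsup) simp
    also have "\<dots> \<le> ennreal (e\<^sup>2)"
    proof (rule Limsup_bounded)
      show "\<forall>\<^sub>F m in sequentially. line_integral (Rep_h2 (X n - X m)) x \<le> ennreal (e\<^sup>2)"
        using eventually_ge_at_top[of N]
      proof eventually_elim
        case (elim m)
        have "line_integral (Rep_h2 (X n - X m)) x \<le> ennreal ((norm (X n - X m))\<^sup>2)"
          by (rule line_integral_le_norm[OF x])
        also have "\<dots> \<le> ennreal (e\<^sup>2)"
          using e[OF elim] by (intro ennreal_leI power_mono) auto
        finally show ?case .
      qed
    qed
    finally show ?thesis .
  qed
  have diff: "(\<lambda>w. Rep_h2 (X n) w - g w) \<in> h2_functions"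
    if e: "\<And>m. m \<ge> N \<Longrightarrow> norm (X n - X m) \<le> e" for n N e
  proof -
    have "h2_normsq (\<lambda>w. Rep_h2 (X n) w - g w) \<le> ennreal (e\<^sup>2)"
      unfolding h2_normsq_def using fatou[OF _ e] by (intro SUP_least) auto
    also have "\<dots> < \<infinity>" by simp
    finally show ?thesis
      by (auto simp: h2_functions_def g_out Rep_h2_outside intro!: holomorphic_intros g_hol Rep_h2_holomorphic)
  qed
  obtain N0 where N0: "\<And>m n. m \<ge> N0 \<Longrightarrow> n \<ge> N0 \<Longrightarrow> norm (X m - X n) < 1"
    using X by (metis CauchyD zero_less_one)
  \<comment> \<open>Membership of \<open>g\<close> in the space is reached through
    \<open>X N0 - g\<close>, whose line integrals Fatou's lemma bounds by 1.\<close>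
  define D where "D = Abs_h2 (\<lambda>w. Rep_h2 (X N0) w - g w)"
  have RD: "Rep_h2 D = (\<lambda>w. Rep_h2 (X N0) w - g w)"
    unfolding D_def by (rule Abs_h2_inverse, rule diff[of N0 N0 1]) (use N0 in \<open>auto intro: less_imp_le\<close>)
  define L where "L = X N0 - D"
  have RL: "Rep_h2 L w = g w" for w
    by (simp add: L_def Rep_h2_minus RD)
  have "X \<longlonglongrightarrow> L"
  proof (rule LIMSEQ_I)
    fix r :: real assume r: "r > 0"
    then have "r / 2 > 0" by simp
    then obtain N where N: "\<And>m n. m \<ge> N \<Longrightarrow> n \<ge> N \<Longrightarrow> norm (X m - X n) < r / 2"
      using X by (metis CauchyD)
    have "norm (X n - L) < r" if n: "n \<ge> N" for n
    proof -
      have "norm (X n - L) \<le> r / 2"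
      proof (rule norm_h2_leI)
        fix x :: real assume x: "x > 0"
        have "Rep_h2 (X n - L) = (\<lambda>w. Rep_h2 (X n) w - g w)"
          by (auto simp: Rep_h2_minus RL)
        then show "line_integral (Rep_h2 (X n - L)) x \<le> ennreal ((r / 2)\<^sup>2)"
          using fatou[OF x, of N n "r / 2"] N n by (auto intro: less_imp_le)
      qed (use r in auto)
      then show ?thesis using r by simp
    qed
    then show "\<exists>no. \<forall>n\<ge>no. norm (X n - L) < r" by blast
  qed
  then show "convergent X" by (rule convergentI)
qed

section \<open>The inner product of the Hardy space\<close>

lemma nn_integral_cauchy_schwarz:
  fixes u v :: "real \<Rightarrow> complex"
  assumes [measurable]: "u \<in> borel_measurable borel" "v \<in> borel_measurable borel"
    and A: "(\<integral>\<^sup>+y. ennreal ((cmod (u y))\<^sup>2) \<partial>lborel) \<le> ennreal (A\<^sup>2)" "0 \<le> A"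
    and B: "(\<integral>\<^sup>+y. ennreal ((cmod (v y))\<^sup>2) \<partial>lborel) \<le> ennreal (B\<^sup>2)" "0 \<le> B"
  shows "(\<integral>\<^sup>+y. ennreal (cmod (u y * v y)) \<partial>lborel) \<le> ennreal (A * B)"
proof -
  have "(\<integral>\<^sup>+y. ennreal (cmod (u y)) * ennreal (cmod (v y)) \<partial>lborel)\<^sup>2
      \<le> (\<integral>\<^sup>+y. (ennreal (cmod (u y)))\<^sup>2 \<partial>lborel) * (\<integral>\<^sup>+y. (ennreal (cmod (v y)))\<^sup>2 \<partial>lborel)"
    by (rule Cauchy_Schwarz_nn_integral) auto
  also have "\<dots> \<le> ennreal (A\<^sup>2) * ennreal (B\<^sup>2)"
    using A(1) B(1) by (intro mult_mono) (simp_all add: ennreal_power)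
  also have "\<dots> = (ennreal (A * B))\<^sup>2"
    using A(2) B(2) by (simp add: ennreal_mult power_mult_distrib flip: ennreal_power)
  finally have "(\<integral>\<^sup>+y. ennreal (cmod (u y)) * ennreal (cmod (v y)) \<partial>lborel) \<le> ennreal (A * B)"
    using A(2) B(2) by (intro ennreal_le_if_power2_le) auto
  then show ?thesis by (simp add: norm_mult ennreal_mult)
qed

section \<open>Moving vertical lines of integration\<close>

lemma emeasure_lborel_atLeast: "emeasure lborel {a::real..} = \<infinity>"
proof (rule ccontr)
  assume "emeasure lborel {a..} \<noteq> \<infinity>"
  then obtain r where r: "emeasure lborel {a..} = ennreal r" "r \<ge> 0"
    by (cases "emeasure lborel {a..}") auto
  obtain n :: nat where n: "r < real n" using reals_Archimedean2[of r] by (elim exE)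
  have "ennreal (real n) = emeasure lborel {a..a + real n}" by simp
  also have "\<dots> \<le> emeasure lborel {a..}" by (intro emeasure_mono) auto
  finally have "real n \<le> r" using r by simp
  with n show False by simp
qed

text \<open>The horizontal sides of the rectangle are controlled on average over their height, so no
  decay of \<open>F\<close> at infinity is needed.\<close>

lemma line_integral_shift:
  fixes F :: "complex \<Rightarrow> complex"
  assumes F: "F holomorphic_on {z. \<alpha> < Re z \<and> Re z < \<beta>}" and x: "\<alpha> < x1" "x1 < x2" "x2 < \<beta>"
    and M: "\<And>x. x1 \<le> x \<Longrightarrow> x \<le> x2 \<Longrightarrow> (\<integral>\<^sup>+y. ennreal (cmod (F (Complex x y))) \<partial>lborel) \<le> ennreal M"
  shows "(LINT y|lborel. F (Complex x1 y)) = (LINT y|lborel. F (Complex x2 y))"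
proof (rule ccontr)
  let ?S = "{z. \<alpha> < Re z \<and> Re z < \<beta>}"
  assume neq: "\<not> ?thesis"
  have S: "open ?S" "convex ?S"
  proof -
    have eq: "?S = {z. Re z > \<alpha>} \<inter> {z. Re z < \<beta>}" by auto
    show "open ?S" unfolding eq by (intro open_Int open_halfspace_Re_gt open_halfspace_Re_lt)
    show "convex ?S" unfolding eq by (intro convex_Int convex_halfspace_Re_gt convex_halfspace_Re_lt)
  qed
  obtain P where P: "\<And>z. z \<in> ?S \<Longrightarrow> (P has_field_derivative F z) (at z within ?S)"
    using holomorphic_convex_primitive'[OF S(2,1) F] by blast
  have int_path: "(F has_contour_integral (P b - P a)) (linepath a b)" if "a \<in> ?S" "b \<in> ?S" for a b
  proof -
    have "closed_segment a b \<subseteq> ?S" using that S(2) by (rule closed_segment_subset)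
    then show ?thesis using contour_integral_primitive[OF P, of "linepath a b"] by simp
  qed
  have contF: "continuous_on ?S F" using F by (rule holomorphic_on_imp_continuous_on)
  have line_cont: "continuous_on UNIV (\<lambda>y. F (Complex x y))" if "\<alpha> < x" "x < \<beta>" for x
    by (rule continuous_on_compose2[OF contF, where f = "Complex x"])
      (use that in \<open>auto simp: complex_eq intro!: continuous_intros\<close>)
  have line_int: "integrable lborel (\<lambda>y. F (Complex x y))" if "x1 \<le> x" "x \<le> x2" for x
  proof (rule integrableI_bounded)
    show "(\<lambda>y. F (Complex x y)) \<in> borel_measurable lborel"
      using borel_measurable_continuous_onI[OF line_cont] that x by simp
    show "(\<integral>\<^sup>+y. ennreal (cmod (F (Complex x y))) \<partial>lborel) < \<infinity>"
      using M[OF that] by (rule le_less_trans) simp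
  qed
  have vert: "integral {-T..T} (\<lambda>y. F (Complex x y)) = - \<i> * (P (Complex x T) - P (Complex x (-T)))"
    if "\<alpha> < x" "x < \<beta>" "T > 0" for x T
  proof -
    have "((\<lambda>y. F (Complex x y)) has_integral - \<i> * (P (Complex x T) - P (Complex x (-T)))) {-T..T}"
      using int_path[of "Complex x (-T)" "Complex x T"] that
        has_contour_integral_linepath_same_Re_iff[of "Complex x (-T)" x "Complex x T" "-T" T F]
      by auto
    then show ?thesis by (rule integral_unique)
  qed
  have lim: "((\<lambda>T. integral {-T..T} (\<lambda>y. F (Complex x y))) \<longlongrightarrow> (LINT y|lborel. F (Complex x y))) at_top"
    if xx: "x1 \<le> x" "x \<le> x2" for x
  proof -
    have eq: "integral {-T..T} (\<lambda>y. F (Complex x y)) = (LINT y|lborel. indicat_real {-T..T} y *\<^sub>R F (Complex x y))" for T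
    proof -
      have "set_integrable lborel {-T..T} (\<lambda>y. F (Complex x y))"
        using line_int[OF xx] unfolding set_integrable_def by (intro integrable_mult_indicator) auto
      then show ?thesis
        using set_borel_integral_eq_integral(2)[of "{-T..T}" "\<lambda>y. F (Complex x y)"]
        by (simp add: set_lebesgue_integral_def)
    qed
    show ?thesis unfolding eq
    proof (rule integral_dominated_convergence_at_top[where w = "\<lambda>y. cmod (F (Complex x y))"])
      show "(\<lambda>y. F (Complex x y)) \<in> borel_measurable lborel"
        using line_int[OF xx] by (rule borel_measurable_integrable)
      then show "(\<lambda>y. indicat_real {-T..T} y *\<^sub>R F (Complex x y)) \<in> borel_measurable lborel" for T
        by measurable
      show "integrable lborel (\<lambda>y. cmod (F (Complex x y)))"
        using line_int[OF xx] by (rule integrable_norm)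
      show "\<forall>\<^sub>F T in at_top. AE y in lborel. cmod (indicat_real {-T..T} y *\<^sub>R F (Complex x y)) \<le> cmod (F (Complex x y))"
        by (intro always_eventually allI AE_I2) (auto split: split_indicator)
      show "AE y in lborel. ((\<lambda>T. indicat_real {-T..T} y *\<^sub>R F (Complex x y)) \<longlongrightarrow> F (Complex x y)) at_top"
      proof (rule AE_I2)
        fix y :: real
        have "\<forall>\<^sub>F T in at_top. indicat_real {-T..T} y *\<^sub>R F (Complex x y) = F (Complex x y)"
          using eventually_ge_at_top[of "\<bar>y\<bar>"]
        proof eventually_elim
          case (elim T)
          then have "y \<in> {-T..T}" by auto
          then show ?case by simp
        qed
        then show "((\<lambda>T. indicat_real {-T..T} y *\<^sub>R F (Complex x y)) \<longlongrightarrow> F (Complex x y)) at_top"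
          by (rule tendsto_eventually)
      qed
    qed
  qed
  \<comment> \<open>If the two line integrals differ by \<open>D\<close> in modulus, then at every
    large height \<open>T\<close> the two horizontal sides together carry at least
    \<open>D / 2\<close>.\<close>
  define D where "D = cmod ((LINT y|lborel. F (Complex x1 y)) - (LINT y|lborel. F (Complex x2 y)))"
  have D: "D > 0" using neq by (simp add: D_def)
  have "((\<lambda>T. cmod (integral {-T..T} (\<lambda>y. F (Complex x1 y)) - integral {-T..T} (\<lambda>y. F (Complex x2 y)))) \<longlongrightarrow> D) at_top"
    unfolding D_def using x by (intro tendsto_intros lim) auto
  then have "\<forall>\<^sub>F T in at_top. D / 2 < cmod (integral {-T..T} (\<lambda>y. F (Complex x1 y)) - integral {-T..T} (\<lambda>y. F (Complex x2 y)))"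
    using D by (intro order_tendstoD(1)) auto
  then obtain T0 where T0: "\<And>T. T \<ge> T0 \<Longrightarrow> D / 2 < cmod (integral {-T..T} (\<lambda>y. F (Complex x1 y)) - integral {-T..T} (\<lambda>y. F (Complex x2 y)))"
    unfolding eventually_at_top_linorder by blast
  \<comment> \<open>Clamping makes the integrand continuous on the whole plane, which gives the
    measurability for Fubini's theorem.\<close>
  define clamp :: "real \<Rightarrow> real" where "clamp t = max 0 (min 1 t)" for t
  define seg where "seg t = x1 + clamp t * (x2 - x1)" for t
  have seg: "x1 \<le> seg t" "seg t \<le> x2" for t
  proof -
    have "0 \<le> clamp t" "clamp t \<le> 1" by (auto simp: clamp_def)
    then have "0 * (x2 - x1) \<le> clamp t * (x2 - x1)" "clamp t * (x2 - x1) \<le> 1 * (x2 - x1)"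
      using x by (intro mult_right_mono; simp)+
    then show "x1 \<le> seg t" "seg t \<le> x2" by (simp_all add: seg_def)
  qed
  \<comment> \<open>\<open>h T\<close> is the mean of \<open>cmod F\<close> over the horizontal side
    at height \<open>T\<close>; the hypothesis on vertical lines bounds its integral over all
    heights.\<close>
  define h where "h T = (\<integral>\<^sup>+t\<in>{0..1}. ennreal (cmod (F (Complex (seg t) T))) \<partial>lborel)" for T
  have "continuous_on UNIV (\<lambda>p. F (Complex (seg (snd p)) (fst p)))"
  proof (rule continuous_on_compose2[OF contF, where f = "\<lambda>p. Complex (seg (snd p)) (fst p)"])
    show "continuous_on UNIV (\<lambda>p. Complex (seg (snd p)) (fst p))"
      unfolding complex_eq seg_def clamp_def by (intro continuous_intros)
    show "range (\<lambda>p. Complex (seg (snd p)) (fst p)) \<subseteq> ?S"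
    proof safe
      fix y t
      show "\<alpha> < Re (Complex (seg (snd (y, t))) (fst (y, t)))" "Re (Complex (seg (snd (y, t))) (fst (y, t))) < \<beta>"
        using seg[of t] x by auto
    qed
  qed
  then have "(\<lambda>p. F (Complex (seg (snd p)) (fst p))) \<in> borel_measurable borel"
    by (rule borel_measurable_continuous_onI)
  then have m [measurable]: "(\<lambda>p. F (Complex (seg (snd p)) (fst p))) \<in> borel_measurable (borel \<Otimes>\<^sub>M borel)"
    by (simp add: borel_prod)
  have [measurable]: "(\<lambda>p. F (Complex (seg (fst p)) (snd p))) \<in> borel_measurable (borel \<Otimes>\<^sub>M borel)"
    using measurable_compose[OF measurable_Pair[OF measurable_snd measurable_fst] m] by simp
  have [measurable]: "h \<in> borel_measurable borel" unfolding h_def by measurable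
  have hM: "(\<integral>\<^sup>+T. h T \<partial>lborel) \<le> ennreal M"
  proof -
    have "(\<integral>\<^sup>+T. h T \<partial>lborel)
        = (\<integral>\<^sup>+t. (\<integral>\<^sup>+T. ennreal (cmod (F (Complex (seg t) T))) * indicator {0..1} t \<partial>lborel) \<partial>lborel)"
      unfolding h_def by (rule lborel_pair.Fubini') measurable
    also have "\<dots> \<le> (\<integral>\<^sup>+t. ennreal M * indicator {0..1} t \<partial>(lborel :: real measure))"
    proof (rule nn_integral_mono)
      fix t :: real
      show "(\<integral>\<^sup>+T. ennreal (cmod (F (Complex (seg t) T))) * indicator {0..1} t \<partial>lborel)
          \<le> ennreal M * indicator {0..1} t"
        using M[OF seg, of t] by (auto split: split_indicator)
    qed
    also have "\<dots> = ennreal M" by (simp add: nn_integral_cmult_indicator)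
    finally show ?thesis .
  qed
  have horiz: "ennreal (cmod (P (Complex x2 T) - P (Complex x1 T))) \<le> ennreal (x2 - x1) * h T" for T
  proof -
    have lp: "linepath (Complex x1 T) (Complex x2 T) t = Complex (seg t) T" if "t \<in> {0..1}" for t
      using that by (simp add: linepath_def seg_def clamp_def complex_eq_iff algebra_simps)
    have cs: "continuous_on {0..1} (\<lambda>t. F (Complex (seg t) T))"
    proof (rule continuous_on_compose2[OF contF, where f = "\<lambda>t. Complex (seg t) T"])
      show "continuous_on {0..1} (\<lambda>t. Complex (seg t) T)"
        unfolding complex_eq seg_def clamp_def by (intro continuous_intros)
      have "\<alpha> < seg t" "seg t < \<beta>" for t using seg[of t] x by auto
      then show "(\<lambda>t. Complex (seg t) T) ` {0..1} \<subseteq> ?S" by auto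
    qed
    have "((\<lambda>t. F (linepath (Complex x1 T) (Complex x2 T) t) * (Complex x2 T - Complex x1 T))
        has_integral P (Complex x2 T) - P (Complex x1 T)) {0..1}"
      using int_path[of "Complex x1 T" "Complex x2 T"] x
      unfolding has_contour_integral_linepath by simp
    then have hi: "((\<lambda>t. F (Complex (seg t) T) * (Complex x2 T - Complex x1 T))
        has_integral P (Complex x2 T) - P (Complex x1 T)) {0..1}"
      by (rule has_integral_eq[rotated]) (simp add: lp)
    have "cmod (integral {0..1} (\<lambda>t. F (Complex (seg t) T) * (Complex x2 T - Complex x1 T)))
        \<le> integral {0..1} (\<lambda>t. (x2 - x1) * cmod (F (Complex (seg t) T)))"
    proof (rule integral_norm_bound_integral)
      show "(\<lambda>t. F (Complex (seg t) T) * (Complex x2 T - Complex x1 T)) integrable_on {0..1}"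
        using hi by blast
      show "(\<lambda>t. (x2 - x1) * cmod (F (Complex (seg t) T))) integrable_on {0..1}"
        by (intro integrable_continuous_interval continuous_intros cs)
      have "cmod (Complex x2 T - Complex x1 T) = x2 - x1"
        using x by (simp add: cmod_def)
      then show "cmod (F (Complex (seg t) T) * (Complex x2 T - Complex x1 T)) \<le> (x2 - x1) * cmod (F (Complex (seg t) T))" for t
        by (simp add: norm_mult)
    qed
    then have "ennreal (cmod (P (Complex x2 T) - P (Complex x1 T)))
        \<le> ennreal ((x2 - x1) * integral {0..1} (\<lambda>t. cmod (F (Complex (seg t) T))))"
      using integral_unique[OF hi] by (intro ennreal_leI) simp
    also have "\<dots> = ennreal (x2 - x1) * ennreal (integral {0..1} (\<lambda>t. cmod (F (Complex (seg t) T))))"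
      using x by (simp add: ennreal_mult')
    also have "ennreal (integral {0..1} (\<lambda>t. cmod (F (Complex (seg t) T)))) = h T"
      unfolding h_def by (intro nn_integral_continuous_on_Icc[symmetric] continuous_intros cs) auto
    finally show ?thesis .
  qed
  define T1 where "T1 = max T0 1"
  have low: "ennreal (D / 2) \<le> ennreal (x2 - x1) * (h T + h (- T))" if T: "T \<ge> T1" for T
  proof -
    have T': "T \<ge> T0" "T > 0" using T by (auto simp: T1_def)
    have "integral {-T..T} (\<lambda>y. F (Complex x1 y)) - integral {-T..T} (\<lambda>y. F (Complex x2 y))
        = \<i> * ((P (Complex x2 T) - P (Complex x1 T)) - (P (Complex x2 (-T)) - P (Complex x1 (-T))))"
    proof -
      have "\<alpha> < x1" "x1 < \<beta>" "\<alpha> < x2" "x2 < \<beta>" using x by auto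
      then show ?thesis by (simp only: vert T') (simp add: algebra_simps)
    qed
    then have "cmod (integral {-T..T} (\<lambda>y. F (Complex x1 y)) - integral {-T..T} (\<lambda>y. F (Complex x2 y)))
        = cmod ((P (Complex x2 T) - P (Complex x1 T)) - (P (Complex x2 (-T)) - P (Complex x1 (-T))))"
      by (simp add: norm_mult)
    also have "\<dots> \<le> cmod (P (Complex x2 T) - P (Complex x1 T)) + cmod (P (Complex x2 (-T)) - P (Complex x1 (-T)))"
      by (rule norm_triangle_ineq4)
    finally have "D / 2 \<le> cmod (P (Complex x2 T) - P (Complex x1 T)) + cmod (P (Complex x2 (-T)) - P (Complex x1 (-T)))"
      using T0[OF T'(1)] by linarith
    then have "ennreal (D / 2) \<le> ennreal (cmod (P (Complex x2 T) - P (Complex x1 T)) + cmod (P (Complex x2 (-T)) - P (Complex x1 (-T))))"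
      by (rule ennreal_leI)
    also have "\<dots> = ennreal (cmod (P (Complex x2 T) - P (Complex x1 T))) + ennreal (cmod (P (Complex x2 (-T)) - P (Complex x1 (-T))))"
      by (simp add: ennreal_plus)
    also have "\<dots> \<le> ennreal (x2 - x1) * h T + ennreal (x2 - x1) * h (- T)"
      by (intro add_mono horiz)
    finally show ?thesis by (simp add: distrib_left)
  qed
  \<comment> \<open>A positive constant on a half-line of infinite measure would be dominated by an
    integrable function.\<close>
  have "ennreal (D / 2) * emeasure lborel {T1..} = (\<integral>\<^sup>+T. ennreal (D / 2) * indicator {T1..} T \<partial>lborel)"
    by (simp add: nn_integral_cmult_indicator)
  also have "\<dots> \<le> (\<integral>\<^sup>+T. ennreal (x2 - x1) * (h T + h (- T)) \<partial>lborel)"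
    using low by (intro nn_integral_mono) (auto split: split_indicator)
  also have "\<dots> = ennreal (x2 - x1) * ((\<integral>\<^sup>+T. h T \<partial>lborel) + (\<integral>\<^sup>+T. h (- T) \<partial>lborel))"
    by (simp add: nn_integral_cmult nn_integral_add)
  also have "(\<integral>\<^sup>+T. h (- T) \<partial>lborel) = (\<integral>\<^sup>+T. h T \<partial>lborel)"
    using nn_integral_real_affine[of h "-1" 0] by simp
  also have "ennreal (x2 - x1) * ((\<integral>\<^sup>+T. h T \<partial>lborel) + (\<integral>\<^sup>+T. h T \<partial>lborel))
      \<le> ennreal (x2 - x1) * (ennreal M + ennreal M)"
    by (intro mult_left_mono add_mono hM) auto
  also have "\<dots> < \<infinity>" by (simp add: ennreal_mult_less_top)
  finally have "ennreal (D / 2) * emeasure lborel {T1..} < \<infinity>" .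
  moreover have "emeasure lborel {T1..} = \<infinity>" by (rule emeasure_lborel_atLeast)
  ultimately show False using D by (simp add: ennreal_mult_top)
qed

section \<open>Norms and inner products on vertical lines\<close>

lemma Rep_h2_line_measurable: "x > 0 \<Longrightarrow> (\<lambda>y. Rep_h2 f (Complex x y)) \<in> borel_measurable borel"
  by (rule line_measurable[OF Rep_h2_holomorphic])

lemma Rep_h2_plus: "Rep_h2 (f + g) w = Rep_h2 f w + Rep_h2 g w"
  by (simp add: plus_h2.rep_eq)

lemma Rep_h2_scaleC: "Rep_h2 (c *\<^sub>C f) w = c * Rep_h2 f w"
  by (simp add: scaleC_h2.rep_eq)

definition line_normsq :: "h2 \<Rightarrow> real \<Rightarrow> real" where
  "line_normsq f x = enn2real (line_integral (Rep_h2 f) x)"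

definition line_ip :: "real \<Rightarrow> h2 \<Rightarrow> h2 \<Rightarrow> complex" where
  "line_ip x f g = (LINT y|lborel. Rep_h2 f (Complex x y) * cnj (Rep_h2 g (Complex x y)))"

lemma line_normsq_nonneg [simp]: "0 \<le> line_normsq f x"
  by (simp add: line_normsq_def)

lemma ennreal_line_normsq: "x > 0 \<Longrightarrow> ennreal (line_normsq f x) = line_integral (Rep_h2 f) x"
  unfolding line_normsq_def using h2_functions_line_finite[OF Rep_h2, of x f] by simp

lemma line_normsq_le: "x > 0 \<Longrightarrow> line_normsq f x \<le> (norm f)\<^sup>2"
  using line_integral_le_norm[of x f] by (simp flip: ennreal_line_normsq)

lemma line_ip_integrable:
  assumes x: "x > 0"
  shows "integrable lborel (\<lambda>y. Rep_h2 f (Complex x y) * cnj (Rep_h2 g (Complex x y)))"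
proof (rule integrableI_bounded)
  note [measurable] = Rep_h2_line_measurable[OF x]
  have [measurable]: "cnj \<in> borel_measurable borel"
    by (intro borel_measurable_continuous_onI continuous_intros)
  show "(\<lambda>y. Rep_h2 f (Complex x y) * cnj (Rep_h2 g (Complex x y))) \<in> borel_measurable lborel"
    by measurable
  have "(\<integral>\<^sup>+y. ennreal (cmod (Rep_h2 f (Complex x y) * cnj (Rep_h2 g (Complex x y)))) \<partial>lborel)
      \<le> ennreal (norm f * norm g)"
    using line_integral_le_norm[OF x] unfolding line_integral_def
    by (intro nn_integral_cauchy_schwarz) auto
  also have "\<dots> < \<infinity>" by simp
  finally show "(\<integral>\<^sup>+y. ennreal (cmod (Rep_h2 f (Complex x y) * cnj (Rep_h2 g (Complex x y)))) \<partial>lborel) < \<infinity>" .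
qed

lemma line_ip_add_left: "x > 0 \<Longrightarrow> line_ip x (f + g) h = line_ip x f h + line_ip x g h"
  unfolding line_ip_def Rep_h2_plus distrib_right
  by (rule Bochner_Integration.integral_add) (rule line_ip_integrable; assumption)+

lemma line_ip_scale_left: "x > 0 \<Longrightarrow> line_ip x (c *\<^sub>C f) g = c * line_ip x f g"
  unfolding line_ip_def Rep_h2_scaleC mult.assoc by (simp add: line_ip_integrable)

lemma line_ip_commute: "line_ip x g f = cnj (line_ip x f g)"
proof -
  have "cnj (line_ip x f g) = (LINT y|lborel. cnj (Rep_h2 f (Complex x y) * cnj (Rep_h2 g (Complex x y))))"
    unfolding line_ip_def by (rule Bochner_Integration.integral_cnj[symmetric])
  then show ?thesis by (simp add: line_ip_def mult.commute)
qed

lemma line_ip_self: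
  assumes x: "x > 0"
  shows "line_ip x f f = complex_of_real (line_normsq f x)"
proof -
  note [measurable] = Rep_h2_line_measurable[OF x]
  have "line_ip x f f = (LINT y|lborel. complex_of_real ((cmod (Rep_h2 f (Complex x y)))\<^sup>2))"
    unfolding line_ip_def by (simp add: complex_norm_square del: of_real_power)
  also have "\<dots> = complex_of_real (LINT y|lborel. (cmod (Rep_h2 f (Complex x y)))\<^sup>2)"
    by (rule integral_complex_of_real)
  also have "(LINT y|lborel. (cmod (Rep_h2 f (Complex x y)))\<^sup>2) = line_normsq f x"
    unfolding line_normsq_def line_integral_def by (intro integral_eq_nn_integral) auto
  finally show ?thesis .
qed

text \<open>Through norms alone, the limit of \<open>line_ip\<close> at the boundary follows from
  that of \<open>line_normsq\<close>.\<close>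

lemma line_polarization:
  assumes x: "x > 0"
  shows "line_ip x f g = (complex_of_real (line_normsq (f + g) x) - complex_of_real (line_normsq (f + (-1) *\<^sub>C g) x)
    + \<i> * complex_of_real (line_normsq (f + \<i> *\<^sub>C g) x)
    - \<i> * complex_of_real (line_normsq (f + (-\<i>) *\<^sub>C g) x)) / 4"
proof -
  have e: "complex_of_real (line_normsq (f + c *\<^sub>C g) x)
      = line_ip x f f + c * line_ip x g f + cnj c * line_ip x f g + c * cnj c * line_ip x g g" for c
  proof -
    have r: "line_ip x h (f + c *\<^sub>C g) = line_ip x h f + cnj c * line_ip x h g" for h
      using x line_ip_commute[of x h "f + c *\<^sub>C g"] line_ip_commute[of x h f] line_ip_commute[of x h g]
      by (simp add: line_ip_add_left line_ip_scale_left)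
    show ?thesis
      using x by (simp add: line_ip_self[symmetric] line_ip_add_left line_ip_scale_left r algebra_simps)
  qed
  show ?thesis
    using e[of 1] by (simp add: e algebra_simps)
qed

text \<open>\<open>w \<mapsto> s - cnj w\<close> reflects in the line \<open>Re w = s / 2\<close>;
  conjugating the value as well makes two antiholomorphic maps cancel.\<close>

lemma rhp_reflect_holomorphic:
  assumes "f holomorphic_on right_half_plane"
  shows "(\<lambda>w. cnj (f (complex_of_real s - cnj w))) holomorphic_on {w. Re w < s}"
proof -
  have "cnj ` right_half_plane = right_half_plane"
  proof safe
    fix z assume "z \<in> right_half_plane"
    then show "z \<in> cnj ` right_half_plane"
      by (intro image_eqI[of _ _ "cnj z"]) (auto simp: right_half_plane_def)
  qed (simp add: right_half_plane_def)
  then have "(cnj \<circ> f \<circ> cnj) holomorphic_on right_half_plane"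
    using assms open_rhp by (intro holomorphic_on_compose_cnj_cnj) auto
  then have "((cnj \<circ> f \<circ> cnj) \<circ> (\<lambda>w. complex_of_real s - w)) holomorphic_on {w. Re w < s}"
    by (rule holomorphic_on_compose_gen[rotated]) (auto simp: right_half_plane_def intro!: holomorphic_intros)
  then show ?thesis by (simp add: o_def)
qed

text \<open>The integral of \<open>f w * cnj (f (2 * x - cnj w))\<close> over a vertical line does not depend on the
  line; over the line through \<open>x\<close> it is the squared norm of \<open>f\<close> on that line.\<close>

lemma line_normsq_log_convex:
  assumes p: "0 < p" "p < x"
  shows "(line_normsq f x)\<^sup>2 \<le> line_normsq f p * line_normsq f (2 * x - p)"
proof -
  define F where "F w = Rep_h2 f w * cnj (Rep_h2 f (complex_of_real (2 * x) - cnj w))" for w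
  have Fline: "F (Complex t y) = Rep_h2 f (Complex t y) * cnj (Rep_h2 f (Complex (2 * x - t) y))" for t y
  proof -
    have "complex_of_real (2 * x) - cnj (Complex t y) = Complex (2 * x - t) y"
      by (simp add: complex_eq_iff)
    then show ?thesis by (simp only: F_def)
  qed
  have hol: "F holomorphic_on {z. 0 < Re z \<and> Re z < 2 * x}"
    unfolding F_def
    by (intro holomorphic_on_mult holomorphic_on_subset[OF Rep_h2_holomorphic]
        holomorphic_on_subset[OF rhp_reflect_holomorphic[OF Rep_h2_holomorphic]])
      (auto simp: right_half_plane_def)
  have [measurable]: "cnj \<in> borel_measurable borel"
    by (intro borel_measurable_continuous_onI continuous_intros)
  have bd: "(\<integral>\<^sup>+y. ennreal (cmod (F (Complex t y))) \<partial>lborel)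
      \<le> ennreal (sqrt (line_normsq f t) * sqrt (line_normsq f (2 * x - t)))" if t: "0 < t" "t < 2 * x" for t
  proof -
    have t': "0 < 2 * x - t" using t by simp
    note [measurable] = Rep_h2_line_measurable[OF t(1)] Rep_h2_line_measurable[OF t']
    show ?thesis unfolding Fline
      by (rule nn_integral_cauchy_schwarz)
        (use ennreal_line_normsq[OF t(1), of f] ennreal_line_normsq[OF t', of f] in \<open>auto simp: line_integral_def\<close>)
  qed
  have "(LINT y|lborel. F (Complex p y)) = (LINT y|lborel. F (Complex x y))"
  proof (rule line_integral_shift[OF hol, where M = "norm f * norm f"])
    fix t assume t: "p \<le> t" "t \<le> x"
    have "sqrt (line_normsq f t) * sqrt (line_normsq f (2 * x - t)) \<le> norm f * norm f"
      using line_normsq_le[of t f] line_normsq_le[of "2 * x - t" f] t p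
      by (intro mult_mono real_le_lsqrt) auto
    then show "(\<integral>\<^sup>+y. ennreal (cmod (F (Complex t y))) \<partial>lborel) \<le> ennreal (norm f * norm f)"
      using t p by (intro order_trans[OF bd ennreal_leI]) auto
  qed (use p in auto)
  also have "(LINT y|lborel. F (Complex x y)) = complex_of_real (line_normsq f x)"
    using p by (simp add: Fline flip: line_ip_self line_ip_def)
  finally have "line_normsq f x = cmod (LINT y|lborel. F (Complex p y))"
    by simp
  also have "\<dots> \<le> sqrt (line_normsq f p) * sqrt (line_normsq f (2 * x - p))"
  proof -
    have p': "0 < 2 * x - p" using p by simp
    note [measurable] = Rep_h2_line_measurable[OF p(1)] Rep_h2_line_measurable[OF p']
    have "(\<integral>\<^sup>+y. ennreal (cmod (F (Complex p y))) \<partial>lborel) < \<infinity>"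
      using p by (intro le_less_trans[OF bd]) auto
    then have integ: "integrable lborel (\<lambda>y. F (Complex p y))"
      by (intro integrableI_bounded) (simp_all add: Fline)
    have "ennreal (cmod (LINT y|lborel. F (Complex p y))) \<le> (\<integral>\<^sup>+y. ennreal (cmod (F (Complex p y))) \<partial>lborel)"
      by (rule integral_norm_bound_ennreal[OF integ])
    also have "\<dots> \<le> ennreal (sqrt (line_normsq f p) * sqrt (line_normsq f (2 * x - p)))"
      using p by (intro bd) auto
    finally show ?thesis by (simp add: ennreal_le_iff)
  qed
  finally have "(line_normsq f x)\<^sup>2 \<le> (sqrt (line_normsq f p) * sqrt (line_normsq f (2 * x - p)))\<^sup>2"
    by (intro power_mono) auto
  then show ?thesis by (simp add: power_mult_distrib)
qed

text \<open>A bounded midpoint log-convex function on a half-line cannot increase: with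
  \<open>S\<close> the supremum to the right of \<open>p\<close>, the inequality gives
  \<open>S\<^sup>2 \<le> line_normsq f p * S\<close>.\<close>

lemma line_normsq_antimono:
  assumes p: "0 < p" "p \<le> x"
  shows "line_normsq f x \<le> line_normsq f p"
proof -
  define S where "S = (SUP t\<in>{p..}. line_normsq f t)"
  have bdd: "bdd_above (line_normsq f ` {p..})"
    by (rule bdd_aboveI2[of _ _ "(norm f)\<^sup>2"]) (use p line_normsq_le in auto)
  have le_S: "line_normsq f t \<le> S" if "t \<ge> p" for t
    unfolding S_def using that by (intro cSUP_upper bdd) auto
  have S0: "0 \<le> S" using le_S[of p] line_normsq_nonneg[of f p] by linarith
  have sq: "(line_normsq f t)\<^sup>2 \<le> line_normsq f p * S" if t: "t \<ge> p" for t
  proof (cases "t = p")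
    case True
    then show ?thesis using le_S[of p] by (simp add: power2_eq_square mult_left_mono)
  next
    case False
    with t p have "(line_normsq f t)\<^sup>2 \<le> line_normsq f p * line_normsq f (2 * t - p)"
      by (intro line_normsq_log_convex) auto
    also have "\<dots> \<le> line_normsq f p * S" using t by (intro mult_left_mono le_S) auto
    finally show ?thesis .
  qed
  have "S \<le> sqrt (line_normsq f p * S)"
    unfolding S_def by (rule cSUP_least) (use sq in \<open>auto simp: S_def intro: real_le_rsqrt\<close>)
  then have "S\<^sup>2 \<le> (sqrt (line_normsq f p * S))\<^sup>2" using S0 by (rule power_mono)
  then have "S * S \<le> line_normsq f p * S" using S0 by (simp add: power2_eq_square)
  then have "S \<le> line_normsq f p"
    using S0 line_normsq_nonneg[of f p] by (cases "S = 0") (auto simp: mult_le_cancel_right)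
  with le_S[OF p(2)] show ?thesis by linarith
qed

text \<open>Monotonicity turns the supremum in the norm into a limit at the boundary, and limits,
  unlike suprema, respect the sums in polarization.\<close>

lemma line_normsq_tendsto: "(line_normsq f \<longlongrightarrow> (norm f)\<^sup>2) (at_right 0)"
proof (rule order_tendstoI)
  fix t assume t: "t < (norm f)\<^sup>2"
  have "\<exists>x0>0. t < line_normsq f x0"
  proof (cases "t < 0")
    case True
    then show ?thesis using line_normsq_nonneg[of f 1] by (intro exI[of _ 1]) linarith
  next
    case False
    then have "ennreal t < h2_normsq (Rep_h2 f)"
      using t by (simp add: h2_normsq_eq ennreal_less_iff)
    then obtain x0 where x0: "x0 > 0" "ennreal t < line_integral (Rep_h2 f) x0"
      unfolding h2_normsq_def less_SUP_iff by auto
    then have "t < line_normsq f x0"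
      using False by (simp flip: ennreal_line_normsq add: ennreal_less_iff)
    with x0 show ?thesis by blast
  qed
  then obtain x0 where x0: "x0 > 0" "t < line_normsq f x0" by blast
  show "\<forall>\<^sub>F x in at_right 0. t < line_normsq f x"
    unfolding eventually_at_right_field
    using x0 line_normsq_antimono by (intro exI[of _ x0]) (auto intro: less_le_trans less_imp_le)
next
  fix t assume t: "(norm f)\<^sup>2 < t"
  show "\<forall>\<^sub>F x in at_right 0. line_normsq f x < t"
    unfolding eventually_at_right_field
    using t line_normsq_le[of _ f] by (intro exI[of _ 1]) (auto intro: le_less_trans)
qed

text \<open>Polarization of the norm. Its additivity and homogeneity are inherited from
  \<open>line_ip\<close>, whose boundary limit it is.\<close>

definition h2_ip :: "h2 \<Rightarrow> h2 \<Rightarrow> complex" where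
  "h2_ip f g = (complex_of_real ((norm (f + g))\<^sup>2) - complex_of_real ((norm (f + (-1) *\<^sub>C g))\<^sup>2)
    + \<i> * complex_of_real ((norm (f + \<i> *\<^sub>C g))\<^sup>2) - \<i> * complex_of_real ((norm (f + (-\<i>) *\<^sub>C g))\<^sup>2)) / 4"

lemma eventually_at_right_0: "(\<And>x::real. x > 0 \<Longrightarrow> P x) \<Longrightarrow> eventually P (at_right 0)"
  unfolding eventually_at_right_field by (intro exI[of _ 1]) auto

lemma line_ip_tendsto: "((\<lambda>x. line_ip x f g) \<longlongrightarrow> h2_ip f g) (at_right 0)"
proof (rule Lim_transform_eventually)
  show "((\<lambda>x. (complex_of_real (line_normsq (f + g) x) - complex_of_real (line_normsq (f + (-1) *\<^sub>C g) x)
    + \<i> * complex_of_real (line_normsq (f + \<i> *\<^sub>C g) x)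
    - \<i> * complex_of_real (line_normsq (f + (-\<i>) *\<^sub>C g) x)) / 4) \<longlongrightarrow> h2_ip f g) (at_right 0)"
    unfolding h2_ip_def by (intro tendsto_intros line_normsq_tendsto) auto
qed (intro eventually_at_right_0 line_polarization[symmetric])

interpretation h2: complex_hilbert h2_ip
proof
  fix f g h :: h2 and c :: complex
  show "h2_ip (f + g) h = h2_ip f h + h2_ip g h"
  proof (rule tendsto_unique)
    show "((\<lambda>x. line_ip x (f + g) h) \<longlongrightarrow> h2_ip (f + g) h) (at_right 0)" by (rule line_ip_tendsto)
    show "((\<lambda>x. line_ip x (f + g) h) \<longlongrightarrow> h2_ip f h + h2_ip g h) (at_right 0)"
      by (rule Lim_transform_eventually[OF tendsto_add[OF line_ip_tendsto line_ip_tendsto]],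
          rule eventually_at_right_0) (simp add: line_ip_add_left)
  qed simp
  show "h2_ip (c *\<^sub>C f) g = c * h2_ip f g"
  proof (rule tendsto_unique)
    show "((\<lambda>x. line_ip x (c *\<^sub>C f) g) \<longlongrightarrow> h2_ip (c *\<^sub>C f) g) (at_right 0)" by (rule line_ip_tendsto)
    show "((\<lambda>x. line_ip x (c *\<^sub>C f) g) \<longlongrightarrow> c * h2_ip f g) (at_right 0)"
      by (rule Lim_transform_eventually[OF tendsto_mult_left[OF line_ip_tendsto]],
          rule eventually_at_right_0) (simp add: line_ip_scale_left)
  qed simp
  show "h2_ip g f = cnj (h2_ip f g)"
  proof (rule tendsto_unique)
    show "((\<lambda>x. line_ip x g f) \<longlongrightarrow> h2_ip g f) (at_right 0)" by (rule line_ip_tendsto)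
    show "((\<lambda>x. line_ip x g f) \<longlongrightarrow> cnj (h2_ip f g)) (at_right 0)"
      unfolding line_ip_commute[of _ g f] by (intro tendsto_cnj line_ip_tendsto)
  qed simp
  show "h2_ip f f = complex_of_real ((norm f)\<^sup>2)"
  proof (rule tendsto_unique)
    show "((\<lambda>x. line_ip x f f) \<longlongrightarrow> h2_ip f f) (at_right 0)" by (rule line_ip_tendsto)
    show "((\<lambda>x. line_ip x f f) \<longlongrightarrow> complex_of_real ((norm f)\<^sup>2)) (at_right 0)"
      by (rule Lim_transform_eventually[OF tendsto_of_real[OF line_normsq_tendsto]],
          rule eventually_at_right_0) (simp add: line_ip_self)
  qed simp
qed

section \<open>A right inverse for expanding maps\<close>

text \<open>A difference by \<open>c\<close> gains a factor of order \<open>cmod c / x\<close> in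
  mean square on the line at \<open>x\<close>, because the two Cauchy kernels differ by order
  \<open>cmod c / r\<^sup>2\<close> on a circle of radius \<open>r = x / 2\<close>.\<close>

lemma line_integral_difference:
  assumes f: "f holomorphic_on right_half_plane" and x: "0 < x" and c: "cmod c \<le> x / 4"
    and M: "\<And>x'. \<bar>x' - x\<bar> \<le> x / 2 \<Longrightarrow> line_integral f x' \<le> M"
  shows "line_integral (\<lambda>w. f w - f (w + c)) x \<le> ennreal ((4 * cmod c / x)\<^sup>2) * M"
proof -
  define r where "r = x / 2"
  have r: "0 < r" "r < x" using x by (auto simp: r_def)
  define J where "J y = (\<integral>\<^sup>+t\<in>{0..1}. ennreal ((cmod (f (circlepath (Complex x y) r t)))\<^sup>2) \<partial>lborel)" for y
  have J [measurable]: "J \<in> borel_measurable borel"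
    unfolding J_def by (rule circle_average_measurable[OF f r])
  have 1: "ennreal ((cmod (f (Complex x y) - f (Complex x y + c)))\<^sup>2) \<le> ennreal ((4 * cmod c / x)\<^sup>2) * J y" for y
  proof -
    define v where "v = Complex x y"
    have sub: "cball v r \<subseteq> right_half_plane" using r by (intro rhp_cball) (simp add: v_def)
    have hol: "f holomorphic_on cball v r" using f sub by (rule holomorphic_on_subset)
    have lt: "cmod (v - v) < r" "cmod (v + c - v) < r" using r c x by (auto simp: r_def)
    have "((\<lambda>u. f u / (u - v) - f u / (u - (v + c))) has_contour_integral
        2 * complex_of_real pi * \<i> * f v - 2 * complex_of_real pi * \<i> * f (v + c)) (circlepath v r)"
      by (intro has_contour_integral_diff Cauchy_integral_circlepath_simple[OF hol] lt)
    then have ci: "((\<lambda>u. f u * (1 / (u - v) - 1 / (u - (v + c)))) has_contour_integral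
        2 * complex_of_real pi * \<i> * (f v - f (v + c))) (circlepath v r)"
      by (simp only: right_diff_distrib times_divide_eq_right mult_1_right)
    \<comment> \<open>\<open>cmod c \<le> r / 2\<close> keeps \<open>z\<close> at distance at least
      \<open>r / 2 = x / 4\<close> from \<open>v + c\<close>, whence the factor
      \<open>4 / x\<close>.\<close>
    have k: "r * cmod (1 / (z - v) - 1 / (z - (v + c))) \<le> 4 * cmod c / x" if z: "z \<in> sphere v r" for z
    proof -
      have zv: "cmod (z - v) = r" using z by (metis dist_commute dist_norm mem_sphere)
      have "cmod (z - v) \<le> cmod (z - (v + c)) + cmod c"
        using norm_triangle_ineq[of "z - (v + c)" c] by simp
      then have zc: "r / 2 \<le> cmod (z - (v + c))" using zv c by (simp add: r_def)
      have nz: "z - v \<noteq> 0" "z - (v + c) \<noteq> 0" using zv zc r(1) by auto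
      have "1 / (z - v) - 1 / (z - (v + c)) = - c / ((z - v) * (z - (v + c)))"
        using nz by (simp add: diff_frac_eq)
      then have "r * cmod (1 / (z - v) - 1 / (z - (v + c))) = r * (cmod c / (r * cmod (z - (v + c))))"
        using zv by (simp add: norm_divide norm_mult)
      also have "\<dots> = cmod c / cmod (z - (v + c))" using r(1) by simp
      also have "\<dots> \<le> cmod c / (r / 2)"
        using zc r(1) by (intro divide_left_mono) (auto intro!: mult_pos_pos)
      also have "\<dots> = 4 * cmod c / x" by (simp add: r_def)
      finally show ?thesis .
    qed
    have cf: "continuous_on (sphere v r) f"
      using holomorphic_on_imp_continuous_on[OF hol] by (rule continuous_on_subset) auto
    show ?thesis
      using circle_kernel_bound[OF cf r(1) k ci] by (simp add: J_def v_def)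
  qed
  have "line_integral (\<lambda>w. f w - f (w + c)) x \<le> (\<integral>\<^sup>+y. ennreal ((4 * cmod c / x)\<^sup>2) * J y \<partial>lborel)"
    unfolding line_integral_def using 1 by (intro nn_integral_mono) auto
  also have "\<dots> = ennreal ((4 * cmod c / x)\<^sup>2) * (\<integral>\<^sup>+y. J y \<partial>lborel)"
    by (intro nn_integral_cmult) simp
  also have "\<dots> \<le> ennreal ((4 * cmod c / x)\<^sup>2) * M"
    unfolding J_def by (intro mult_left_mono circle_line_average f r M) (auto simp: r_def)
  finally show ?thesis .
qed

section \<open>Affine composition operators and series of operators\<close>

definition affine_op :: "real \<Rightarrow> complex \<Rightarrow> h2 \<Rightarrow> h2" where
  "affine_op \<alpha> \<beta> = composition_operator (\<lambda>w. complex_of_real \<alpha> * w + \<beta>)"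

lemma composition_operator_cong:
  "(\<And>w. w \<in> right_half_plane \<Longrightarrow> \<psi> w = \<psi>' w) \<Longrightarrow> composition_operator \<psi> = composition_operator \<psi>'"
  unfolding composition_operator_def by (intro ext arg_cong[where f = Abs_h2]) auto

context
  fixes \<alpha> :: real and \<beta> :: complex
  assumes \<alpha>: "\<alpha> > 0" and \<beta>: "Re \<beta> > 0"
begin

lemma Rep_affine_op: "w \<in> right_half_plane \<Longrightarrow> Rep_h2 (affine_op \<alpha> \<beta> f) w = Rep_h2 f (complex_of_real \<alpha> * w + \<beta>)"
  using Rep_composition_operator[of \<alpha> \<beta> "\<lambda>w. complex_of_real \<alpha> * w + \<beta>" f w] \<alpha> \<beta>
  by (simp add: affine_op_def right_half_plane_def)

lemma norm_affine_op: "norm (affine_op \<alpha> \<beta> f) \<le> sqrt (1 / \<alpha>) * norm f"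
  using norm_composition_operator[of \<alpha> \<beta> "\<lambda>w. complex_of_real \<alpha> * w + \<beta>" f] \<alpha> \<beta>
  by (simp add: affine_op_def right_half_plane_def)

lemma bounded_clinear_affine_op: "bounded_clinear (affine_op \<alpha> \<beta>)"
  using bounded_clinear_composition_operator[of \<alpha> \<beta> "\<lambda>w. complex_of_real \<alpha> * w + \<beta>"] \<alpha> \<beta>
  by (simp add: affine_op_def right_half_plane_def)

lemma affine_rhp: "w \<in> right_half_plane \<Longrightarrow> complex_of_real \<alpha> * w + \<beta> \<in> right_half_plane"
  using \<alpha> \<beta> by (simp add: right_half_plane_def add_pos_pos)

end

lemma bounded_clinear_funpow:
  fixes T :: "'a::complex_normed_vector \<Rightarrow> 'a"
  shows "bounded_clinear T \<Longrightarrow> bounded_clinear (T ^^ n)"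
  by (induction n) (auto simp: bounded_clinear_ident id_def o_def intro: bounded_clinear_compose)

lemma bounded_clinear_sum:
  "(\<And>i. i \<in> I \<Longrightarrow> bounded_clinear (T i)) \<Longrightarrow> bounded_clinear (\<lambda>x. \<Sum>i\<in>I. T i x)"
proof (induction I rule: infinite_finite_induct)
  case (insert i I)
  then show ?case by (simp add: bounded_clinear_add)
qed (auto simp: bounded_clinear_def)

lemma bounded_clinear_suminf:
  fixes T :: "nat \<Rightarrow> 'a::complex_normed_vector \<Rightarrow> 'b::{complex_normed_vector,banach}"
  assumes T: "\<And>n. bounded_clinear (T n)" and K: "\<And>n x. norm (T n x) \<le> K n * norm x" "summable K"
  shows "summable (\<lambda>n. T n x)" "bounded_clinear (\<lambda>x. \<Sum>n. T n x)"
proof -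
  note lin = bounded_linear.linear[OF bounded_clinearD(1)[OF T]]
  have S: "summable (\<lambda>n. norm (T n x))" for x
    by (rule summable_comparison_test'[OF summable_mult2[OF K(2), of "norm x"], of 0]) (simp add: K(1))
  note S' = summable_norm_cancel[OF S]
  show "summable (\<lambda>n. T n x)" by (rule S')
  have sc: "(\<Sum>n. T n (c *\<^sub>C x)) = c *\<^sub>C (\<Sum>n. T n x)" for c x
    by (simp add: bounded_clinearD(2)[OF T] bounded_linear.suminf[OF bounded_linear_scaleC S'])
  have "bounded_linear (\<lambda>x. \<Sum>n. T n x)"
  proof (rule bounded_linear_intro[where K = "\<Sum>n. K n"])
    show "(\<Sum>n. T n (x + y)) = (\<Sum>n. T n x) + (\<Sum>n. T n y)" for x y
      by (simp add: linear_add[OF lin] suminf_add[OF S' S'])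
    show "(\<Sum>n. T n (r *\<^sub>R x)) = r *\<^sub>R (\<Sum>n. T n x)" for r x
      using sc[of "complex_of_real r" x] by (simp add: scaleC_of_real)
    show "norm (\<Sum>n. T n x) \<le> norm x * (\<Sum>n. K n)" for x
    proof -
      have "norm (\<Sum>n. T n x) \<le> (\<Sum>n. norm (T n x))" by (rule summable_norm[OF S])
      also have "\<dots> \<le> (\<Sum>n. K n * norm x)"
        by (intro suminf_le K(1) S summable_mult2[OF K(2)])
      also have "\<dots> = norm x * (\<Sum>n. K n)" by (simp add: suminf_mult2[OF K(2), symmetric] mult.commute)
      finally show ?thesis .
    qed
  qed
  then show "bounded_clinear (\<lambda>x. \<Sum>n. T n x)" using sc by (simp add: bounded_clinear_def)
qed

lemma bounded_clinear_boundE: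
  assumes "bounded_clinear T"
  obtains K where "K \<ge> 0" "\<And>x. norm (T x) \<le> K * norm x"
  using bounded_linear.nonneg_bounded[OF bounded_clinearD(1)[OF assms]] by (metis mult.commute)

text \<open>The map is \<open>w \<mapsto> a * (w + c) - c\<close>, with fixed point
  \<open>- c\<close> to the left of the half-plane; the last condition is
  \<open>cmod l < a powr (-1/2)\<close>.\<close>

locale expanding_affine =
  fixes a :: real and c :: complex and l :: complex
  assumes a: "1 < a" and c: "0 < Re c" and l: "0 < cmod l" "cmod l * sqrt a < 1"
begin

text \<open>In the coordinate \<open>w + c\<close>, \<open>C\<close> is composition with the dilation by \<open>a\<close>, and \<open>R n\<close> is
  composition with the dilation by \<open>(1 / a) ^ Suc n\<close> followed by the translation by \<open>c\<close>.\<close>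

definition C :: "h2 \<Rightarrow> h2" where "C = affine_op a (complex_of_real (a - 1) * c)"
definition T :: "h2 \<Rightarrow> h2" where "T = affine_op 1 c"
definition D :: "h2 \<Rightarrow> h2" where "D f = f - T f"
definition R :: "nat \<Rightarrow> h2 \<Rightarrow> h2" where
  "R n = affine_op ((1 / a) ^ Suc n) (complex_of_real ((1 / a) ^ Suc n) * c)"

lemma C: "bounded_clinear C"
  unfolding C_def using a c by (intro bounded_clinear_affine_op) auto

lemma T: "bounded_clinear T"
  unfolding T_def using c by (intro bounded_clinear_affine_op) auto

lemma D: "bounded_clinear D"
  unfolding D_def by (intro bounded_clinear_diff bounded_clinear_ident T)

lemma R: "bounded_clinear (R n)"
  unfolding R_def using a c by (intro bounded_clinear_affine_op) auto

lemma norm_R: "norm (R n f) \<le> sqrt a ^ Suc n * norm f"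
  using norm_affine_op[of "(1 / a) ^ Suc n" "complex_of_real ((1 / a) ^ Suc n) * c" f] a c
  by (simp add: R_def real_sqrt_power[symmetric] power_divide del: power_Suc)

lemma Rep_C: "w \<in> right_half_plane \<Longrightarrow> Rep_h2 (C f) w = Rep_h2 f (complex_of_real a * (w + c) - c)"
  using a c by (simp add: C_def Rep_affine_op algebra_simps)

lemma C_maps: "w \<in> right_half_plane \<Longrightarrow> complex_of_real a * (w + c) - c \<in> right_half_plane"
  using affine_rhp[of a "complex_of_real (a - 1) * c" w] a c by (simp add: algebra_simps)

lemma Rep_C_pow: "w \<in> right_half_plane \<Longrightarrow> Rep_h2 ((C ^^ n) f) w = Rep_h2 f (complex_of_real (a ^ n) * (w + c) - c)"
proof (induction n arbitrary: w)
  case (Suc n)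
  then show ?case using Suc.IH[OF C_maps[OF Suc.prems]] by (simp add: Rep_C mult_ac)
qed simp

lemma Rep_T: "w \<in> right_half_plane \<Longrightarrow> Rep_h2 (T f) w = Rep_h2 f (w + c)"
  using c by (simp add: T_def Rep_affine_op)

lemma Rep_R: "w \<in> right_half_plane \<Longrightarrow> Rep_h2 (R n f) w = Rep_h2 f (complex_of_real ((1 / a) ^ Suc n) * (w + c))"
  using a c by (simp add: R_def Rep_affine_op distrib_left del: power_Suc)

text \<open>In the coordinate \<open>v = w + c\<close>, \<open>T f\<close> is the function
  \<open>f v\<close>, which is defined for all \<open>Re v > 0\<close> and so admits every dilation.
  \<open>R n f\<close> is \<open>T f\<close> inversely dilated \<open>Suc n\<close> times, and
  \<open>C\<close> undoes one step.\<close>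

lemma C_R_0: "C (R 0 f) = T f"
  using a by (intro h2_eqI) (simp add: Rep_C Rep_R Rep_T C_maps)

lemma C_R_Suc: "C (R (Suc n) f) = R n f"
  using a by (intro h2_eqI) (simp add: Rep_C Rep_R C_maps)

text \<open>The norm of \<open>C\<close> exceeds \<open>cmod l\<close>, but iterated differences decay fast enough on
  far lines to make the series over powers of \<open>C\<close> converge; what the differences omit is of the
  form \<open>T (Q f)\<close>, on which the inverse dilations \<open>R n\<close> act.\<close>

lemma D_pow_decay:
  "\<exists>\<rho>>0. \<exists>K\<ge>0. \<forall>f x. x \<ge> \<rho> \<longrightarrow> line_integral (Rep_h2 ((D ^^ N) f)) x \<le> ennreal (K / x ^ (2 * N) * (norm f)\<^sup>2)"
proof (induction N)
  case 0
  show ?case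
    by (intro exI[of _ 1] conjI allI impI) (auto intro!: line_integral_le_norm)
next
  case (Suc N)
  then obtain \<rho> K where \<rho>: "\<rho> > 0" and K: "K \<ge> 0"
    and IH: "\<And>f x. x \<ge> \<rho> \<Longrightarrow> line_integral (Rep_h2 ((D ^^ N) f)) x \<le> ennreal (K / x ^ (2 * N) * (norm f)\<^sup>2)"
    by blast
  \<comment> \<open>From \<open>\<rho>'\<close> on, the strip of half-width \<open>x / 2\<close>
    around the line at \<open>x\<close> stays in the range of the induction hypothesis, and
    \<open>c\<close> is small enough for the difference estimate. Passing from \<open>x\<close> to
    \<open>x / 2\<close> costs \<open>2 ^ (2 * N)\<close>.\<close>
  define \<rho>' where "\<rho>' = max (2 * \<rho>) (4 * cmod c)"
  define K' where "K' = (4 * cmod c)\<^sup>2 * (K * 2 ^ (2 * N))"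
  have "line_integral (Rep_h2 ((D ^^ Suc N) f)) x \<le> ennreal (K' / x ^ (2 * Suc N) * (norm f)\<^sup>2)"
    if x: "x \<ge> \<rho>'" for f x
  proof -
    define g where "g = (D ^^ N) f"
    have x0: "x > 0" "x \<ge> 2 * \<rho>" "cmod c \<le> x / 4" using x \<rho> by (auto simp: \<rho>'_def)
    have "line_integral (Rep_h2 ((D ^^ Suc N) f)) x = line_integral (\<lambda>w. Rep_h2 g w - Rep_h2 g (w + c)) x"
      unfolding line_integral_def using x0 by (simp add: D_def g_def Rep_h2_minus Rep_T)
    also have "\<dots> \<le> ennreal ((4 * cmod c / x)\<^sup>2) * ennreal (K / (x / 2) ^ (2 * N) * (norm f)\<^sup>2)"
    proof (rule line_integral_difference[OF Rep_h2_holomorphic x0(1,3)])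
      fix x' assume "\<bar>x' - x\<bar> \<le> x / 2"
      then have x': "x / 2 \<le> x'" unfolding abs_le_iff by linarith
      then have "x' \<ge> \<rho>" using x0 by linarith
      then have "line_integral (Rep_h2 g) x' \<le> ennreal (K / x' ^ (2 * N) * (norm f)\<^sup>2)"
        unfolding g_def by (rule IH)
      also have "\<dots> \<le> ennreal (K / (x / 2) ^ (2 * N) * (norm f)\<^sup>2)"
        using x' x0 K by (intro ennreal_leI mult_right_mono divide_left_mono power_mono mult_pos_pos) auto
      finally show "line_integral (Rep_h2 g) x' \<le> ennreal (K / (x / 2) ^ (2 * N) * (norm f)\<^sup>2)" .
    qed
    also have "\<dots> = ennreal ((4 * cmod c / x)\<^sup>2 * (K / (x / 2) ^ (2 * N) * (norm f)\<^sup>2))"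
      using K x0 by (intro ennreal_mult[symmetric]) auto
    also have "(4 * cmod c / x)\<^sup>2 * (K / (x / 2) ^ (2 * N) * (norm f)\<^sup>2) = K' / x ^ (2 * Suc N) * (norm f)\<^sup>2"
      using x0 by (simp add: K'_def power_divide power2_eq_square field_simps)
    finally show ?thesis .
  qed
  moreover have "\<rho>' > 0" "K' \<ge> 0" using \<rho> K by (auto simp: \<rho>'_def K'_def)
  ultimately show ?case by blast
qed

text \<open>The change of variables also yields a factor \<open>(1 / a) ^ n\<close>, which is given
  away. The gain is the abscissa: as \<open>Re c > 0\<close>, it grows like \<open>a ^ n\<close>
  even for lines close to the boundary.\<close>

lemma line_integral_C_pow:
  assumes x: "x > 0"
  shows "line_integral (Rep_h2 ((C ^^ n) f)) x \<le> line_integral (Rep_h2 f) (a ^ n * x + (a ^ n - 1) * Re c)"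
proof -
  define X where "X = a ^ n * x + (a ^ n - 1) * Re c"
  have an: "a ^ n \<ge> 1" using a by simp
  have "a ^ n * x > 0" using x a by simp
  moreover have "(a ^ n - 1) * Re c \<ge> 0" using an c by simp
  ultimately have X: "X > 0" unfolding X_def by linarith
  note [measurable] = Rep_h2_line_measurable[OF X]
  have pt: "complex_of_real (a ^ n) * (Complex x y + c) - c = Complex X ((a ^ n - 1) * Im c + a ^ n * y)" for y
    by (simp add: X_def complex_eq_iff algebra_simps)
  have "line_integral (Rep_h2 ((C ^^ n) f)) x
      = (\<integral>\<^sup>+y. ennreal ((cmod (Rep_h2 f (Complex X ((a ^ n - 1) * Im c + a ^ n * y))))\<^sup>2) \<partial>lborel)"
    unfolding line_integral_def using x by (simp only: Rep_C_pow Complex_in_rhp pt)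
  also have "\<dots> \<le> ennreal (a ^ n) * \<dots>"
    using an mult_right_mono[of 1 "ennreal (a ^ n)"] by simp
  also have "\<dots> = line_integral (Rep_h2 f) X"
    unfolding line_integral_def
    using nn_integral_real_affine[of "\<lambda>y. ennreal ((cmod (Rep_h2 f (Complex X y)))\<^sup>2)" "a ^ n" "(a ^ n - 1) * Im c"] an a
    by simp
  finally show ?thesis by (simp add: X_def)
qed

lemma C_pow_D_pow_decay:
  "\<exists>K\<ge>0. \<exists>n0. \<forall>n\<ge>n0. \<forall>f. norm ((C ^^ n) ((D ^^ N) f)) \<le> K * ((1 / a) ^ N) ^ n * norm f"
proof -
  obtain \<rho> K where \<rho>: "\<rho> > 0" and K: "K \<ge> 0"
    and dec: "\<And>f x. x \<ge> \<rho> \<Longrightarrow> line_integral (Rep_h2 ((D ^^ N) f)) x \<le> ennreal (K / x ^ (2 * N) * (norm f)\<^sup>2)"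
    using D_pow_decay[of N] by blast
  \<comment> \<open>For \<open>n \<ge> 1\<close>,
    \<open>a ^ n - 1 \<ge> a ^ n * (1 - 1 / a)\<close>, so the line lands at abscissa at least
    \<open>a ^ n * \<delta>\<close>; \<open>n1\<close> makes this exceed
    \<open>\<rho>\<close>.\<close>
  define \<delta> where "\<delta> = (1 - 1 / a) * Re c"
  have \<delta>: "\<delta> > 0" using a c by (simp add: \<delta>_def)
  obtain n1 where n1: "\<rho> / \<delta> < a ^ n1" using real_arch_pow[OF a] by blast
  have "norm ((C ^^ n) ((D ^^ N) f)) \<le> sqrt K / \<delta> ^ N * ((1 / a) ^ N) ^ n * norm f" if n: "n \<ge> Suc n1" for n f
  proof (rule norm_h2_leI)
    fix x :: real assume x: "x > 0"
    define X where "X = a ^ n * x + (a ^ n - 1) * Re c"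
    have "a ^ n * (1 / a) \<ge> 1"
      using n a by (cases n) auto
    then have "a ^ n * (1 - 1 / a) \<le> a ^ n - 1" by (simp add: right_diff_distrib)
    then have "a ^ n * (1 - 1 / a) * Re c \<le> (a ^ n - 1) * Re c" using c by (intro mult_right_mono) auto
    moreover have "a ^ n * x > 0" using x a by simp
    ultimately have X: "a ^ n * \<delta> \<le> X" by (simp add: X_def \<delta>_def mult.assoc)
    have "\<rho> < a ^ n1 * \<delta>" using n1 \<delta> by (simp add: pos_divide_less_eq)
    also have "\<dots> \<le> a ^ n * \<delta>" using n a \<delta> by (intro mult_right_mono power_increasing) auto
    finally have X\<rho>: "X \<ge> \<rho>" using X by linarith
    have p: "0 < a ^ n * \<delta>" using a \<delta> by simp
    have "line_integral (Rep_h2 ((C ^^ n) ((D ^^ N) f))) x \<le> line_integral (Rep_h2 ((D ^^ N) f)) X"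
      unfolding X_def by (rule line_integral_C_pow[OF x])
    also have "\<dots> \<le> ennreal (K / X ^ (2 * N) * (norm f)\<^sup>2)" by (rule dec[OF X\<rho>])
    also have "\<dots> \<le> ennreal (K / (a ^ n * \<delta>) ^ (2 * N) * (norm f)\<^sup>2)"
      using X p K by (intro ennreal_leI mult_right_mono divide_left_mono power_mono mult_pos_pos) auto
    also have "K / (a ^ n * \<delta>) ^ (2 * N) * (norm f)\<^sup>2 = (sqrt K / \<delta> ^ N * ((1 / a) ^ N) ^ n * norm f)\<^sup>2"
      using K a \<delta> by (simp add: power_mult_distrib power_divide power_mult[symmetric] mult_ac)
    finally show "line_integral (Rep_h2 ((C ^^ n) ((D ^^ N) f))) x
        \<le> ennreal ((sqrt K / \<delta> ^ N * ((1 / a) ^ N) ^ n * norm f)\<^sup>2)" .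
  qed (use K a \<delta> in auto)
  then show ?thesis using K \<delta> by (intro exI[of _ "sqrt K / \<delta> ^ N"]) auto
qed

lemma right_inverse: "\<exists>W. bounded_clinear W \<and> (\<forall>f. C (W f) - l *\<^sub>C W f = f)"
proof -
  have l0: "l \<noteq> 0" using l by auto
  \<comment> \<open>With this \<open>N\<close> the decay of \<open>((1 / a) ^ N) ^ n\<close> beats
    the growth of \<open>inverse l ^ n\<close>.\<close>
  obtain N where N: "(1 / a) ^ N < cmod l" using real_arch_pow_inv[of "cmod l" "1 / a"] l a by auto
  \<comment> \<open>A geometric sum in \<open>D = I - T\<close>, whence
    \<open>T Q = I - D ^^ N\<close>: this is the splitting of \<open>f\<close>.\<close>
  define Q where "Q f = (\<Sum>i<N. (D ^^ i) f)" for f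
  have Q: "bounded_clinear Q"
    unfolding Q_def by (intro bounded_clinear_sum bounded_clinear_funpow D)
  have TQ: "T (Q f) = f - (D ^^ N) f" for f
  proof -
    have "T (Q f) = (\<Sum>i<N. T ((D ^^ i) f))"
      unfolding Q_def by (rule linear_sum[OF bounded_linear.linear[OF bounded_clinearD(1)[OF T]]])
    also have "\<dots> = (\<Sum>i<N. (D ^^ i) f - (D ^^ Suc i) f)" by (simp add: D_def)
    also have "\<dots> = f - (D ^^ N) f" by (subst sum_lessThan_telescope') simp
    finally show ?thesis .
  qed
  \<comment> \<open>The sum of the \<open>A n f\<close> solves \<open>C x - l x = T (Q f)\<close>,
    and minus the sum of the \<open>B n f\<close> solves \<open>C x - l x = (D ^^ N) f\<close>; in
    both series \<open>C\<close> shifts the index by one.\<close>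
  define A where "A n f = l ^ n *\<^sub>C R n (Q f)" for n f
  define B where "B n f = inverse l ^ Suc n *\<^sub>C (C ^^ n) ((D ^^ N) f)" for n f
  obtain KQ where KQ: "KQ \<ge> 0" "\<And>x. norm (Q x) \<le> KQ * norm x" using bounded_clinear_boundE[OF Q] by blast
  have A: "bounded_clinear (A n)" for n
    unfolding A_def by (intro bounded_clinear_compose[OF bounded_clinear_scaleC] bounded_clinear_compose[OF R Q])
  have B: "bounded_clinear (B n)" for n
    unfolding B_def by (intro bounded_clinear_compose[OF bounded_clinear_scaleC]
        bounded_clinear_compose[OF bounded_clinear_funpow[OF C] bounded_clinear_funpow[OF D]])
  have A_le: "norm (A n f) \<le> (sqrt a * KQ) * (cmod l * sqrt a) ^ n * norm f" for n f
  proof -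
    have "norm (A n f) \<le> cmod l ^ n * (sqrt a ^ Suc n * norm (Q f))"
      unfolding A_def norm_scaleC norm_power by (intro mult_left_mono norm_R) simp
    also have "\<dots> \<le> cmod l ^ n * (sqrt a ^ Suc n * (KQ * norm f))"
      using a by (intro mult_left_mono KQ) auto
    finally show ?thesis by (simp add: power_mult_distrib mult_ac)
  qed
  have sA: "summable (\<lambda>n. (sqrt a * KQ) * (cmod l * sqrt a) ^ n)"
    using l a by (intro summable_mult summable_geometric) auto
  note A_sum = bounded_clinear_suminf[OF A A_le sA]
  obtain K n0 where K: "K \<ge> 0" "\<And>n f. n \<ge> n0 \<Longrightarrow> norm ((C ^^ n) ((D ^^ N) f)) \<le> K * ((1 / a) ^ N) ^ n * norm f"
    using C_pow_D_pow_decay[of N] by blast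
  define q where "q = (1 / a) ^ N / cmod l"
  have q: "0 \<le> q" "q < 1" using N a l by (auto simp: q_def)
  have "\<exists>k\<ge>0. \<forall>f. norm (B n f) \<le> k * norm f" for n using bounded_clinear_boundE[OF B] by metis
  then obtain k where k: "\<And>n. k n \<ge> 0" "\<And>n f. norm (B n f) \<le> k n * norm f" by metis
  \<comment> \<open>The decay estimate starts at \<open>n0\<close>; the finitely many earlier terms
    contribute arbitrary bounds.\<close>
  define k' where "k' n = (if n < n0 then k n else K / cmod l * q ^ n)" for n
  have B_le: "norm (B n f) \<le> k' n * norm f" for n f
  proof (cases "n < n0")
    case True
    then show ?thesis by (simp add: k'_def k)
  next
    case False
    have "norm (B n f) \<le> inverse (cmod l) ^ Suc n * (K * ((1 / a) ^ N) ^ n * norm f)"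
      unfolding B_def norm_scaleC norm_power norm_inverse using False by (intro mult_left_mono K(2)) auto
    also have "\<dots> = K / cmod l * q ^ n * norm f"
      by (simp add: q_def power_divide divide_inverse power_inverse power_mult_distrib mult_ac)
    finally show ?thesis using False by (simp add: k'_def)
  qed
  have sB: "summable k'"
  proof (rule summable_comparison_test_ev)
    show "\<forall>\<^sub>F n in sequentially. norm (k' n) \<le> K / cmod l * q ^ n"
      using eventually_ge_at_top[of n0] by eventually_elim (use K q in \<open>auto simp: k'_def\<close>)
    show "summable (\<lambda>n. K / cmod l * q ^ n)" using q by (intro summable_mult summable_geometric) auto
  qed
  note B_sum = bounded_clinear_suminf[OF B B_le sB]
  define W where "W f = (\<Sum>n. A n f) - (\<Sum>n. B n f)" for f
  have W: "bounded_clinear W"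
    unfolding W_def by (intro bounded_clinear_diff A_sum(2) B_sum(2))
  note blC = bounded_clinearD(1)[OF C]
  have "C (W f) - l *\<^sub>C W f = f" for f
  proof -
    have CA: "C (A 0 f) = T (Q f)" "C (A (Suc n) f) = l *\<^sub>C A n f" for n
      by (simp_all add: A_def bounded_clinearD(2)[OF C] C_R_0 C_R_Suc scaleC_scaleC)
    have CB: "C (B n f) = l *\<^sub>C B (Suc n) f" for n
    proof -
      have "l * inverse l ^ Suc (Suc n) = inverse l ^ Suc n"
        using l0 by (simp add: mult.assoc[symmetric])
      then show ?thesis by (simp only: B_def bounded_clinearD(2)[OF C] scaleC_scaleC) simp
    qed
    have B0: "l *\<^sub>C B 0 f = (D ^^ N) f" using l0 by (simp add: B_def scaleC_scaleC)
    have sCA: "summable (\<lambda>n. C (A n f))" using bounded_linear.summable[OF blC A_sum(1)] .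
    have "C (\<Sum>n. A n f) = (\<Sum>n. C (A n f))" by (rule bounded_linear.suminf[OF blC A_sum(1)])
    also have "\<dots> = (\<Sum>n. C (A (Suc n) f)) + C (A 0 f)"
      using suminf_split_head[OF sCA] by simp
    also have "(\<Sum>n. C (A (Suc n) f)) = l *\<^sub>C (\<Sum>n. A n f)"
      unfolding CA(2) by (rule bounded_linear.suminf[OF bounded_linear_scaleC A_sum(1), symmetric])
    finally have 1: "C (\<Sum>n. A n f) = l *\<^sub>C (\<Sum>n. A n f) + T (Q f)" by (simp add: CA(1))
    have "C (\<Sum>n. B n f) = (\<Sum>n. C (B n f))" by (rule bounded_linear.suminf[OF blC B_sum(1)])
    also have "\<dots> = l *\<^sub>C (\<Sum>n. B (Suc n) f)"
      unfolding CB using summable_ignore_initial_segment[OF B_sum(1)[of f], of 1]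
      by (intro bounded_linear.suminf[OF bounded_linear_scaleC, symmetric]) simp
    also have "(\<Sum>n. B (Suc n) f) = (\<Sum>n. B n f) - B 0 f"
      by (rule suminf_split_head[OF B_sum(1)])
    finally have 2: "C (\<Sum>n. B n f) = l *\<^sub>C (\<Sum>n. B n f) - (D ^^ N) f"
      by (simp add: scaleC_diff_right B0)
    show ?thesis
      unfolding W_def linear_diff[OF bounded_linear.linear[OF blC]] scaleC_diff_right 1 2
      by (simp add: TQ)
  qed
  with W show ?thesis by blast
qed

end

section \<open>Eigenfunctions of expanding maps\<close>

lemma nn_integral_powr_finite:
  assumes d: "d > 0" and t: "t < -1"
  shows "(\<integral>\<^sup>+y. ennreal (cmod (Complex d y) powr t) \<partial>lborel) < \<infinity>"
proof -
  define g where "g y = ennreal (y powr t) * indicator {1..} y" for y :: real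
  have g: "(\<integral>\<^sup>+y. g y \<partial>lborel) < \<infinity>"
  proof -
    have "(\<integral>\<^sup>+y. ennreal (y powr t) * indicator {1..} y \<partial>lborel) = ennreal (0 - 1 powr (t + 1) / (t + 1))"
    proof (rule nn_integral_FTC_atLeast[where F = "\<lambda>y. y powr (t + 1) / (t + 1)"])
      show "((\<lambda>y. y powr (t + 1) / (t + 1)) has_real_derivative y powr t) (at y)" if "1 \<le> y" for y
        using that t by (auto intro!: derivative_eq_intros simp: divide_simps)
      have "((\<lambda>y. y powr (t + 1) / (t + 1)) \<longlongrightarrow> 0 / (t + 1)) at_top"
        using t by (intro tendsto_divide tendsto_neg_powr filterlim_ident) auto
      then show "((\<lambda>y. y powr (t + 1) / (t + 1)) \<longlongrightarrow> 0) at_top" by simp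
    qed auto
    then show ?thesis by (simp add: g_def)
  qed
  have gm [measurable]: "g \<in> borel_measurable borel" unfolding g_def by measurable
  have le: "ennreal (cmod (Complex d y) powr t)
      \<le> ennreal (d powr t) * indicator {-1..1} y + g y + g (- y)" for y
  proof (cases "y \<in> {-1..1}")
    case True
    have "\<bar>Re (Complex d y)\<bar> \<le> cmod (Complex d y)" by (rule abs_Re_le_cmod)
    then have "cmod (Complex d y) powr t \<le> d powr t"
      using d t by (intro powr_mono2') auto
    then show ?thesis using True by (simp add: ennreal_leI add_increasing2)
  next
    case False
    have "\<bar>Im (Complex d y)\<bar> \<le> cmod (Complex d y)" by (rule abs_Im_le_cmod)
    then have "cmod (Complex d y) powr t \<le> \<bar>y\<bar> powr t"
      using False t by (intro powr_mono2') auto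
    then have "ennreal (cmod (Complex d y) powr t) \<le> ennreal (\<bar>y\<bar> powr t)" by (rule ennreal_leI)
    also have "\<dots> \<le> g y + g (- y)" using False by (cases "y > 0") (auto simp: g_def)
    finally show ?thesis using False by simp
  qed
  have "(\<integral>\<^sup>+y. ennreal (cmod (Complex d y) powr t) \<partial>lborel)
      \<le> (\<integral>\<^sup>+y. ennreal (d powr t) * indicator {-1..1} y + g y + g (- y) \<partial>lborel)"
    by (intro nn_integral_mono le)
  also have "\<dots> = (\<integral>\<^sup>+y. ennreal (d powr t) * indicator {-1..1} y \<partial>(lborel :: real measure))
      + (\<integral>\<^sup>+y. g y \<partial>lborel) + (\<integral>\<^sup>+y. g (- y) \<partial>lborel)"
    by (simp add: nn_integral_add)
  also have "(\<integral>\<^sup>+y. g (- y) \<partial>lborel) = (\<integral>\<^sup>+y. g y \<partial>lborel)"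
    using nn_integral_real_affine[of g "-1" 0] by simp
  also have "(\<integral>\<^sup>+y. ennreal (d powr t) * indicator {-1..1} y \<partial>(lborel :: real measure)) < \<infinity>"
    by (simp add: nn_integral_cmult_indicator ennreal_mult_less_top)
  finally show ?thesis using g by (simp add: less_top[symmetric])
qed

definition powr_line_bound :: "real \<Rightarrow> real \<Rightarrow> ennreal" where
  "powr_line_bound d s = (\<integral>\<^sup>+y. ennreal (cmod (Complex d y) powr (2 * s)) \<partial>lborel)"

lemma powr_line_bound_finite: "d > 0 \<Longrightarrow> s < -1/2 \<Longrightarrow> powr_line_bound d s < \<infinity>"
  unfolding powr_line_bound_def by (rule nn_integral_powr_finite) auto

text \<open>Moving a line away from the origin only decreases a negative power of the modulus, so
  one bound at \<open>d\<close> serves all lines \<open>X \<ge> d\<close>.\<close>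

lemma nn_integral_powr_line:
  assumes d: "0 < d" "d \<le> X" and s: "s < 0" and K: "0 \<le> K"
    and g: "\<And>y. cmod (g y) \<le> K * cmod (Complex X (b + y)) powr s"
  shows "(\<integral>\<^sup>+y. ennreal ((cmod (g y))\<^sup>2) \<partial>lborel) \<le> ennreal (K\<^sup>2) * powr_line_bound d s"
proof -
  have [measurable]: "(\<lambda>y. cmod (Complex d y)) \<in> borel_measurable borel"
    unfolding complex_eq by (intro borel_measurable_continuous_onI continuous_intros)
  have le: "ennreal ((cmod (g y))\<^sup>2) \<le> ennreal (K\<^sup>2) * ennreal (cmod (Complex d (b + 1 * y)) powr (2 * s))" for y
  proof -
    have "cmod (Complex d (b + y)) \<le> cmod (Complex X (b + y))"
      using d by (auto simp: cmod_def intro!: real_sqrt_le_mono power_mono)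
    moreover have "0 < cmod (Complex d (b + y))" using d by (simp add: complex_eq_iff)
    ultimately have "cmod (Complex X (b + y)) powr s \<le> cmod (Complex d (b + y)) powr s"
      using s by (intro powr_mono2') auto
    then have "cmod (g y) \<le> K * cmod (Complex d (b + y)) powr s"
      using g[of y] K by (meson mult_left_mono order_trans)
    then have "(cmod (g y))\<^sup>2 \<le> (K * cmod (Complex d (b + y)) powr s)\<^sup>2"
      by (intro power_mono) auto
    also have "\<dots> = K\<^sup>2 * cmod (Complex d (b + y)) powr (2 * s)"
      unfolding mult_2 powr_add by (simp add: power_mult_distrib power2_eq_square)
    finally have "ennreal ((cmod (g y))\<^sup>2) \<le> ennreal (K\<^sup>2 * cmod (Complex d (b + y)) powr (2 * s))"
      by (rule ennreal_leI)
    then show ?thesis by (simp add: ennreal_mult)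
  qed
  have "(\<integral>\<^sup>+y. ennreal ((cmod (g y))\<^sup>2) \<partial>lborel)
      \<le> (\<integral>\<^sup>+y. ennreal (K\<^sup>2) * ennreal (cmod (Complex d (b + 1 * y)) powr (2 * s)) \<partial>lborel)"
    by (intro nn_integral_mono le)
  also have "\<dots> = ennreal (K\<^sup>2) * (\<integral>\<^sup>+y. ennreal (cmod (Complex d (b + 1 * y)) powr (2 * s)) \<partial>lborel)"
    by (intro nn_integral_cmult) measurable
  also have "(\<integral>\<^sup>+y. ennreal (cmod (Complex d (b + 1 * y)) powr (2 * s)) \<partial>lborel) = powr_line_bound d s"
    unfolding powr_line_bound_def
    by (subst (2) nn_integral_real_affine[where c = 1 and t = b]) auto
  finally show ?thesis .
qed

lemma h2_functions_powr_bound: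
  assumes hol: "g holomorphic_on right_half_plane" and out: "\<And>w. w \<notin> right_half_plane \<Longrightarrow> g w = 0"
    and c: "0 < Re c" and s: "s < -1/2"
    and bd: "\<And>w. w \<in> right_half_plane \<Longrightarrow> cmod (g w) \<le> K * cmod (w + c) powr s"
  shows "g \<in> h2_functions"
proof -
  have K: "0 \<le> K"
  proof -
    have "0 \<le> K * cmod (1 + c) powr s" using order_trans[OF norm_ge_zero bd[of 1]] by (simp add: right_half_plane_def add.commute)
    moreover have "1 + c \<noteq> 0" using c by (auto simp: complex_eq_iff)
    ultimately show ?thesis by (simp add: zero_le_mult_iff powr_gt_zero)
  qed
  have "line_integral g x \<le> ennreal (K\<^sup>2) * powr_line_bound (Re c) s" if x: "x > 0" for x
    unfolding line_integral_def
  proof (rule nn_integral_powr_line[where X = "x + Re c" and b = "Im c"])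
    show "cmod (g (Complex x y)) \<le> K * cmod (Complex (x + Re c) (Im c + y)) powr s" for y
    proof -
      have "Complex x y + c = Complex (x + Re c) (Im c + y)" by (simp add: complex_eq_iff)
      then show ?thesis using bd[of "Complex x y"] x by simp
    qed
  qed (use c s K x in auto)
  then have "h2_normsq g \<le> ennreal (K\<^sup>2) * powr_line_bound (Re c) s"
    unfolding h2_normsq_def by (intro SUP_least) auto
  also have "\<dots> < \<infinity>" using powr_line_bound_finite[OF c s] by (simp add: ennreal_mult_less_top)
  finally show ?thesis using hol out by (simp add: h2_functions_def)
qed

text \<open>For non-real \<open>s\<close> the argument of \<open>z\<close> contributes
  \<open>exp (- Im s * Im (Ln z))\<close>, and it is at most \<open>pi\<close> in modulus.\<close>

lemma cmod_powr_le:
  assumes "z \<noteq> 0"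
  shows "cmod (z powr s) \<le> exp (\<bar>Im s\<bar> * pi) * cmod z powr Re s"
proof -
  have "\<bar>Im (Ln z)\<bar> \<le> pi" using mpi_less_Im_Ln[OF assms] Im_Ln_le_pi[OF assms] by (simp add: abs_le_iff)
  then have "\<bar>Im s * Im (Ln z)\<bar> \<le> \<bar>Im s\<bar> * pi" by (simp add: abs_mult mult_left_mono)
  then have "Re s * ln (cmod z) - Im s * Im (Ln z) \<le> \<bar>Im s\<bar> * pi + Re s * ln (cmod z)" by (simp add: abs_le_iff)
  then show ?thesis
    using assms by (simp add: powr_def norm_exp_eq_Re Re_Ln exp_add[symmetric] mult.commute)
qed

lemma h2_of_powr_bound:
  assumes hol: "g holomorphic_on right_half_plane" and c: "0 < Re c" and s: "s < -1/2"
    and bd: "\<And>w. w \<in> right_half_plane \<Longrightarrow> cmod (g w) \<le> K * cmod (w + c) powr s"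
  obtains f where "\<And>w. w \<in> right_half_plane \<Longrightarrow> Rep_h2 f w = g w"
proof -
  define g' where "g' w = (if w \<in> right_half_plane then g w else 0)" for w
  have "g' \<in> h2_functions"
  proof (rule h2_functions_powr_bound[OF _ _ c s, where K = K])
    show "g' holomorphic_on right_half_plane"
      by (rule holomorphic_transform[OF hol]) (simp add: g'_def)
  qed (auto simp: g'_def bd)
  then have "Rep_h2 (Abs_h2 g') = g'" by (rule Abs_h2_inverse)
  then show ?thesis using that[of "Abs_h2 g'"] by (simp add: g'_def)
qed

lemma shifted_rhp_nonzero: "w \<in> right_half_plane \<Longrightarrow> 0 < Re c \<Longrightarrow> 0 < Re (w + c)"
  by (simp add: right_half_plane_def)

lemma shifted_rhp_neq_0: "w \<in> right_half_plane \<Longrightarrow> 0 < Re c \<Longrightarrow> w + c \<noteq> 0"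
  using shifted_rhp_nonzero[of w c] by (metis less_irrefl zero_complex.simps(1))

lemma Ln_shift_holomorphic:
  assumes "0 < Re c" shows "(\<lambda>w. Ln (w + c)) holomorphic_on right_half_plane"
proof -
  have "w + c \<notin> \<real>\<^sub>\<le>\<^sub>0" if "w \<in> right_half_plane" for w
    using shifted_rhp_nonzero[OF that assms] by (auto simp: complex_nonpos_Reals_iff)
  then show ?thesis by (intro holomorphic_intros)
qed

context
  fixes a :: real and c l :: complex
  assumes a: "1 < a" and c: "0 < Re c" and l: "0 < cmod l" "cmod l * sqrt a < 1"
begin

text \<open>The functions \<open>(w + c) powr s * p (q w)\<close>, where \<open>a powr s = l\<close>, \<open>p\<close> is a polynomial and
  \<open>q\<close> is bounded and invariant under the dilation by \<open>a\<close> in the coordinate \<open>w + c\<close>, form an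
  infinite-dimensional eigenspace.\<close>

definition eigen_exponent :: complex where "eigen_exponent = Ln l / complex_of_real (ln a)"

definition quasi_period :: "complex \<Rightarrow> complex" where
  "quasi_period w = exp (2 * complex_of_real pi * \<i> / complex_of_real (ln a) * Ln (w + c))"

definition eigen_fun :: "complex poly \<Rightarrow> complex \<Rightarrow> complex" where
  "eigen_fun p w = (w + c) powr eigen_exponent * poly p (quasi_period w)"

text \<open>The real part of the exponent times \<open>ln a\<close> is \<open>ln (cmod l)\<close>,
  so the condition on \<open>l\<close> is exactly square integrability of the power on vertical
  lines.\<close>

lemma Re_eigen_exponent: "Re eigen_exponent < -1/2"
proof -
  have "ln (cmod l * sqrt a) < 0" using l a by simp
  then have "ln (cmod l) + ln a / 2 < 0" using l a by (simp add: ln_mult ln_sqrt)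
  moreover have "Re eigen_exponent * ln a = ln (cmod l)"
    using l a by (simp add: eigen_exponent_def Re_divide_of_real Re_Ln)
  ultimately have "(Re eigen_exponent + 1 / 2) * ln a < 0" by (simp add: distrib_right)
  then show ?thesis using a by (simp add: mult_less_0_iff)
qed

text \<open>The modulus of a purely imaginary power depends only on the argument, which is
  bounded.\<close>

lemma quasi_period_bound: "w \<in> right_half_plane \<Longrightarrow> cmod (quasi_period w) \<le> exp (2 * pi * pi / ln a)"
proof -
  assume "w \<in> right_half_plane"
  then have "w + c \<noteq> 0" using shifted_rhp_neq_0[OF _ c] by blast
  then have "- pi \<le> Im (Ln (w + c))" using mpi_less_Im_Ln less_imp_le by blast
  then have "- (2 * pi * Im (Ln (w + c)) / ln a) \<le> 2 * pi * pi / ln a"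
  proof -
    have "pi * (- Im (Ln (w + c))) \<le> pi * pi"
      using \<open>- pi \<le> Im (Ln (w + c))\<close> by (intro mult_left_mono) auto
    then show ?thesis using a by (simp add: divide_simps)
  qed
  then show ?thesis by (simp add: quasi_period_def norm_exp_eq_Re Re_divide_of_real)
qed

lemma eigen_fun_holomorphic: "eigen_fun p holomorphic_on right_half_plane"
proof -
  have "(\<lambda>w. poly p (quasi_period w)) holomorphic_on right_half_plane"
    unfolding quasi_period_def poly_altdef
    by (intro holomorphic_intros Ln_shift_holomorphic c)
  moreover have "(\<lambda>w. (w + c) powr eigen_exponent) holomorphic_on right_half_plane"
  proof (rule holomorphic_transform)
    show "(\<lambda>w. exp (eigen_exponent * Ln (w + c))) holomorphic_on right_half_plane"
      by (intro holomorphic_intros Ln_shift_holomorphic c)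
    show "exp (eigen_exponent * Ln (w + c)) = (w + c) powr eigen_exponent" if "w \<in> right_half_plane" for w
      using shifted_rhp_neq_0[OF that c] by (auto simp: powr_def)
  qed
  ultimately show ?thesis
    unfolding eigen_fun_def[abs_def] by (intro holomorphic_on_mult)
qed

lemma eigen_fun_bound:
  "\<exists>K. \<forall>w\<in>right_half_plane. cmod (eigen_fun p w) \<le> K * cmod (w + c) powr Re eigen_exponent"
proof -
  define B where "B = exp (2 * pi * pi / ln a)"
  have "bounded (poly p ` cball 0 B)"
    by (intro compact_imp_bounded compact_continuous_image continuous_intros compact_cball)
  then obtain P where "\<forall>z\<in>cball 0 B. cmod (poly p z) \<le> P"
    unfolding bounded_iff by auto
  then have P: "cmod (poly p z) \<le> P" if "cmod z \<le> B" for z using that by simp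
  have "cmod (eigen_fun p w) \<le> (exp (\<bar>Im eigen_exponent\<bar> * pi) * P) * cmod (w + c) powr Re eigen_exponent"
    if w: "w \<in> right_half_plane" for w
  proof -
    have nz: "w + c \<noteq> 0" by (rule shifted_rhp_neq_0[OF w c])
    have "cmod (eigen_fun p w) \<le> exp (\<bar>Im eigen_exponent\<bar> * pi) * cmod (w + c) powr Re eigen_exponent * P"
      unfolding eigen_fun_def norm_mult
      using quasi_period_bound[OF w] by (intro mult_mono cmod_powr_le nz P) (auto simp: B_def)
    then show ?thesis by (simp add: mult_ac)
  qed
  then show ?thesis by blast
qed

text \<open>The dilation adds \<open>ln a\<close> to the logarithm: the power gains
  \<open>exp (Ln l)\<close>, the quasi-period \<open>exp (2 * pi * \<i>) = 1\<close>.\<close>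

lemma eigen_fun_dilation:
  assumes w: "w \<in> right_half_plane" and w': "w' + c = complex_of_real a * (w + c)"
  shows "eigen_fun p w' = l * eigen_fun p w"
proof -
  have nz: "w + c \<noteq> 0" by (rule shifted_rhp_neq_0[OF w c])
  have lna: "complex_of_real (ln a) \<noteq> 0" using a by simp
  have Ln: "Ln (w' + c) = complex_of_real (ln a) + Ln (w + c)"
    unfolding w' using a nz by (simp add: Ln_times_of_real Ln_of_real)
  have "2 * complex_of_real pi * \<i> / complex_of_real (ln a) * (complex_of_real (ln a) + Ln (w + c))
      = 2 * complex_of_real pi * \<i> + 2 * complex_of_real pi * \<i> / complex_of_real (ln a) * Ln (w + c)"
    using lna by (simp add: field_simps)
  then have q: "quasi_period w' = quasi_period w"
    by (simp only: quasi_period_def Ln exp_add exp_two_pi_i mult_1_left)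
  have "(w' + c) powr eigen_exponent = exp (eigen_exponent * (complex_of_real (ln a) + Ln (w + c)))"
    using nz a Ln by (simp add: powr_def w')
  also have "\<dots> = exp (Ln l) * (w + c) powr eigen_exponent"
    using nz lna by (simp add: powr_def exp_add[symmetric] eigen_exponent_def field_simps)
  also have "exp (Ln l) = l" using l by (intro exp_Ln) auto
  finally show ?thesis unfolding eigen_fun_def q by simp
qed

text \<open>Where \<open>w + c = a powr t\<close>, the value is
  \<open>exp (2 * pi * \<i> * t)\<close>, injective for \<open>t\<close> in an open interval of
  length 1. Such \<open>w\<close> lie in the half-plane for \<open>t > t0\<close>.\<close>

lemma infinite_range_quasi_period: "infinite (quasi_period ` right_half_plane)"
proof
  assume fin: "finite (quasi_period ` right_half_plane)"
  define t0 where "t0 = ln (Re c) / ln a"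
  have lna: "ln a > 0" using a by simp
  define W where "W t = complex_of_real (exp (t * ln a)) - c" for t
  have W: "W t \<in> right_half_plane" if "t > t0" for t
  proof -
    have "ln (Re c) < t * ln a" using that lna by (simp add: t0_def pos_divide_less_eq)
    then have "exp (ln (Re c)) < exp (t * ln a)" by simp
    then show ?thesis using c by (simp add: W_def right_half_plane_def)
  qed
  have qW: "quasi_period (W t) = exp (2 * complex_of_real pi * \<i> * complex_of_real t)" for t
  proof -
    have "Ln (W t + c) = complex_of_real (t * ln a)"
      by (simp add: W_def Ln_of_real)
    then show ?thesis using lna by (simp add: quasi_period_def mult_ac)
  qed
  have "inj_on (\<lambda>t. quasi_period (W t)) {t0<..<t0 + 1}"
  proof (rule inj_onI)
    fix t u assume tu: "t \<in> {t0<..<t0 + 1}" "u \<in> {t0<..<t0 + 1}" and eq: "quasi_period (W t) = quasi_period (W u)"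
    then obtain n :: int where "2 * complex_of_real pi * \<i> * complex_of_real t
        = 2 * complex_of_real pi * \<i> * complex_of_real u + (of_int (2 * n) * pi) * \<i>"
      unfolding qW exp_eq by blast
    then have "2 * complex_of_real pi * \<i> * complex_of_real t = 2 * complex_of_real pi * \<i> * complex_of_real (u + of_int n)"
      by (simp add: algebra_simps)
    then have tn: "t = u + of_int n" by (simp del: of_real_add)
    then have "\<bar>real_of_int n\<bar> < 1" using tu by auto
    then have "n = 0" by linarith
    then show "t = u" using tn by simp
  qed
  then have "infinite ((\<lambda>t. quasi_period (W t)) ` {t0<..<t0 + 1})"
    by (simp add: finite_image_iff infinite_Ioo)
  moreover have "(\<lambda>t. quasi_period (W t)) ` {t0<..<t0 + 1} \<subseteq> quasi_period ` right_half_plane"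
    using W by auto
  ultimately show False using fin finite_subset by blast
qed

text \<open>The power has no zero, so \<open>p\<close> would vanish on the infinite range of
  \<open>quasi_period\<close>.\<close>

lemma eigen_fun_eq_zero_imp:
  assumes "\<And>w. w \<in> right_half_plane \<Longrightarrow> eigen_fun p w = 0"
  shows "p = 0"
proof (rule ccontr)
  assume "p \<noteq> 0"
  then have "finite {z. poly p z = 0}" by (rule poly_roots_finite)
  moreover have "quasi_period ` right_half_plane \<subseteq> {z. poly p z = 0}"
  proof safe
    fix w assume w: "w \<in> right_half_plane"
    have "w + c \<noteq> 0" by (rule shifted_rhp_neq_0[OF w c])
    then show "poly p (quasi_period w) = 0" using assms[OF w] by (simp add: eigen_fun_def)
  qed
  ultimately show False using infinite_range_quasi_period finite_subset by blast
qed

definition eigen_vec :: "complex poly \<Rightarrow> h2" where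
  "eigen_vec p = (SOME f. \<forall>w\<in>right_half_plane. Rep_h2 f w = eigen_fun p w)"

lemma Rep_eigen_vec: "w \<in> right_half_plane \<Longrightarrow> Rep_h2 (eigen_vec p) w = eigen_fun p w"
proof -
  obtain K where K: "\<And>w. w \<in> right_half_plane \<Longrightarrow> cmod (eigen_fun p w) \<le> K * cmod (w + c) powr Re eigen_exponent"
    using eigen_fun_bound by blast
  obtain f where "\<And>w. w \<in> right_half_plane \<Longrightarrow> Rep_h2 f w = eigen_fun p w"
    using h2_of_powr_bound[OF eigen_fun_holomorphic c Re_eigen_exponent K] by blast
  then have "\<forall>w\<in>right_half_plane. Rep_h2 (eigen_vec p) w = eigen_fun p w"
    unfolding eigen_vec_def by (intro someI_ex[of "\<lambda>f. \<forall>w\<in>right_half_plane. Rep_h2 f w = eigen_fun p w"]) blast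
  then show "w \<in> right_half_plane \<Longrightarrow> Rep_h2 (eigen_vec p) w = eigen_fun p w" by blast
qed

lemma eigen_vec_add: "eigen_vec (p + q) = eigen_vec p + eigen_vec q"
  by (rule h2_eqI) (simp add: Rep_h2_plus Rep_eigen_vec eigen_fun_def distrib_left)

lemma eigen_vec_smult: "eigen_vec (smult k p) = k *\<^sub>C eigen_vec p"
  by (rule h2_eqI) (simp add: Rep_h2_scaleC Rep_eigen_vec eigen_fun_def)

lemma eigen_vec_eq_zero_imp: "eigen_vec p = 0 \<Longrightarrow> p = 0"
  by (rule eigen_fun_eq_zero_imp) (simp add: zero_h2.rep_eq flip: Rep_eigen_vec)

text \<open>Injectivity of \<open>eigen_vec\<close> carries the strict chain of polynomials of
  degree below \<open>n\<close> over to eigenvectors.\<close>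

lemma eigen_space_chain:
  defines "M \<equiv> \<lambda>n. eigen_vec ` {p. \<forall>i\<ge>n. coeff p i = 0}"
  shows "csubspace (M n)" "M n \<subset> M (Suc n)"
proof -
  have zero: "eigen_vec 0 = 0" using eigen_vec_smult[of 0 0] by simp
  have sc: "k *\<^sub>C x \<in> M n" if "x \<in> M n" for k x
    using that unfolding M_def
    by (auto simp: eigen_vec_smult[symmetric] intro!: imageI)
  show "csubspace (M n)"
    unfolding csubspace_def
  proof (intro conjI allI ballI sc)
    show "subspace (M n)"
    proof (rule subspaceI)
      show "0 \<in> M n" unfolding M_def using zero by (intro image_eqI[of _ _ 0]) auto
      show "x + y \<in> M n" if "x \<in> M n" "y \<in> M n" for x y
        using that unfolding M_def by (auto simp: eigen_vec_add[symmetric] intro!: imageI)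
      show "r *\<^sub>R x \<in> M n" if "x \<in> M n" for r x
        using sc[OF that, of "complex_of_real r"] by (simp add: scaleC_of_real)
    qed
  qed
  have "eigen_vec (monom 1 n) \<in> M (Suc n)" unfolding M_def by (intro imageI) auto
  moreover have "eigen_vec (monom 1 n) \<notin> M n"
  proof
    assume "eigen_vec (monom 1 n) \<in> M n"
    then obtain p where p: "\<forall>i\<ge>n. coeff p i = 0" "eigen_vec (monom 1 n) = eigen_vec p"
      unfolding M_def by auto
    have "eigen_vec (monom 1 n + smult (-1) p) = 0"
      unfolding eigen_vec_add eigen_vec_smult p(2) by (simp add: scaleC_minus_left)
    then have "monom 1 n + smult (-1) p = 0" by (rule eigen_vec_eq_zero_imp)
    then have "coeff (monom 1 n + smult (-1) p) n = 0" by simp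
    then show False using p(1) by simp
  qed
  moreover have "M n \<subseteq> M (Suc n)" unfolding M_def by (intro image_mono) auto
  ultimately show "M n \<subset> M (Suc n)" by blast
qed

end

section \<open>Contracting maps\<close>

lemma affine_fixed_point:
  assumes "a < 1"
  shows "complex_of_real a * (b / complex_of_real (1 - a)) + b = b / complex_of_real (1 - a)"
proof -
  have "1 - complex_of_real a \<noteq> 0" using assms by (simp add: complex_eq_iff)
  then show ?thesis by (simp add: field_simps)
qed

text \<open>In the coordinate \<open>u = w - w0\<close> centred at the fixed point, an eigenfunction is
  \<open>u ^ n * h u\<close> with \<open>h (a * u) = h u\<close>, so \<open>h\<close> is constant by continuity at \<open>0\<close>; but a multiple
  of \<open>u ^ n\<close> is not square integrable.\<close>

lemma contracting_point_spectrum_empty: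
  assumes a: "0 < a" "a < 1" and b: "0 < Re b"
  shows "point_spectrum (affine_op a b) = {}"
proof (rule ccontr)
  assume "point_spectrum (affine_op a b) \<noteq> {}"
  then obtain l x where x: "x \<noteq> 0" and ev: "affine_op a b x = l *\<^sub>C x"
    unfolding point_spectrum_def by blast
  define f where "f = Rep_h2 x"
  define w0 where "w0 = b / complex_of_real (1 - a)"
  have Rw0: "Re w0 > 0" using a b by (simp add: w0_def Re_divide_of_real del: of_real_diff)
  have w0: "w0 \<in> right_half_plane" using Rw0 by (simp add: right_half_plane_def)
  have w0b: "complex_of_real a * w0 + b = w0"
    unfolding w0_def by (rule affine_fixed_point[OF a(2)])
  have hol: "f holomorphic_on right_half_plane" unfolding f_def by (rule Rep_h2_holomorphic)
  have conv: "w0 + complex_of_real t * u \<in> right_half_plane" if "w0 + u \<in> right_half_plane" "0 < t" "t \<le> 1" for t u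
  proof -
    have "0 \<le> (1 - t) * Re w0" using Rw0 that by simp
    moreover have "0 < t * Re (w0 + u)" using that by (simp add: right_half_plane_def)
    ultimately have "0 < (1 - t) * Re w0 + t * Re (w0 + u)" by linarith
    then show ?thesis by (simp add: right_half_plane_def algebra_simps)
  qed
  have feq: "f (w0 + complex_of_real a * u) = l * f (w0 + u)" if "w0 + u \<in> right_half_plane" for u
  proof -
    have "w0 + complex_of_real a * u = complex_of_real a * (w0 + u) + b"
      using w0b by (simp add: algebra_simps)
    then have "f (w0 + complex_of_real a * u) = Rep_h2 (affine_op a b x) (w0 + u)"
      using Rep_affine_op[OF a(1) b that] by (simp add: f_def)
    then show ?thesis by (simp add: ev Rep_h2_scaleC f_def)
  qed
  have fne: "\<exists>w\<in>right_half_plane. f w \<noteq> 0"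
  proof (rule ccontr)
    assume "\<not> ?thesis"
    then have "x = 0" by (intro h2_eqI) (auto simp: f_def zero_h2.rep_eq)
    with x show False by simp
  qed
  \<comment> \<open>The order of vanishing at the fixed point: \<open>n = 0\<close> with
    \<open>g = f\<close> if \<open>f w0\<close> is nonzero, and otherwise the local factorisation of
    a non-constant function.\<close>
  have "\<exists>n g r. 0 < r \<and> ball w0 r \<subseteq> right_half_plane \<and> isCont g w0 \<and> g w0 \<noteq> 0 \<and> (\<forall>w\<in>ball w0 r. f w = (w - w0) ^ n * g w)"
  proof (cases "f w0 = 0")
    case False
    obtain r where "0 < r" "ball w0 r \<subseteq> right_half_plane" using open_rhp w0 by (meson open_contains_ball)
    moreover have "isCont f w0"
      using holomorphic_on_imp_continuous_on[OF hol] open_rhp w0 by (simp add: continuous_on_eq_continuous_at)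
    ultimately show ?thesis using False by (intro exI[of _ 0] exI[of _ f] exI[of _ r]) auto
  next
    case True
    have "\<not> f constant_on right_half_plane" using fne True w0 unfolding constant_on_def by metis
    moreover have "connected right_half_plane"
      unfolding right_half_plane_def by (intro convex_connected convex_halfspace_Re_gt)
    ultimately obtain g r n where g: "0 < r" "ball w0 r \<subseteq> right_half_plane" "g holomorphic_on ball w0 r"
      "\<And>w. w \<in> ball w0 r \<Longrightarrow> f w = (w - w0) ^ n * g w" "\<And>w. w \<in> ball w0 r \<Longrightarrow> g w \<noteq> 0"
      using holomorphic_factor_zero_nonconstant[OF hol open_rhp _ w0 True] by metis
    have "isCont g w0"
      using holomorphic_on_imp_continuous_on[OF g(3)] g(1) by (simp add: continuous_on_eq_continuous_at)
    then show ?thesis using g by (intro exI[of _ n] exI[of _ g] exI[of _ r]) auto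
  qed
  then obtain n g r where r: "0 < r" "ball w0 r \<subseteq> right_half_plane" and g: "isCont g w0" "g w0 \<noteq> 0"
    and fg: "\<And>w. w \<in> ball w0 r \<Longrightarrow> f w = (w - w0) ^ n * g w" by blast
  have main: "f (w0 + u) = g w0 * u ^ n" if u: "w0 + u \<in> right_half_plane" "u \<noteq> 0" for u
  proof -
    \<comment> \<open>\<open>s m\<close> is \<open>f\<close> divided by the \<open>n\<close>-th
      power, at displacement \<open>a ^ m * u\<close> from \<open>w0\<close>. It is a geometric
      sequence with a nonzero limit, so its ratio is 1 and it is constant.\<close>
    define s where "s m = f (w0 + complex_of_real (a ^ m) * u) / (complex_of_real (a ^ m) * u) ^ n" for m
    define \<mu> where "\<mu> = l / complex_of_real a ^ n"
    have step: "s (Suc m) = \<mu> * s m" for m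
    proof -
      have "w0 + complex_of_real (a ^ m) * u \<in> right_half_plane"
        using conv[OF u(1), of "a ^ m"] a by (simp add: power_le_one)
      then have "f (w0 + complex_of_real a * (complex_of_real (a ^ m) * u)) = l * f (w0 + complex_of_real (a ^ m) * u)"
        by (rule feq)
      then show ?thesis by (simp add: s_def \<mu>_def power_mult_distrib mult.assoc)
    qed
    have lim: "(\<lambda>m. w0 + complex_of_real (a ^ m) * u) \<longlonglongrightarrow> w0"
    proof -
      have "(\<lambda>m. w0 + complex_of_real (a ^ m) * u) \<longlonglongrightarrow> w0 + complex_of_real 0 * u"
        by (intro tendsto_intros) (use a in auto)
      then show ?thesis by (simp only: of_real_0 mult_zero_left add_0_right)
    qed
    have "s \<longlonglongrightarrow> g w0"
    proof (rule Lim_transform_eventually)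
      show "(\<lambda>m. g (w0 + complex_of_real (a ^ m) * u)) \<longlonglongrightarrow> g w0"
        by (rule isCont_tendsto_compose[OF g(1) lim])
      have "\<forall>\<^sub>F m in sequentially. w0 + complex_of_real (a ^ m) * u \<in> ball w0 r"
        using lim r(1) by (intro topological_tendstoD) auto
      then show "\<forall>\<^sub>F m in sequentially. g (w0 + complex_of_real (a ^ m) * u) = s m"
      proof eventually_elim
        case (elim m)
        have "complex_of_real (a ^ m) * u \<noteq> 0" using a u by simp
        then show ?case using fg[OF elim] by (simp add: s_def)
      qed
    qed
    note sl = this
    have "(\<lambda>m. \<mu> * s m) \<longlonglongrightarrow> \<mu> * g w0" by (intro tendsto_intros sl)
    moreover have "(\<lambda>m. \<mu> * s m) \<longlonglongrightarrow> g w0" using LIMSEQ_Suc[OF sl] by (simp add: step)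
    ultimately have "\<mu> * g w0 = g w0" by (rule LIMSEQ_unique)
    then have "\<mu> = 1" using g(2) by simp
    then have "s m = s 0" for m by (induction m) (auto simp: step)
    then have "s 0 = g w0" using sl LIMSEQ_unique[of s "s 0" "g w0"] by (metis LIMSEQ_const_iff ext)
    then show ?thesis using u(2) by (simp add: s_def field_simps)
  qed
  \<comment> \<open>On a vertical line at distance 1 from \<open>w0\<close>,
    \<open>cmod u \<ge> 1\<close> holds, so \<open>cmod f\<close> stays above the positive constant
    \<open>cmod (g w0)\<close> on a set of infinite measure.\<close>
  define X where "X = Re w0 + 1"
  have X: "X > 0" using Rw0 by (simp add: X_def)
  have "ennreal ((cmod (g w0))\<^sup>2) \<le> ennreal ((cmod (f (Complex X y)))\<^sup>2)" for y
  proof -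
    define u where "u = Complex X y - w0"
    have "\<bar>Re u\<bar> \<le> cmod u" by (rule abs_Re_le_cmod)
    then have u1: "1 \<le> cmod u" by (simp add: u_def X_def)
    have "w0 + u \<in> right_half_plane" "u \<noteq> 0" using X u1 by (auto simp: u_def)
    then have "f (Complex X y) = g w0 * u ^ n" using main[of u] by (simp add: u_def)
    moreover have "cmod (g w0) * 1 \<le> cmod (g w0) * cmod u ^ n"
      using u1 by (intro mult_left_mono one_le_power) auto
    ultimately have "cmod (g w0) \<le> cmod (f (Complex X y))" by (simp add: norm_mult norm_power)
    then show ?thesis by (intro ennreal_leI power_mono) auto
  qed
  then have "(\<integral>\<^sup>+y. ennreal ((cmod (g w0))\<^sup>2) \<partial>(lborel :: real measure)) \<le> line_integral f X"
    unfolding line_integral_def by (intro nn_integral_mono)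
  also have "\<dots> < \<infinity>" unfolding f_def by (rule h2_functions_line_finite[OF Rep_h2 X])
  finally show False using g(2) by (simp add: ennreal_mult_top)
qed

locale contracting_affine =
  fixes a :: real and b l :: complex
  assumes a: "0 < a" "a < 1" and b: "0 < Re b" and l: "0 < cmod l" "cmod l * sqrt a < 1"
begin

definition w0 :: complex where "w0 = b / complex_of_real (1 - a)"
text \<open>Chosen so that \<open>a powr s = 1 / (l * a)\<close>; the factor \<open>a\<close>
  compensates the change of variables in \<open>functional\<close>.\<close>

definition s :: complex where "s = - Ln l / complex_of_real (ln a) - 1"

text \<open>The adjoint of the composition operator has the eigenvalue \<open>l\<close>: its eigenfunctional integrates
  against a power of \<open>w0 - w\<close>, where \<open>w0\<close> is the fixed point of the map, over any vertical line to
  the left of \<open>w0\<close>.\<close>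

definition functional :: "real \<Rightarrow> h2 \<Rightarrow> complex" where
  "functional x f = (LINT y|lborel. Rep_h2 f (Complex x y) * (w0 - Complex x y) powr s)"

lemma Re_w0: "0 < Re w0"
  using a b by (simp add: w0_def Re_divide_of_real del: of_real_diff)

lemma fixed_point: "complex_of_real a * w0 + b = w0"
  unfolding w0_def by (rule affine_fixed_point[OF a(2)])

text \<open>Again \<open>cmod l < a powr (-1/2)\<close> is what makes the kernel square integrable
  on vertical lines; here \<open>ln a\<close> is negative.\<close>

lemma Re_s: "Re s < -1/2"
proof -
  have "ln (cmod l * sqrt a) < 0" using l a by simp
  then have "ln (cmod l) + ln a / 2 < 0" using l a by (simp add: ln_mult ln_sqrt)
  moreover have lna: "ln a < 0" using a by simp
  moreover have "(Re s + 1) * ln a = - ln (cmod l)"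
    using l lna by (simp add: s_def Re_divide_of_real Re_Ln)
  ultimately have "(Re s + 1 / 2) * ln a > 0" by (simp add: distrib_right)
  then show ?thesis using lna by (simp add: zero_less_mult_iff)
qed

lemma kernel_measurable:
  assumes "x < Re w0"
  shows "(\<lambda>y. (w0 - Complex x y) powr s) \<in> borel_measurable borel"
proof (rule borel_measurable_continuous_onI)
  have nr: "w0 - (complex_of_real x + \<i> * complex_of_real y) \<notin> \<real>\<^sub>\<le>\<^sub>0" for y
    using assms by (auto simp: complex_nonpos_Reals_iff)
  have "(w0 - Complex x y) powr s = exp (s * Ln (w0 - (complex_of_real x + \<i> * complex_of_real y)))" for y
    using nr[of y] unfolding Complex_eq powr_def by auto
  then show "continuous_on UNIV (\<lambda>y. (w0 - Complex x y) powr s)"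
    using nr by (simp only:) (intro continuous_intros; simp)
qed

text \<open>Cauchy-Schwarz; the bound depends on \<open>x2\<close> but not on \<open>x\<close>, as
  moving the line of integration demands.\<close>

lemma functional_integrand_bound:
  assumes x: "0 < x" "x \<le> x2" "x2 < Re w0"
  shows "(\<integral>\<^sup>+y. ennreal (cmod (Rep_h2 f (Complex x y) * (w0 - Complex x y) powr s)) \<partial>lborel)
    \<le> ennreal (norm f * sqrt (exp (\<bar>Im s\<bar> * pi) ^ 2 * enn2real (powr_line_bound (Re w0 - x2) (Re s))))"
proof (rule nn_integral_cauchy_schwarz)
  let ?K = "exp (\<bar>Im s\<bar> * pi)"
  have d: "0 < Re w0 - x2" using x by simp
  show "(\<lambda>y. Rep_h2 f (Complex x y)) \<in> borel_measurable borel" by (rule Rep_h2_line_measurable[OF x(1)])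
  show "(\<lambda>y. (w0 - Complex x y) powr s) \<in> borel_measurable borel" using x by (intro kernel_measurable) simp
  show "(\<integral>\<^sup>+y. ennreal ((cmod (Rep_h2 f (Complex x y)))\<^sup>2) \<partial>lborel) \<le> ennreal ((norm f)\<^sup>2)"
    using line_integral_le_norm[OF x(1)] by (simp add: line_integral_def)
  have "(\<integral>\<^sup>+y. ennreal ((cmod ((w0 - Complex x y) powr s))\<^sup>2) \<partial>lborel)
      \<le> ennreal (?K\<^sup>2) * powr_line_bound (Re w0 - x2) (Re s)"
  proof (rule nn_integral_powr_line[where X = "Re w0 - x" and b = "- Im w0"])
    show "cmod ((w0 - Complex x y) powr s) \<le> ?K * cmod (Complex (Re w0 - x) (- Im w0 + y)) powr Re s" for y
    proof -
      have "w0 - Complex x y \<noteq> 0" using x by (auto simp: complex_eq_iff)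
      moreover have "cmod (w0 - Complex x y) = cmod (Complex (Re w0 - x) (- Im w0 + y))"
        by (simp add: cmod_def power2_commute)
      ultimately show ?thesis using cmod_powr_le[of "w0 - Complex x y" s] by simp
    qed
  qed (use d x Re_s in auto)
  also have "\<dots> = ennreal (?K\<^sup>2 * enn2real (powr_line_bound (Re w0 - x2) (Re s)))"
    using powr_line_bound_finite[OF d Re_s] by (simp add: ennreal_mult)
  finally show "(\<integral>\<^sup>+y. ennreal ((cmod ((w0 - Complex x y) powr s))\<^sup>2) \<partial>lborel)
      \<le> ennreal ((sqrt (?K\<^sup>2 * enn2real (powr_line_bound (Re w0 - x2) (Re s))))\<^sup>2)"
    by simp
qed auto

lemma functional_integrable:
  assumes x: "0 < x" "x < Re w0"
  shows "integrable lborel (\<lambda>y. Rep_h2 f (Complex x y) * (w0 - Complex x y) powr s)"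
proof (rule integrableI_bounded)
  note [measurable] = Rep_h2_line_measurable[OF x(1)] kernel_measurable[OF x(2)]
  show "(\<lambda>y. Rep_h2 f (Complex x y) * (w0 - Complex x y) powr s) \<in> borel_measurable lborel"
    by measurable
  show "(\<integral>\<^sup>+y. ennreal (cmod (Rep_h2 f (Complex x y) * (w0 - Complex x y) powr s)) \<partial>lborel) < \<infinity>"
    using x by (intro le_less_trans[OF functional_integrand_bound[of x x]]) auto
qed

lemma functional_shift:
  assumes x: "0 < x1" "x1 < x2" "x2 < Re w0"
  shows "functional x1 f = functional x2 f"
  unfolding functional_def
proof (rule line_integral_shift[OF _ x, where
      M = "norm f * sqrt (exp (\<bar>Im s\<bar> * pi) ^ 2 * enn2real (powr_line_bound (Re w0 - x2) (Re s)))"])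
  have "w0 - w \<notin> \<real>\<^sub>\<le>\<^sub>0" if "Re w < Re w0" for w using that by (auto simp: complex_nonpos_Reals_iff)
  then show "(\<lambda>w. Rep_h2 f w * (w0 - w) powr s) holomorphic_on {z. 0 < Re z \<and> Re z < Re w0}"
    by (intro holomorphic_on_mult holomorphic_on_subset[OF Rep_h2_holomorphic] holomorphic_intros)
      (auto simp: right_half_plane_def)
qed (use x functional_integrand_bound in auto)

lemma functional_diff:
  assumes "0 < x" "x < Re w0"
  shows "functional x (f - l *\<^sub>C g) = functional x f - l * functional x g"
  unfolding functional_def Rep_h2_minus Rep_h2_scaleC left_diff_distrib mult.assoc
  using functional_integrable[OF assms] by simp

text \<open>As \<open>w0\<close> is fixed, \<open>w0 - (a * w + b) = a * (w0 - w)\<close>, so the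
  substitution only produces constants: \<open>l * a\<close> from the power and \<open>1 / a\<close>
  from the measure.\<close>

lemma functional_affine_op:
  assumes x: "0 < x" "x < Re w0"
  shows "functional x (affine_op a b f) = l * functional (a * x + Re b) f"
proof -
  define G where "G y = Rep_h2 f (Complex (a * x + Re b) y) * (w0 - Complex (a * x + Re b) y) powr s" for y
  have lna: "ln a \<noteq> 0" using a by simp
  have pt: "Rep_h2 (affine_op a b f) (Complex x y) * (w0 - Complex x y) powr s
      = complex_of_real a * l * G (Im b + a * y)" for y
  proof -
    have w': "Complex (a * x + Re b) (Im b + a * y) = complex_of_real a * Complex x y + b"
      by (simp add: complex_eq_iff)
    have nz: "w0 - Complex x y \<noteq> 0" using x by (auto simp: complex_eq_iff)
    have "w0 - Complex (a * x + Re b) (Im b + a * y) = complex_of_real a * (w0 - Complex x y)"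
      unfolding w' using fixed_point by (simp add: algebra_simps)
    moreover have "(complex_of_real a * (w0 - Complex x y)) powr s
        = exp (s * complex_of_real (ln a)) * (w0 - Complex x y) powr s"
      using nz a by (simp add: powr_def Ln_times_of_real Ln_of_real exp_add[symmetric] distrib_left)
    moreover have "s * complex_of_real (ln a) = - Ln l - complex_of_real (ln a)"
      using lna by (simp add: s_def field_simps)
    moreover have "exp (- Ln l - complex_of_real (ln a)) = 1 / (l * complex_of_real a)"
      using l a by (simp add: exp_diff exp_minus field_simps exp_of_real)
    ultimately have "(w0 - Complex (a * x + Re b) (Im b + a * y)) powr s
        = 1 / (l * complex_of_real a) * (w0 - Complex x y) powr s" by simp
    moreover have "Rep_h2 (affine_op a b f) (Complex x y) = Rep_h2 f (Complex (a * x + Re b) (Im b + a * y))"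
      unfolding w' using x by (intro Rep_affine_op a b) simp
    ultimately show ?thesis using l a by (simp add: G_def)
  qed
  have "functional x (affine_op a b f) = complex_of_real a * l * (LINT y|lborel. G (Im b + a * y))"
    unfolding functional_def pt by (rule integral_mult_right_zero)
  moreover have "functional (a * x + Re b) f = \<bar>a\<bar> *\<^sub>R (LINT y|lborel. G (Im b + a * y))"
    unfolding functional_def G_def[symmetric] using a by (intro lborel_integral_real_affine) auto
  ultimately show ?thesis using a by (simp add: scaleR_conv_of_real)
qed

text \<open>The map moves the line at \<open>x\<close> strictly towards \<open>w0\<close>, still on
  its left, and there the functional does not depend on the line; so it takes
  \<open>affine_op a b f\<close> to \<open>l\<close> times its value at \<open>f\<close>.\<close>

lemma functional_range:
  assumes x: "0 < x" "x < Re w0"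
  shows "functional x (affine_op a b f - l *\<^sub>C f) = 0"
proof -
  have "Re (complex_of_real a * w0 + b) = Re w0" by (simp only: fixed_point)
  then have w0: "Re w0 = a * Re w0 + Re b" by simp
  have "(1 - a) * x < (1 - a) * Re w0" using x a by (intro mult_strict_left_mono) auto
  then have 1: "x < a * x + Re b" using w0 by (simp add: algebra_simps)
  have "a * x < a * Re w0" using x a by simp
  then have 2: "a * x + Re b < Re w0" using w0 by linarith
  have "functional x f = functional (a * x + Re b) f" by (rule functional_shift[OF x(1) 1 2])
  then show ?thesis by (simp add: functional_diff[OF x] functional_affine_op[OF x])
qed

lemma functional_nonzero: "\<exists>g x. 0 < x \<and> x < Re w0 \<and> functional x g \<noteq> 0"
proof -
  define x where "x = Re w0 / 4"
  \<comment> \<open>On the line at \<open>x\<close>, \<open>cnj w = 2 * x - w\<close>, so the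
    conjugate of the kernel extends from it holomorphically as a power of \<open>w + d\<close>;
    \<open>x = Re w0 / 4\<close> keeps \<open>Re d\<close> positive. The functional of this
    extension is its squared norm on the line.\<close>
  define d where "d = cnj w0 - complex_of_real (2 * x)"
  have x: "0 < x" "x < Re w0" using Re_w0 by (auto simp: x_def)
  have d: "0 < Re d" using Re_w0 by (simp add: d_def x_def)
  have nr: "w + d \<notin> \<real>\<^sub>\<le>\<^sub>0" if "w \<in> right_half_plane" for w
    using that d by (auto simp: complex_nonpos_Reals_iff right_half_plane_def)
  obtain g where g: "\<And>w. w \<in> right_half_plane \<Longrightarrow> Rep_h2 g w = (w + d) powr cnj s"
  proof (rule h2_of_powr_bound[of "\<lambda>w. (w + d) powr cnj s" d "Re s" "exp (\<bar>Im s\<bar> * pi)"])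
    show "(\<lambda>w. (w + d) powr cnj s) holomorphic_on right_half_plane"
      using nr by (intro holomorphic_intros) auto
    show "cmod ((w + d) powr cnj s) \<le> exp (\<bar>Im s\<bar> * pi) * cmod (w + d) powr Re s" if "w \<in> right_half_plane" for w
      using cmod_powr_le[OF shifted_rhp_neq_0[OF that d], of "cnj s"] by simp
  qed (use d Re_s in auto)
  have eq: "(w0 - Complex x y) powr s = cnj (Rep_h2 g (Complex x y))" for y
  proof -
    have "Complex x y + d = cnj (w0 - Complex x y)" by (simp add: d_def complex_eq_iff)
    moreover have "cnj (w0 - Complex x y) powr cnj s = cnj ((w0 - Complex x y) powr s)"
      using x by (intro cnj_powr[symmetric]) (auto simp: complex_eq_iff)
    ultimately show ?thesis using g[of "Complex x y"] x by simp
  qed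
  have "functional x g = complex_of_real (line_normsq g x)"
    using line_ip_self[OF x(1), of g] by (simp add: functional_def line_ip_def eq)
  moreover have "line_normsq g x \<noteq> 0"
  proof
    assume 0: "line_normsq g x = 0"
    note [measurable] = Rep_h2_line_measurable[OF x(1)]
    have "line_integral (Rep_h2 g) x = 0" using ennreal_line_normsq[OF x(1), of g] 0 by simp
    then have "emeasure lborel {y. Rep_h2 g (Complex x y) \<noteq> 0} = 0"
      unfolding line_integral_def by (subst (asm) nn_integral_0_iff) auto
    moreover have "Rep_h2 g (Complex x y) \<noteq> 0" for y
      using g[of "Complex x y"] x shifted_rhp_neq_0[OF _ d, of "Complex x y"] by simp
    ultimately show False by simp
  qed
  ultimately show ?thesis using x by (intro exI[of _ g] exI[of _ x]) simp
qed

lemma mem_spectrum: "l \<in> spectrum (affine_op a b)"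
proof (rule ccontr)
  assume "l \<notin> spectrum (affine_op a b)"
  then obtain S where S: "\<And>f. affine_op a b (S f) - l *\<^sub>C S f = f" unfolding spectrum_def by blast
  obtain g x where "0 < x" "x < Re w0" "functional x g \<noteq> 0" using functional_nonzero by blast
  then show False using functional_range[of x "S g"] S[of g] by simp
qed

end

section \<open>Closed disc, separating evaluations and the theorem\<close>

lemma closed_punctured_disc:
  assumes S: "closed (S :: complex set)" and r: "0 < r" and sub: "{l. 0 < cmod l \<and> cmod l < r} \<subseteq> S"
  shows "{l. cmod l \<le> r} \<subseteq> S"
proof safe
  fix l assume l: "cmod l \<le> r"
  have "\<exists>y\<in>S. dist y l < e" if e: "e > 0" for e
  proof (cases "l = 0")
    case True
    have "complex_of_real (min (e / 2) (r / 2)) \<in> S" using e r by (intro subsetD[OF sub]) auto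
    moreover have "dist (complex_of_real (min (e / 2) (r / 2))) l < e" using True e r by (simp add: dist_norm)
    ultimately show ?thesis by blast
  next
    case False
    define t where "t = min (1 / 2) (e / (2 * cmod l))"
    have t: "0 < t" "t < 1" using e False by (auto simp: t_def)
    have "t * cmod l \<le> e / (2 * cmod l) * cmod l" by (intro mult_right_mono) (auto simp: t_def)
    then have te: "t * cmod l < e" using e False by simp
    have "cmod (complex_of_real (1 - t) * l) = (1 - t) * cmod l"
      using t by (simp add: norm_mult del: of_real_diff)
    moreover have "(1 - t) * cmod l < 1 * cmod l" using t False by (intro mult_strict_right_mono) auto
    then have "(1 - t) * cmod l < r" using l by linarith
    moreover have "0 < (1 - t) * cmod l" using t False by simp
    ultimately have "complex_of_real (1 - t) * l \<in> S"
      using t False by (intro subsetD[OF sub]) auto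
    moreover have "dist (complex_of_real (1 - t) * l) l < e"
    proof -
      have "complex_of_real (1 - t) * l - l = - (complex_of_real t * l)" by (simp add: algebra_simps)
      then show ?thesis using te t by (simp add: dist_norm norm_mult)
    qed
    ultimately show ?thesis by blast
  qed
  then show "l \<in> S" using closed_approachable[OF S] by blast
qed

text \<open>The points accumulate at \<open>1\<close> inside the half-plane, so the identity theorem
  applies. Evaluations at them form the separating sequence for the universality criterion.\<close>

lemma h2_eq_zero_if_sequence:
  assumes "\<And>n. Rep_h2 f (complex_of_real (1 + 1 / real (Suc n))) = 0"
  shows "f = 0"
proof (rule h2_eqI)
  fix w assume w: "w \<in> right_half_plane"
  let ?U = "range (\<lambda>n. complex_of_real (1 + 1 / real (Suc n)))"
  have "Rep_h2 f w = 0"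
  proof (rule analytic_continuation[OF Rep_h2_holomorphic open_rhp, where U = ?U and \<xi> = 1])
    show "connected right_half_plane"
      unfolding right_half_plane_def by (intro convex_connected convex_halfspace_Re_gt)
    show "?U \<subseteq> right_half_plane" by (auto simp: right_half_plane_def add_pos_pos)
    show "1 \<in> right_half_plane" by (simp add: right_half_plane_def)
    have "(\<lambda>n. complex_of_real (1 + 1 / real (Suc n))) \<longlonglongrightarrow> complex_of_real (1 + 0)"
      using LIMSEQ_inverse_real_of_nat by (intro tendsto_intros) (simp add: inverse_eq_divide)
    then show "1 islimpt ?U"
      unfolding islimpt_sequential
      by (intro exI[of _ "\<lambda>n. complex_of_real (1 + 1 / real (Suc n))"]) (auto simp: complex_eq_iff)
  qed (use assms w in auto)
  then show "Rep_h2 f w = Rep_h2 0 w" by (simp add: zero_h2.rep_eq)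
qed

lemma powr_minus_half: "0 < a \<Longrightarrow> a powr (- 1 / 2) = sqrt (1 / a)"
  using powr_minus[of a "1 / 2"] by (simp add: powr_half_sqrt real_sqrt_divide inverse_eq_divide)

context expanding_affine
begin

lemma C_eigen_vec: "C (eigen_vec a c l p) = l *\<^sub>C eigen_vec a c l p"
proof (rule h2_eqI)
  fix w assume w: "w \<in> right_half_plane"
  have "eigen_fun a c l p (complex_of_real a * (w + c) - c) = l * eigen_fun a c l p w"
    by (rule eigen_fun_dilation[OF a c l w]) simp
  then show "Rep_h2 (C (eigen_vec a c l p)) w = Rep_h2 (l *\<^sub>C eigen_vec a c l p) w"
    using w C_maps[OF w] by (simp add: Rep_C Rep_h2_scaleC Rep_eigen_vec[OF a c l])
qed

lemma mem_point_spectrum: "l \<in> point_spectrum C"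
proof -
  have "eigen_vec a c l 1 \<noteq> 0" using eigen_vec_eq_zero_imp[OF a c l, of 1] by auto
  then show ?thesis using C_eigen_vec unfolding point_spectrum_def by blast
qed

lemma universal_C: "universal (\<lambda>f. C f - l *\<^sub>C f)"
proof -
  obtain W where W: "bounded_clinear W" "\<And>f. C (W f) - l *\<^sub>C W f = f" using right_inverse by blast
  define p where "p n = complex_of_real (1 + 1 / real (Suc n))" for n
  have p: "p n \<in> right_half_plane" for n by (simp add: p_def right_half_plane_def add_pos_pos)
  show ?thesis
  proof (rule h2.universal_criterion[where W = W and \<phi> = "\<lambda>n f. Rep_h2 f (p n)"
        and M = "\<lambda>n. eigen_vec a c l ` {q. \<forall>i\<ge>n. coeff q i = 0}"])
    show "bounded_clinear (\<lambda>f. C f - l *\<^sub>C f)" by (intro bounded_clinear_diff C bounded_clinear_scaleC)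
    show "bounded_linear (\<lambda>f. Rep_h2 f (p n))" for n
    proof (rule bounded_linear_intro[where K = "sqrt (8 / Re (p n))"])
      show "Rep_h2 (r *\<^sub>R f) (p n) = r *\<^sub>R Rep_h2 f (p n)" for r f
        using Rep_h2_scaleC[of "complex_of_real r" f "p n"] by (simp add: scaleC_of_real scaleR_conv_of_real)
      show "cmod (Rep_h2 f (p n)) \<le> norm f * sqrt (8 / Re (p n))" for f
        using Rep_h2_bound[OF p] by (simp add: mult.commute)
    qed (rule Rep_h2_plus)
    show "f = 0" if "\<And>n. Rep_h2 f (p n) = 0" for f
      using that unfolding p_def by (rule h2_eq_zero_if_sequence)
    show "csubspace (eigen_vec a c l ` {q. \<forall>i\<ge>n. coeff q i = 0})" for n
      by (rule eigen_space_chain(1)[OF a c l])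
    show "eigen_vec a c l ` {q. \<forall>i\<ge>n. coeff q i = 0} \<subset> eigen_vec a c l ` {q. \<forall>i\<ge>Suc n. coeff q i = 0}" for n
      by (rule eigen_space_chain(2)[OF a c l])
  qed (auto simp: W C_eigen_vec Rep_h2_scaleC)
qed

end

theorem theorem11:
  fixes a :: real and b :: complex and \<psi> :: "complex \<Rightarrow> complex"
  assumes a: "a \<in> {0<..<1} \<union> {1<..}"
    and b: "b \<in> right_half_plane"
    and \<psi>: "\<And>w. w \<in> right_half_plane \<Longrightarrow> \<psi> w = complex_of_real a * w + b"
  shows "(a > 1 \<longrightarrow>
      (\<forall>l. 0 < cmod l \<and> cmod l < a powr (-1/2) \<longrightarrow>
        universal (\<lambda>f. composition_operator \<psi> f - l *\<^sub>C f)) \<and>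
      {l. 0 < cmod l \<and> cmod l < a powr (-1/2)} \<subseteq> point_spectrum (composition_operator \<psi>)) \<and>
    (a < 1 \<longrightarrow>
      (\<forall>l. \<not> universal (\<lambda>f. composition_operator \<psi> f - l *\<^sub>C f)) \<and>
      point_spectrum (composition_operator \<psi>) = {}) \<and>
    spectrum (composition_operator \<psi>) = {l. cmod l \<le> a powr (-1/2)}"
proof -
  have a0: "0 < a" "a \<noteq> 1" using a by auto
  have Rb: "0 < Re b" using b by (simp add: right_half_plane_def)
  define r where "r = a powr (-1/2)"
  have r: "r = sqrt (1 / a)" unfolding r_def using powr_minus_half[OF a0(1)] by simp
  have r0: "0 < r" using a0 by (simp add: r)
  have small: "cmod l * sqrt a < 1" if "cmod l < r" for l
    using that a0 by (simp add: r real_sqrt_divide pos_less_divide_eq)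
  have op: "composition_operator \<psi> = affine_op a b"
    unfolding affine_op_def by (rule composition_operator_cong) (rule \<psi>)
  have ex: "universal (\<lambda>f. affine_op a b f - l *\<^sub>C f)" "l \<in> point_spectrum (affine_op a b)"
    if "a > 1" "0 < cmod l" "cmod l < r" for l
  proof -
    \<comment> \<open>\<open>- c\<close> is the fixed point of the map.\<close>
    define c where "c = b / complex_of_real (a - 1)"
    have "0 < Re c" using that(1) Rb by (simp add: c_def Re_divide_of_real del: of_real_diff)
    then interpret expanding_affine a c l
      using that small by unfold_locales auto
    have "complex_of_real (a - 1) * c = b" using that(1) by (simp add: c_def del: of_real_diff)
    then have "C = affine_op a b" by (simp add: C_def del: of_real_diff)
    then show "universal (\<lambda>f. affine_op a b f - l *\<^sub>C f)" "l \<in> point_spectrum (affine_op a b)"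
      using universal_C mem_point_spectrum by auto
  qed
  have empty: "point_spectrum (affine_op a b) = {}" if "a < 1"
    by (rule contracting_point_spectrum_empty[OF a0(1) that Rb])
  have nonuniv: "\<not> universal (\<lambda>f. affine_op a b f - l *\<^sub>C f)" if "a < 1" for l
  proof
    assume U: "universal (\<lambda>f. affine_op a b f - l *\<^sub>C f)"
    \<comment> \<open>A nonzero element of \<open>h2\<close>: an eigenvector of the auxiliary
      expanding map with factor 2, for the eigenvalue \<open>1/2\<close>.\<close>
    obtain z :: h2 where z: "z \<noteq> 0"
    proof -
      have "cmod (1/2) * sqrt 2 < 1" using sqrt2_less_2 by (simp add: norm_divide)
      then interpret e: expanding_affine 2 1 "1/2" by unfold_locales simp_all
      show ?thesis using that e.mem_point_spectrum unfolding point_spectrum_def by blast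
    qed
    obtain x where "x \<noteq> 0" "affine_op a b x - l *\<^sub>C x = 0"
      using universal_imp_eigenvalue[OF U z] by blast
    then have "l \<in> point_spectrum (affine_op a b)" unfolding point_spectrum_def by auto
    with empty[OF that] show False by blast
  qed
  have bc: "bounded_clinear (affine_op a b)" by (rule bounded_clinear_affine_op[OF a0(1) Rb])
  have "spectrum (affine_op a b) = {l. cmod l \<le> r}"
  proof
    show "spectrum (affine_op a b) \<subseteq> {l. cmod l \<le> r}"
      using spectrum_norm_le[OF bc norm_affine_op[OF a0(1) Rb]] a0 by (auto simp: r)
    \<comment> \<open>Closedness of the spectrum adds the centre and the boundary circle to the open
      punctured disc.\<close>
    show "{l. cmod l \<le> r} \<subseteq> spectrum (affine_op a b)"
    proof (rule closed_punctured_disc[OF closed_spectrum[OF bc] r0], safe)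
      fix l assume l: "0 < cmod l" "cmod l < r"
      show "l \<in> spectrum (affine_op a b)"
      proof (cases "a > 1")
        case True
        then show ?thesis using ex(2)[OF True l] point_spectrum_subset_spectrum by blast
      next
        case False
        then interpret contracting_affine a b l
          using a0 Rb l small by unfold_locales auto
        show ?thesis by (rule mem_spectrum)
      qed
    qed
  qed
  with ex empty nonuniv show ?thesis
    unfolding op r_def[symmetric] by blast
qed

end
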